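(* Let $W$ be a finite Coxeter group with shard intersection order $\preceq$, and let $\Delta(W)$ be the pulling triangulation of the $W$-permutohedron in which the vertices are ordered by the reverse of the weak order. Then there exists a dimension-preserving bijection between the simplices of $\Delta(W)$ and the simplices of the order complex of $(W,\preceq)$.
   Context: Let $(W,S)$ be a finite Coxeter group acting faithfully by orthogonal transformations on a Euclidean space $V$ as a reflection group. Let $T=\{wsw^{-1}\}$ be the reflections, $H_t$ the hyperplane fixed by $t$, $\mathcal A=\{H_t:t\in T\}$. A region is the closure of a connected component of $V\setminus\bigcup\mathcal A$; $B$ is the region whose facet hyperplanes are $\{H_s:s\in S\}$, and $w\mapsto wB$ is a bijection from $W$ to regions. $S(R)$ is the set of hyperplanes separating region $R$ from $B$. The (right) weak order is $u\le w$ iff $S(uB)\subseteq S(wB)$. For distinct $H,H'\in\mathcal A$, let $\mathcal A(H,H')$ be the hyperplanes of $\mathcal A$ containing $H\cap H'$; its basic hyperplanes are the two facet-defining hyperplanes of the region of $\mathcal A(H,H')$ containing $B$. $H$ cuts $H'$ if $H$ is basic in $\mathcal A(H,H')$ and $H'$ is not. The shards in $H$ are the closures of connected components of $H$ minus all hyperplanes cutting $H$; $H(\Sigma)$ is the hyperplane containing shard $\Sigma$. $\Psi$ is the set of all intersections of sets of shards ($V$ = empty intersection). $\Sigma$ is a lower shard of region $R$ if $\dim(R\cap\Sigma)=\dim V-1$ and $H(\Sigma)\in S(R)$; $\psi(w)$ is the intersection of the lower shards of $wB$. The map $\psi$ is a bijection $W\to\Psi$ and the shard intersection order is $u\preceq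 w$ iff $\psi(u)\supseteq\psi(w)$. The $W$-permutohedron is the convex hull of $\{wx:w\in W\}$ for a point $x$ in the interior of $B$; its vertices $wx$ correspond to $w\in W$. Given a partial order on the vertices of a polytope such that every face has a unique minimal vertex, the pulling triangulation is defined recursively: let $v_0$ be the minimal vertex of the polytope, triangulate (by pulling, with the restricted order) each face not containing $v_0$, and cone this triangulated complex from $v_0$. The order complex of a poset is the simplicial complex of its chains; a chain with $k+1$ elements is a $k$-dimensional simplex (the empty chain is the empty simplex). *)

theory Defs
  imports
    "HOL-Analysis.Analysis"
    "HOL-Algebra.Generated_Groups"
    "HOL-Algebra.Multiplicative_Group"
    "HOL-Algebra.Group_Action"
begin

section \<open>Coxeter systems\<close>

text \<open>
  Equality of words over \<open>S\<close> modulo the relations \<open>(s t)^m(s,t) = 1\<close>, where \<open>m(s,t)\<close> is the order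
  of \<open>s t\<close>.  The case \<open>s = t\<close> gives \<open>s s = 1\<close>, so that formal inverses are not needed; a pair of
  infinite order contributes only the trivial relation, because \<open>ord\<close> is then \<open>0\<close>.
\<close>

inductive coxeter_equiv :: "('g, 'b) monoid_scheme \<Rightarrow> 'g set \<Rightarrow> 'g list \<Rightarrow> 'g list \<Rightarrow> bool"
  for G S where
  rel: "\<lbrakk>us \<in> lists S; vs \<in> lists S; s \<in> S; t \<in> S\<rbrakk> \<Longrightarrow>
    coxeter_equiv G S (us @ concat (replicate (group.ord G (s \<otimes>\<^bsub>G\<^esub> t)) [s, t]) @ vs) (us @ vs)"
| refl: "us \<in> lists S \<Longrightarrow> coxeter_equiv G S us us"
| sym: "coxeter_equiv G S us vs \<Longrightarrow> coxeter_equiv G S vs us"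
| trans: "\<lbrakk>coxeter_equiv G S us vs; coxeter_equiv G S vs ws\<rbrakk> \<Longrightarrow> coxeter_equiv G S us ws"

definition coxeter_system :: "('g, 'b) monoid_scheme \<Rightarrow> 'g set \<Rightarrow> bool" where
  "coxeter_system G S \<longleftrightarrow>
     group G \<and> S \<subseteq> carrier G \<and> generate G S = carrier G \<and>
     (\<forall>s\<in>S. group.ord G s = 2) \<and>
     (\<forall>us\<in>lists S. \<forall>vs\<in>lists S.
        foldr (\<otimes>\<^bsub>G\<^esub>) us \<one>\<^bsub>G\<^esub> = foldr (\<otimes>\<^bsub>G\<^esub>) vs \<one>\<^bsub>G\<^esub> \<longrightarrow> coxeter_equiv G S us vs)"

section \<open>Actions as a reflection group\<close>

definition is_reflection :: "('v::euclidean_space \<Rightarrow> 'v) \<Rightarrow> bool" where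
  "is_reflection f \<longleftrightarrow> (\<exists>a. a \<noteq> 0 \<and> (\<forall>v. f v = v - (2 * (a \<bullet> v) / (a \<bullet> a)) *\<^sub>R a))"

definition acts_as_reflection_group ::
    "('g, 'b) monoid_scheme \<Rightarrow> 'g set \<Rightarrow> ('g \<Rightarrow> 'v::euclidean_space \<Rightarrow> 'v) \<Rightarrow> bool" where
  "acts_as_reflection_group G S \<rho> \<longleftrightarrow>
     faithful_action G UNIV \<rho> \<and>
     (\<forall>g\<in>carrier G. orthogonal_transformation (\<rho> g)) \<and>
     (\<forall>s\<in>S. is_reflection (\<rho> s))"

definition reflections :: "('g, 'b) monoid_scheme \<Rightarrow> 'g set \<Rightarrow> 'g set" where
  "reflections G S = {w \<otimes>\<^bsub>G\<^esub> s \<otimes>\<^bsub>G\<^esub> inv\<^bsub>G\<^esub> w |w s. w \<in> carrier G \<and> s \<in> S}"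

definition fixed_hyperplane :: "('g \<Rightarrow> 'v::euclidean_space \<Rightarrow> 'v) \<Rightarrow> 'g \<Rightarrow> 'v set" where
  "fixed_hyperplane \<rho> t = {v. \<rho> t v = v}"

definition reflection_arrangement ::
    "('g, 'b) monoid_scheme \<Rightarrow> 'g set \<Rightarrow> ('g \<Rightarrow> 'v::euclidean_space \<Rightarrow> 'v) \<Rightarrow> 'v set set" where
  "reflection_arrangement G S \<rho> = fixed_hyperplane \<rho> ` reflections G S"

section \<open>Regions and shards of a central arrangement\<close>

definition regions :: "'v::euclidean_space set set \<Rightarrow> 'v set set" where
  "regions \<A> = closure ` components (- \<Union>\<A>)"

definition facet_hyperplanes :: "'v::euclidean_space set \<Rightarrow> 'v set set" where
  "facet_hyperplanes R = {affine hull F |F. F facet_of R}"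

text \<open>Hyperplanes are linear, and regions are full-dimensional, so weak inequalities suffice.\<close>

definition separates :: "'v::euclidean_space set \<Rightarrow> 'v set \<Rightarrow> 'v set \<Rightarrow> bool" where
  "separates H R B \<longleftrightarrow>
     (\<exists>a. a \<noteq> 0 \<and> H = {v. a \<bullet> v = 0} \<and> R \<subseteq> {v. a \<bullet> v \<le> 0} \<and> B \<subseteq> {v. 0 \<le> a \<bullet> v})"

definition separating_set ::
    "'v::euclidean_space set set \<Rightarrow> 'v set \<Rightarrow> 'v set \<Rightarrow> 'v set set" where
  "separating_set \<A> B R = {H \<in> \<A>. separates H R B}"

definition rank_two_subarrangement ::
    "'v::euclidean_space set set \<Rightarrow> 'v set \<Rightarrow> 'v set \<Rightarrow> 'v set set" where
  "rank_two_subarrangement \<A> H H' = {K \<in> \<A>. H \<inter> H' \<subseteq> K}"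

text \<open>Exactly one region of the subarrangement contains the base region \<open>B\<close>.\<close>

definition basic_hyperplanes ::
    "'v::euclidean_space set set \<Rightarrow> 'v set \<Rightarrow> 'v set \<Rightarrow> 'v set \<Rightarrow> 'v set set" where
  "basic_hyperplanes \<A> B H H' =
     facet_hyperplanes (THE R. R \<in> regions (rank_two_subarrangement \<A> H H') \<and> B \<subseteq> R)"

definition cuts :: "'v::euclidean_space set set \<Rightarrow> 'v set \<Rightarrow> 'v set \<Rightarrow> 'v set \<Rightarrow> bool" where
  "cuts \<A> B H H' \<longleftrightarrow>
     H \<in> \<A> \<and> H' \<in> \<A> \<and> H \<noteq> H' \<and>
     H \<in> basic_hyperplanes \<A> B H H' \<and> H' \<notin> basic_hyperplanes \<A> B H H'"

definition shards_in :: "'v::euclidean_space set set \<Rightarrow> 'v set \<Rightarrow> 'v set \<Rightarrow> 'v set set" where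
  "shards_in \<A> B H = closure ` components (H - \<Union>{K. cuts \<A> B K H})"

definition shards :: "'v::euclidean_space set set \<Rightarrow> 'v set \<Rightarrow> 'v set set" where
  "shards \<A> B = (\<Union>H\<in>\<A>. shards_in \<A> B H)"

definition shard_hyperplane :: "'v::euclidean_space set set \<Rightarrow> 'v set \<Rightarrow> 'v set" where
  "shard_hyperplane \<A> \<Sigma> = (THE H. H \<in> \<A> \<and> \<Sigma> \<subseteq> H)"

definition lower_shards ::
    "'v::euclidean_space set set \<Rightarrow> 'v set \<Rightarrow> 'v set \<Rightarrow> 'v set set" where
  "lower_shards \<A> B R =
     {\<Sigma> \<in> shards \<A> B. aff_dim (R \<inter> \<Sigma>) = int DIM('v) - 1 \<and>
        shard_hyperplane \<A> \<Sigma> \<in> separating_set \<A> B R}"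

section \<open>Orders on the group\<close>

text \<open>In the following \<open>\<A>\<close> is the reflection arrangement, and \<open>\<rho> w ` B\<close> is the region \<open>w B\<close>.\<close>

definition weak_le :: "('g \<Rightarrow> 'v::euclidean_space \<Rightarrow> 'v) \<Rightarrow> 'v set set \<Rightarrow> 'v set \<Rightarrow> 'g \<Rightarrow> 'g \<Rightarrow> bool"
  where
  "weak_le \<rho> \<A> B u w \<longleftrightarrow> separating_set \<A> B (\<rho> u ` B) \<subseteq> separating_set \<A> B (\<rho> w ` B)"

definition shard_intersection ::
    "('g \<Rightarrow> 'v::euclidean_space \<Rightarrow> 'v) \<Rightarrow> 'v set set \<Rightarrow> 'v set \<Rightarrow> 'g \<Rightarrow> 'v set" where
  "shard_intersection \<rho> \<A> B w = \<Inter>(lower_shards \<A> B (\<rho> w ` B))"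

definition shard_le :: "('g \<Rightarrow> 'v::euclidean_space \<Rightarrow> 'v) \<Rightarrow> 'v set set \<Rightarrow> 'v set \<Rightarrow> 'g \<Rightarrow> 'g \<Rightarrow> bool"
  where
  "shard_le \<rho> \<A> B u w \<longleftrightarrow> shard_intersection \<rho> \<A> B w \<subseteq> shard_intersection \<rho> \<A> B u"

text \<open>The empty chain is included; infinite chains are not simplices.\<close>

definition order_complex :: "'p set \<Rightarrow> ('p \<Rightarrow> 'p \<Rightarrow> bool) \<Rightarrow> 'p set set" where
  "order_complex P leq = {C. C \<subseteq> P \<and> finite C \<and> Complete_Partial_Order.chain leq C}"

section \<open>Permutohedra and pulling triangulations\<close>

definition permutohedron ::
    "('g, 'b) monoid_scheme \<Rightarrow> ('g \<Rightarrow> 'v::euclidean_space \<Rightarrow> 'v) \<Rightarrow> 'v \<Rightarrow> 'v set" where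
  "permutohedron G \<rho> x = convex hull {\<rho> w x |w. w \<in> carrier G}"

definition minimal_vertices :: "('v \<Rightarrow> 'v \<Rightarrow> bool) \<Rightarrow> 'v::euclidean_space set \<Rightarrow> 'v set" where
  "minimal_vertices leq P =
     {v. v extreme_point_of P \<and> (\<forall>u. u extreme_point_of P \<and> leq u v \<longrightarrow> u = v)}"

text \<open>
  Simplices are geometric (convex hulls of affinely independent sets), and the empty simplex, which
  triangulates the empty face, is included: the vertex \<open>v\<close> is the cone over it.
\<close>

inductive pulling_simplex :: "('v \<Rightarrow> 'v \<Rightarrow> bool) \<Rightarrow> 'v::euclidean_space set \<Rightarrow> 'v set \<Rightarrow> bool"
  for leq where
  empty: "pulling_simplex leq {} {}"
| base: "\<lbrakk>minimal_vertices leq P = {v}; F face_of P; v \<notin> F; pulling_simplex leq F \<sigma>\<rbrakk> \<Longrightarrow>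
    pulling_simplex leq P \<sigma>"
| cone: "\<lbrakk>minimal_vertices leq P = {v}; F face_of P; v \<notin> F; pulling_simplex leq F \<sigma>\<rbrakk> \<Longrightarrow>
    pulling_simplex leq P (convex hull (insert v \<sigma>))"

definition pulling_triangulation ::
    "('v \<Rightarrow> 'v \<Rightarrow> bool) \<Rightarrow> 'v::euclidean_space set \<Rightarrow> 'v set set" where
  "pulling_triangulation leq P = {\<sigma>. pulling_simplex leq P \<sigma>}"

lemma pulling_triangulation_empty: "pulling_triangulation leq {} = {{}}"
proof -
  have "\<not> v extreme_point_of ({} :: 'a set)" for v :: 'a
    by (simp add: extreme_point_of_def)
  then have "minimal_vertices leq ({} :: 'a set) = {}"
    by (simp add: minimal_vertices_def)
  then have "pulling_simplex leq ({} :: 'a set) \<sigma> \<longleftrightarrow> \<sigma> = {}" for \<sigma>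
    by (subst pulling_simplex.simps) simp
  then show ?thesis
    by (simp add: pulling_triangulation_def)
qed

lemma pulling_triangulation_rec:
  assumes v: "minimal_vertices leq P = {v}"
  defines "K \<equiv> \<Union>{pulling_triangulation leq F |F. F face_of P \<and> v \<notin> F}"
  shows "pulling_triangulation leq P = K \<union> (\<lambda>\<sigma>. convex hull (insert v \<sigma>)) ` K"
proof -
  have "P \<noteq> {}"
    using v by (auto simp: minimal_vertices_def extreme_point_of_def)
  have "pulling_simplex leq P \<sigma> \<longleftrightarrow>
      (\<exists>F. F face_of P \<and> v \<notin> F \<and> pulling_simplex leq F \<sigma>) \<or>
      (\<exists>F \<tau>. F face_of P \<and> v \<notin> F \<and> pulling_simplex leq F \<tau> \<and> \<sigma> = convex hull (insert v \<tau>))" for \<sigma>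
    by (subst pulling_simplex.simps, simp add: v \<open>P \<noteq> {}\<close>, blast)
  then have *: "\<sigma> \<in> pulling_triangulation leq P \<longleftrightarrow>
      \<sigma> \<in> K \<or> (\<exists>\<tau>. \<tau> \<in> K \<and> \<sigma> = convex hull (insert v \<tau>))" for \<sigma>
    unfolding K_def pulling_triangulation_def by simp blast
  show ?thesis
    using * by (simp add: set_eq_iff image_iff Bex_def)
qed

text \<open>The reverse of the weak order, carried over to the vertices \<open>\<rho> w x\<close>.\<close>

definition reverse_weak_vertex_le ::
    "('g, 'b) monoid_scheme \<Rightarrow> ('g \<Rightarrow> 'v::euclidean_space \<Rightarrow> 'v) \<Rightarrow> 'v set set \<Rightarrow> 'v set \<Rightarrow> 'v \<Rightarrow>
     'v \<Rightarrow> 'v \<Rightarrow> bool" where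
  "reverse_weak_vertex_le G \<rho> \<A> B x p q \<longleftrightarrow>
     (\<exists>u\<in>carrier G. \<exists>w\<in>carrier G. p = \<rho> u x \<and> q = \<rho> w x \<and> weak_le \<rho> \<A> B w u)"

end

theory Submission
  imports Defs
begin

text \<open>
  Both complexes are counted by the same recursion. A simplex of the pulling triangulation is recorded
  by its vertex set in the group: if \<open>w\<close> is its vertex of greatest length, the other vertices form an
  arbitrary simplex inside the largest face with top vertex \<open>w\<close>, the coset \<open>w W\<^sub>J\<close> with \<open>J\<close> the right
  descent set of \<open>w\<close>, avoiding \<open>w\<close>. A chain with maximum \<open>w\<close> is \<open>w\<close> together with a chain strictly
  below \<open>w\<close>. So it suffices to match the elements of \<open>w W\<^sub>J\<close> with the elements below \<open>w\<close> in the shard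
  intersection order, up to conjugacy of the descent data.
  
  An element \<open>u\<close> is determined by its lower walls together with the side on which it lies of the
  hyperplanes cutting these walls. Uniqueness is a confluence argument: among the elements with
  prescribed lower walls \<open>I\<close> (and possibly more), moving to the lowest element of a face on which \<open>I\<close>
  is still uncut is terminating and locally confluent, and any two candidates are connected by such
  moves along a segment in the relative interior of the shard intersection. Being below \<open>w\<close> only
  constrains the signs off the face of \<open>w\<close>, so the elements below \<open>w\<close> correspond to the elements of the
  parabolic subgroup attached to that face.
\<close>

section \<open>Nonnegative combinations and reflections\<close>

text \<open>The obstacle is that the elements below \<open>w\<close> need not lie in the coset
  \<open>w W_J\<close>: the identity lies below every \<open>w\<close> but in general outside that
  coset. The two sets are therefore matched by walls and sides. From a region in the star of a face
  only the lower walls through the face are kept, and the global existence and uniqueness results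
  turn these walls, with the sides of the hyperplanes cutting them, into one element below
  \<open>w\<close>. The recursion then compares a face at a point \<open>a\<close> with the interval
  below \<open>w\<close>, where \<open>a\<close> and \<open>pt w\<close> share nothing but their
  local positive roots up to a group element. This is why the counting lemma is general in
  \<open>a\<close>, \<open>w\<close> and a map \<open>h\<close> between the local systems. Faces are
  encoded by points and not by subsets of the generators: sums of points give intersections of
  faces, and small displacements of a point produce the regions around it. The same point, read as a
  linear functional, exposes the corresponding face of the permutohedron. No explicit map from
  simplices to chains arises; for each number of vertices only the cardinalities are
  compared.\<close>

text \<open>
  In the presence of HOL-Algebra the notation \<open>inv\<close> would clash with the inverse in a group.
\<close>

abbreviation ginv :: "('a \<Rightarrow> 'b) \<Rightarrow> 'b \<Rightarrow> 'a" where "ginv \<equiv> inv_into UNIV"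

text \<open>The denominator \<open>a \<bullet> a\<close> is absent because roots are normalised to
  unit length; only for \<open>norm a = 1\<close> is this the reflection in the hyperplane
  orthogonal to \<open>a\<close>.\<close>

definition reflect :: "'v::euclidean_space \<Rightarrow> 'v \<Rightarrow> 'v" where
  "reflect a v = v - (2 * (a \<bullet> v)) *\<^sub>R a"

definition roots :: "('v::euclidean_space \<Rightarrow> 'v) set \<Rightarrow> 'v set \<Rightarrow> 'v set" where
  "roots G \<Delta> = {g \<alpha> |g \<alpha>. g \<in> G \<and> \<alpha> \<in> \<Delta>}"

text \<open>For infinite \<open>A\<close> the sum is 0 by convention, so that only the zero vector
  qualifies; \<open>ncomb_inner_pos\<close> recovers finiteness of \<open>A\<close> from
  \<open>b \<noteq> 0\<close> in this way.\<close>

definition ncomb :: "'v::real_vector set \<Rightarrow> 'v \<Rightarrow> bool" where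
  "ncomb A b \<longleftrightarrow> (\<exists>c. (\<forall>a\<in>A. 0 \<le> c a) \<and> b = (\<Sum>a\<in>A. c a *\<^sub>R a))"

lemma ncombI: "(\<And>a. a \<in> A \<Longrightarrow> 0 \<le> c a) \<Longrightarrow> b = (\<Sum>a\<in>A. c a *\<^sub>R a) \<Longrightarrow> ncomb A b"
  unfolding ncomb_def by blast

lemma ncomb_base: "finite A \<Longrightarrow> a \<in> A \<Longrightarrow> ncomb A a"
  by (rule ncombI[of A "\<lambda>b. if b = a then 1 else 0"]) (auto simp: if_distrib[of "\<lambda>r. r *\<^sub>R _"] cong: if_cong)

lemma ncomb_add:
  assumes "ncomb A a" "ncomb A b" shows "ncomb A (a + b)"
proof -
  obtain c d where "\<forall>v\<in>A. 0 \<le> c v" "a = (\<Sum>v\<in>A. c v *\<^sub>R v)" "\<forall>v\<in>A. 0 \<le> d v" "b = (\<Sum>v\<in>A. d v *\<^sub>R v)"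
    using assms unfolding ncomb_def by blast
  then show ?thesis
    by (intro ncombI[of A "\<lambda>v. c v + d v"]) (auto simp: scaleR_left_distrib sum.distrib)
qed

lemma ncomb_scale:
  assumes "ncomb A a" "0 \<le> r" shows "ncomb A (r *\<^sub>R a)"
proof -
  obtain c where "\<forall>v\<in>A. 0 \<le> c v" "a = (\<Sum>v\<in>A. c v *\<^sub>R v)"
    using assms unfolding ncomb_def by blast
  then show ?thesis using assms(2)
    by (intro ncombI[of A "\<lambda>v. r * c v"]) (auto simp: scaleR_sum_right)
qed

lemma ncomb_span: "ncomb A b \<Longrightarrow> b \<in> span A"
  unfolding ncomb_def by (auto intro: span_sum span_scale span_base)

lemma ncomb_inner_nonneg: "ncomb A b \<Longrightarrow> (\<And>a. a \<in> A \<Longrightarrow> 0 \<le> a \<bullet> v) \<Longrightarrow> 0 \<le> b \<bullet> v"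
  unfolding ncomb_def by (auto simp: inner_sum_left intro!: sum_nonneg)

lemma ncomb_inner_pos:
  assumes "ncomb A b" "b \<noteq> 0" "\<And>a. a \<in> A \<Longrightarrow> 0 < a \<bullet> v" shows "0 < b \<bullet> v"
proof -
  obtain c where c: "\<forall>a\<in>A. 0 \<le> c a" "b = (\<Sum>a\<in>A. c a *\<^sub>R a)"
    using assms(1) unfolding ncomb_def by blast
  have fin: "finite A" using c(2) assms(2) by (metis sum.infinite)
  have "\<exists>a\<in>A. c a \<noteq> 0" by (rule ccontr) (use c(2) assms(2) in simp)
  then obtain a where "a \<in> A" "c a \<noteq> 0" by blast
  then have "0 < (\<Sum>a\<in>A. c a * (a \<bullet> v))"
    using c(1) assms(3) fin
    by (intro sum_pos2[of A a]) (auto simp: less_le intro!: mult_pos_pos mult_nonneg_nonneg)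
  then show ?thesis by (simp add: c(2) inner_sum_left)
qed

text \<open>A vanishing sum of nonnegative terms vanishes termwise, so generators off the hyperplane
  of \<open>v\<close> have coefficient 0. This is the passage from a cone to a face of it.\<close>

lemma ncomb_restrict:
  assumes "finite A" "ncomb A b" "b \<bullet> v = 0" "\<And>a. a \<in> A \<Longrightarrow> 0 \<le> a \<bullet> v"
  shows "ncomb {a \<in> A. a \<bullet> v = 0} b"
proof -
  obtain c where c: "\<forall>a\<in>A. 0 \<le> c a" "b = (\<Sum>a\<in>A. c a *\<^sub>R a)"
    using assms(2) unfolding ncomb_def by blast
  have "(\<Sum>a\<in>A. c a * (a \<bullet> v)) = 0"
    using assms(3) by (simp add: c(2) inner_sum_left)
  then have z: "\<forall>a\<in>A. c a * (a \<bullet> v) = 0"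
    using c(1) assms by (subst (asm) sum_nonneg_eq_0_iff) auto
  have "b = (\<Sum>a\<in>{a \<in> A. a \<bullet> v = 0}. c a *\<^sub>R a)"
    unfolding c(2) using z assms(1) by (intro sum.mono_neutral_right) auto
  then show ?thesis using c(1) by (intro ncombI[of _ c]) auto
qed

lemma ncomb_image:
  assumes "linear g" "inj g" "ncomb A b" shows "ncomb (g ` A) (g b)"
proof -
  obtain c where c: "\<forall>a\<in>A. 0 \<le> c a" "b = (\<Sum>a\<in>A. c a *\<^sub>R a)"
    using assms(3) unfolding ncomb_def by blast
  have i: "inj_on g A" using assms(2) by (rule inj_on_subset) simp
  have "g b = (\<Sum>a\<in>g ` A. c (ginv g a) *\<^sub>R a)"
    by (simp add: sum.reindex[OF i] c(2) linear_sum[OF assms(1)] linear_cmul[OF assms(1)] inv_f_f[OF assms(2)])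
  then show ?thesis using c(1) assms(2) by (intro ncombI[of _ "\<lambda>a. c (ginv g a)"]) auto
qed

lemma reflect_inner: "reflect a u \<bullet> v = u \<bullet> reflect a v"
  by (simp add: reflect_def inner_diff_left inner_diff_right inner_commute)

lemma reflect_reflect: "norm a = 1 \<Longrightarrow> reflect a (reflect a v) = v"
  by (simp add: reflect_def inner_diff_right dot_square_norm algebra_simps)

lemma reflect_self: "norm a = 1 \<Longrightarrow> reflect a a = - a"
  by (simp add: reflect_def dot_square_norm scaleR_2)

section \<open>Finite reflection groups\<close>

primrec word :: "'v::euclidean_space list \<Rightarrow> 'v \<Rightarrow> 'v" where
  "word [] = id"
| "word (a # as) = reflect a \<circ> word as"

text \<open>A finite reflection group with a marked chamber: \<open>x\<close> is a point inside the
  chamber and \<open>\<Delta>\<close> consists of the unit inward normals of its walls. The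
  assumption \<open>simple_perm\<close> is the wall property: reflecting in a wall crosses no other
  hyperplane.\<close>

locale reflection_system =
  fixes G :: "('v::euclidean_space \<Rightarrow> 'v) set" and \<Delta> :: "'v set" and x :: 'v
  assumes finite_G: "finite G"
    and orth: "g \<in> G \<Longrightarrow> orthogonal_transformation g"
    and id_in: "id \<in> G"
    and comp_in: "g \<in> G \<Longrightarrow> h \<in> G \<Longrightarrow> g \<circ> h \<in> G"
    and inv_in: "g \<in> G \<Longrightarrow> ginv g \<in> G"
    and finite_simple: "finite \<Delta>"
    and simple_unit: "\<alpha> \<in> \<Delta> \<Longrightarrow> norm \<alpha> = 1"
    and simple_reflect_in: "\<alpha> \<in> \<Delta> \<Longrightarrow> reflect \<alpha> \<in> G"
    and gen: "g \<in> G \<Longrightarrow> \<exists>as. set as \<subseteq> \<Delta> \<and> g = word as"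
    and generic: "\<beta> \<in> roots G \<Delta> \<Longrightarrow> \<beta> \<bullet> x \<noteq> 0"
    and simple_pos: "\<alpha> \<in> \<Delta> \<Longrightarrow> 0 < \<alpha> \<bullet> x"
    and simple_perm: "\<alpha> \<in> \<Delta> \<Longrightarrow> \<beta> \<in> roots G \<Delta> \<Longrightarrow> 0 < \<beta> \<bullet> x \<Longrightarrow> \<beta> \<noteq> \<alpha> \<Longrightarrow> 0 < reflect \<alpha> \<beta> \<bullet> x"
begin

abbreviation "\<Phi> \<equiv> roots G \<Delta>"
definition "\<Phi>p = {\<beta> \<in> \<Phi>. 0 < \<beta> \<bullet> x}"

lemma lin: "g \<in> G \<Longrightarrow> linear g"
  using orth orthogonal_transformation_linear by blast
lemma inner_G: "g \<in> G \<Longrightarrow> g u \<bullet> g v = u \<bullet> v"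
  using orth orthogonal_transformation_def by blast
lemma inj_G: "g \<in> G \<Longrightarrow> inj g"
  using orth orthogonal_transformation_inj by blast
lemma inv_left: "g \<in> G \<Longrightarrow> ginv g (g v) = v"
  using inj_G by simp
lemma inv_right: "g \<in> G \<Longrightarrow> g (ginv g v) = v"
  by (meson orth orthogonal_transformation_surj surj_f_inv_f)
lemma inner_inv: "g \<in> G \<Longrightarrow> u \<bullet> g v = ginv g u \<bullet> v"
  by (metis inner_G inv_right)
lemma inner_inv': "g \<in> G \<Longrightarrow> g u \<bullet> v = u \<bullet> ginv g v"
  by (metis inner_G inv_right)

lemma finite_roots: "finite \<Phi>"
proof -
  have "\<Phi> = (\<lambda>(g,\<alpha>). g \<alpha>) ` (G \<times> \<Delta>)" unfolding roots_def by force
  then show ?thesis using finite_G finite_simple by simp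
qed
lemma finite_pos: "finite \<Phi>p" using finite_roots by (simp add: \<Phi>p_def)
lemma root_unit: "\<beta> \<in> \<Phi> \<Longrightarrow> norm \<beta> = 1"
  unfolding roots_def using orth orthogonal_transformation_norm simple_unit by fastforce
lemma root_nz: "\<beta> \<in> \<Phi> \<Longrightarrow> \<beta> \<noteq> 0" using root_unit by fastforce
lemma root_image: "\<beta> \<in> \<Phi> \<Longrightarrow> g \<in> G \<Longrightarrow> g \<beta> \<in> \<Phi>"
  unfolding roots_def using comp_in by (auto; metis comp_apply)
lemma simple_root: "\<alpha> \<in> \<Delta> \<Longrightarrow> \<alpha> \<in> \<Phi>"
  unfolding roots_def using id_in by (auto intro!: exI[of _ id])
lemma simple_posroot: "\<alpha> \<in> \<Delta> \<Longrightarrow> \<alpha> \<in> \<Phi>p"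
  using simple_root simple_pos by (simp add: \<Phi>p_def)
lemma root_neg: assumes "\<beta> \<in> \<Phi>" shows "- \<beta> \<in> \<Phi>"
proof -
  obtain g \<alpha> where b: "\<beta> = g \<alpha>" "g \<in> G" "\<alpha> \<in> \<Delta>" using assms roots_def by blast
  have "- \<beta> = g (reflect \<alpha> \<alpha>)" using b simple_unit lin by (simp add: reflect_self linear_neg)
  then show ?thesis using b by (simp add: root_image simple_reflect_in simple_root)
qed
lemma pos_root: "\<beta> \<in> \<Phi>p \<Longrightarrow> \<beta> \<in> \<Phi>" by (simp add: \<Phi>p_def)
lemma pos_cases: "\<beta> \<in> \<Phi> \<Longrightarrow> \<beta> \<in> \<Phi>p \<or> - \<beta> \<in> \<Phi>p"
  using generic[of \<beta>] root_neg by (auto simp: \<Phi>p_def not_less)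
lemma pos_neg: "\<beta> \<in> \<Phi>p \<Longrightarrow> - \<beta> \<notin> \<Phi>p" by (simp add: \<Phi>p_def)
lemma root_inv: "\<beta> \<in> \<Phi> \<Longrightarrow> g \<in> G \<Longrightarrow> ginv g \<beta> \<in> \<Phi>"
  by (simp add: inv_in root_image)
lemma generic_G: "\<beta> \<in> \<Phi> \<Longrightarrow> g \<in> G \<Longrightarrow> \<beta> \<bullet> g x \<noteq> 0"
  by (simp add: inner_inv root_inv generic)
lemma inv_pos: "\<beta> \<in> \<Phi> \<Longrightarrow> g \<in> G \<Longrightarrow> 0 < \<beta> \<bullet> g x \<longleftrightarrow> ginv g \<beta> \<in> \<Phi>p"
  by (simp add: \<Phi>p_def root_inv inner_inv)

lemma reflect_conj: "g \<in> G \<Longrightarrow> reflect (g \<alpha>) \<circ> g = g \<circ> reflect \<alpha>"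
  by (auto simp: reflect_def inner_G linear_diff linear_cmul lin)

lemma root_reflect_in: assumes "\<beta> \<in> \<Phi>" shows "reflect \<beta> \<in> G"
proof -
  obtain g \<alpha> where b: "\<beta> = g \<alpha>" "g \<in> G" "\<alpha> \<in> \<Delta>" using assms roots_def by blast
  have "reflect \<beta> = g \<circ> reflect \<alpha> \<circ> ginv g"
    unfolding b(1) reflect_conj[OF b(2), symmetric] by (simp add: fun_eq_iff b(2) inv_right)
  then show ?thesis using b by (simp add: comp_in inv_in simple_reflect_in)
qed

lemma simple_perm': "\<alpha> \<in> \<Delta> \<Longrightarrow> \<beta> \<in> \<Phi>p \<Longrightarrow> \<beta> \<noteq> \<alpha> \<Longrightarrow> reflect \<alpha> \<beta> \<in> \<Phi>p"
  using simple_perm root_image simple_reflect_in by (auto simp: \<Phi>p_def)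

section \<open>Words in the simple reflections, exchange, dominant vectors\<close>

lemma word_in: "set as \<subseteq> \<Delta> \<Longrightarrow> word as \<in> G"
  by (induction as) (auto simp: id_in intro: comp_in simple_reflect_in)

lemma word_snoc: "word (as @ [a]) = word as \<circ> reflect a"
  by (induction as) auto

text \<open>When the letters act on \<open>\<alpha>\<close> one after the other from the right, some
  letter \<open>b\<close> turns a positive root negative. By \<open>simple_perm\<close> that root is
  \<open>b\<close> itself, so conjugation moves \<open>reflect \<alpha>\<close> leftwards through
  the word until it cancels \<open>b\<close>.\<close>

lemma exchange:
  assumes "set as \<subseteq> \<Delta>" "\<alpha> \<in> \<Delta>" "word as \<alpha> \<bullet> x < 0"
  shows "\<exists>cs. set cs \<subseteq> \<Delta> \<and> length cs < length as \<and> word as \<circ> reflect \<alpha> = word cs"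
  using assms
proof (induction as)
  case Nil
  then show ?case using simple_pos by force
next
  case (Cons b bs)
  let ?g = "word bs \<alpha>"
  have gin: "word bs \<in> G" using Cons.prems word_in by simp
  have root: "?g \<in> \<Phi>" using Cons.prems gin root_image simple_root by blast
  show ?case
  proof (cases "?g \<bullet> x < 0")
    case True
    then have "\<exists>cs. set cs \<subseteq> \<Delta> \<and> length cs < length bs \<and> word bs \<circ> reflect \<alpha> = word cs"
      using Cons.prems by (intro Cons.IH) auto
    then obtain cs where cs: "set cs \<subseteq> \<Delta>" "length cs < length bs" "word bs \<circ> reflect \<alpha> = word cs"
      by blast
    then have "word (b # bs) \<circ> reflect \<alpha> = word (b # cs)" by (simp add: comp_assoc)
    moreover have "set (b # cs) \<subseteq> \<Delta>" "length (b # cs) < length (b # bs)" using Cons.prems cs by auto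
    ultimately show ?thesis by blast
  next
    case False
    then have "0 < ?g \<bullet> x" using generic root by fastforce
    then have "?g = b" using simple_perm[of b ?g] Cons.prems root by fastforce
    then have "reflect b \<circ> word bs = word bs \<circ> reflect \<alpha>" using reflect_conj[OF gin, of \<alpha>] by simp
    then have "word (b # bs) \<circ> reflect \<alpha> = word bs"
      using Cons.prems simple_unit by (auto simp: fun_eq_iff reflect_reflect)
    moreover have "set bs \<subseteq> \<Delta>" "length bs < length (b # bs)" using Cons.prems by auto
    ultimately show ?thesis by blast
  qed
qed

text \<open>A nonempty word for \<open>g\<close> can always be shortened: if \<open>a\<close> is its
  last letter, positivity of \<open>g a\<close> makes the remaining word send \<open>a\<close> to a
  negative root, and \<open>exchange\<close> applies. This is freeness of the action on
  chambers.\<close>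

lemma id_if_simple_pos:
  assumes "g \<in> G" "\<And>\<alpha>. \<alpha> \<in> \<Delta> \<Longrightarrow> 0 < g \<alpha> \<bullet> x" shows "g = id"
proof -
  obtain as where "set as \<subseteq> \<Delta>" "g = word as" using gen assms by blast
  then show ?thesis using assms
  proof (induction "length as" arbitrary: as rule: less_induct)
    case less
    show ?case
    proof (cases as rule: rev_cases)
      case Nil then show ?thesis using less by simp
    next
      case (snoc bs a)
      have "linear (word bs)" using less.prems snoc word_in[of bs] lin by simp
      then have "g a = - word bs a"
        using less.prems snoc simple_unit[of a] by (simp add: word_snoc reflect_self linear_neg)
      then have "word bs a \<bullet> x < 0" using less.prems snoc by force
      then obtain cs where "set cs \<subseteq> \<Delta>" "length cs < length bs" "g = word cs"
        using exchange[of bs a] less.prems snoc by (auto simp: word_snoc)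
      then show ?thesis using less(1)[of cs] less.prems snoc by simp
    qed
  qed
qed

text \<open>Peeling off the last letter \<open>a\<close> subtracts a nonnegative multiple of
  \<open>word bs a\<close>; if that root is negative, \<open>exchange\<close> shortens the word
  instead. Besides dominance arguments, this later locates the maxima of a linear functional on the
  vertices of the permutohedron.\<close>

lemma dom_max:
  assumes "g \<in> G" "\<And>\<alpha>. \<alpha> \<in> \<Delta> \<Longrightarrow> 0 \<le> \<alpha> \<bullet> v" shows "g v \<bullet> x \<le> v \<bullet> x"
proof -
  obtain as where "set as \<subseteq> \<Delta>" "g = word as" using gen assms by blast
  then show ?thesis using assms(2)
  proof (induction "length as" arbitrary: as g rule: less_induct)
    case less
    show ?case
    proof (cases as rule: rev_cases)
      case Nil then show ?thesis using less by simp
    next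
      case (snoc bs a)
      have bs: "set bs \<subseteq> \<Delta>" "a \<in> \<Delta>" using less snoc by auto
      have lin: "linear (word bs)" using bs word_in[of bs] lin by simp
      have root: "word bs a \<in> \<Phi>" using bs root_image simple_root word_in by blast
      show ?thesis
      proof (cases "word bs a \<bullet> x < 0")
        case True
        then obtain cs where "set cs \<subseteq> \<Delta>" "length cs < length bs" "g = word cs"
          using exchange[of bs a] less.prems snoc by (auto simp: word_snoc)
        then show ?thesis using less(1)[of cs g] less.prems snoc by simp
      next
        case False
        have "g v = word bs v - (2 * (a \<bullet> v)) *\<^sub>R word bs a"
          using less.prems snoc lin by (simp add: word_snoc reflect_def linear_diff linear_cmul)
        moreover have "0 \<le> 2 * (a \<bullet> v) * (word bs a \<bullet> x)"
          using False less.prems(3)[OF bs(2)] by simp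
        moreover have "word bs v \<bullet> x \<le> v \<bullet> x" using less(1)[of bs "word bs"] bs less.prems snoc by simp
        ultimately show ?thesis by (simp add: inner_diff_left)
      qed
    qed
  qed
qed

lemma max_dom:
  assumes "\<And>g. g \<in> G \<Longrightarrow> g v \<bullet> x \<le> v \<bullet> x" "\<alpha> \<in> \<Delta>" shows "0 \<le> \<alpha> \<bullet> v"
proof -
  have "reflect \<alpha> v \<bullet> x \<le> v \<bullet> x" using assms simple_reflect_in by blast
  then have "0 \<le> (\<alpha> \<bullet> v) * (\<alpha> \<bullet> x)" by (simp add: reflect_def inner_diff_left)
  then show ?thesis using simple_pos[OF assms(2)] by (simp add: zero_le_mult_iff)
qed

text \<open>The member of the orbit that is highest in direction \<open>x\<close> is dominant, since
  no simple reflection can raise it.\<close>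

lemma dominant_ex: "\<exists>g\<in>G. \<forall>\<alpha>\<in>\<Delta>. 0 \<le> \<alpha> \<bullet> g v"
proof -
  have "Max ((\<lambda>g. g v \<bullet> x) ` G) \<in> (\<lambda>g. g v \<bullet> x) ` G"
    using finite_G id_in by (intro Max_in) auto
  then obtain g where g: "g \<in> G" "Max ((\<lambda>g. g v \<bullet> x) ` G) = g v \<bullet> x" by blast
  have g2: "h v \<bullet> x \<le> g v \<bullet> x" if "h \<in> G" for h
    unfolding g(2)[symmetric] using that finite_G by (intro Max_ge) auto
  have "0 \<le> \<alpha> \<bullet> g v" if "\<alpha> \<in> \<Delta>" for \<alpha>
    using max_dom[of "g v" \<alpha>] that g2[OF comp_in[OF _ g(1)]] by simp
  then show ?thesis using g by blast
qed

text \<open>Induction on the height \<open>\<beta> \<bullet> x\<close>, measured by the number of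
  lower positive roots. A nonsimple \<open>\<beta>\<close> has positive product with some simple
  \<open>\<alpha>\<close>, and \<open>reflect \<alpha> \<beta>\<close> is lower; otherwise
  \<open>- \<beta>\<close> would be dominant, although \<open>reflect \<beta>\<close> raises it to
  \<open>\<beta>\<close>.\<close>

lemma pos_comb: "\<beta> \<in> \<Phi>p \<Longrightarrow> ncomb \<Delta> \<beta>"
proof (induction "card {\<gamma> \<in> \<Phi>p. \<gamma> \<bullet> x < \<beta> \<bullet> x}" arbitrary: \<beta> rule: less_induct)
  case less
  show ?case
  proof (cases "\<beta> \<in> \<Delta>")
    case True then show ?thesis using finite_simple ncomb_base by blast
  next
    case False
    obtain \<alpha> where a: "\<alpha> \<in> \<Delta>" "0 < \<alpha> \<bullet> \<beta>"
    proof (rule ccontr)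
      assume "\<not> thesis"
      then have "\<And>\<alpha>. \<alpha> \<in> \<Delta> \<Longrightarrow> 0 \<le> \<alpha> \<bullet> (- \<beta>)" using that by fastforce
      then have "reflect \<beta> (- \<beta>) \<bullet> x \<le> (- \<beta>) \<bullet> x"
        using dom_max root_reflect_in pos_root less.prems by blast
      then have "\<beta> \<bullet> x \<le> - (\<beta> \<bullet> x)"
        using root_unit less.prems by (simp add: reflect_def \<Phi>p_def dot_square_norm scaleR_2)
      then show False using less.prems by (simp add: \<Phi>p_def)
    qed
    let ?b = "reflect \<alpha> \<beta>"
    have b: "?b \<in> \<Phi>p" using a False less.prems simple_perm' by metis
    have "?b \<bullet> x < \<beta> \<bullet> x" using a simple_pos by (simp add: reflect_def inner_diff_left)
    then have "card {\<gamma> \<in> \<Phi>p. \<gamma> \<bullet> x < ?b \<bullet> x} < card {\<gamma> \<in> \<Phi>p. \<gamma> \<bullet> x < \<beta> \<bullet> x}"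
      using b finite_pos by (intro psubset_card_mono) auto
    then have "ncomb \<Delta> ?b" using less b by blast
    moreover have "ncomb \<Delta> ((2 * (\<alpha> \<bullet> \<beta>)) *\<^sub>R \<alpha>)"
      using a finite_simple by (intro ncomb_scale ncomb_base) auto
    ultimately have "ncomb \<Delta> (?b + (2 * (\<alpha> \<bullet> \<beta>)) *\<^sub>R \<alpha>)" by (rule ncomb_add)
    then show ?thesis by (simp add: reflect_def)
  qed
qed

text \<open>The witness is twice the midpoint of \<open>x\<close> and its mirror image. Another
  positive root is positive at both, the second by \<open>simple_perm\<close>.\<close>

lemma facet_point:
  assumes "\<alpha> \<in> \<Delta>" shows "\<exists>f. \<alpha> \<bullet> f = 0 \<and> (\<forall>\<gamma>\<in>\<Phi>p. \<gamma> \<noteq> \<alpha> \<longrightarrow> 0 < \<gamma> \<bullet> f)"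
proof (intro exI conjI ballI impI)
  show "\<alpha> \<bullet> (x + reflect \<alpha> x) = 0"
    using simple_unit[OF assms] by (simp add: reflect_def inner_add_right inner_diff_right dot_square_norm)
  fix \<gamma> assume "\<gamma> \<in> \<Phi>p" "\<gamma> \<noteq> \<alpha>"
  then have "0 < \<gamma> \<bullet> x" "0 < reflect \<alpha> \<gamma> \<bullet> x"
    using assms simple_perm' by (auto simp: \<Phi>p_def)
  then show "0 < \<gamma> \<bullet> (x + reflect \<alpha> x)" by (simp add: inner_add_right reflect_inner)
qed

text \<open>If the product were positive, the positive root
  \<open>reflect \<alpha> \<alpha>'\<close> would take a negative value at a facet point of
  \<open>\<alpha>'\<close>.\<close>

lemma simple_obtuse: assumes "\<alpha> \<in> \<Delta>" "\<alpha>' \<in> \<Delta>" "\<alpha> \<noteq> \<alpha>'" shows "\<alpha> \<bullet> \<alpha>' \<le> 0"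
proof (rule ccontr)
  assume "\<not> ?thesis"
  then have p: "0 < \<alpha> \<bullet> \<alpha>'" by simp
  obtain f where f: "\<alpha>' \<bullet> f = 0" "\<And>\<gamma>. \<gamma> \<in> \<Phi>p \<Longrightarrow> \<gamma> \<noteq> \<alpha>' \<Longrightarrow> 0 < \<gamma> \<bullet> f"
    using facet_point assms by blast
  have "reflect \<alpha> \<alpha>' \<noteq> \<alpha>'" using p root_nz[OF simple_root[OF assms(1)]] by (auto simp: reflect_def)
  then have "0 < reflect \<alpha> \<alpha>' \<bullet> f" using f simple_perm' simple_posroot assms by metis
  moreover have "0 < (2 * (\<alpha> \<bullet> \<alpha>')) * (\<alpha> \<bullet> f)" using p f simple_posroot assms by simp
  ultimately show False using f(1) by (simp add: reflect_def inner_diff_left)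
qed

text \<open>Splitting a relation by the signs of its coefficients writes one vector \<open>l\<close>
  as a positive combination of \<open>P\<close> and also of \<open>N\<close>. Obtuseness gives
  \<open>l \<bullet> l \<le> 0\<close>, and with \<open>l = 0\<close>, positivity at
  \<open>x\<close> leaves both sets empty.\<close>

lemma simple_independent: "independent \<Delta>"
proof (rule ccontr)
  assume "\<not> ?thesis"
  then obtain c where c: "\<exists>a\<in>\<Delta>. c a \<noteq> 0" "(\<Sum>a\<in>\<Delta>. c a *\<^sub>R a) = 0"
    using finite_simple by (auto simp: dependent_finite)
  define P where "P = {a \<in> \<Delta>. 0 < c a}"
  define N where "N = {a \<in> \<Delta>. c a < 0}"
  define l where "l = (\<Sum>a\<in>P. c a *\<^sub>R a)"
  have fin: "finite P" "finite N" using finite_simple by (auto simp: P_def N_def)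
  have "(\<Sum>a\<in>\<Delta>. c a *\<^sub>R a) = (\<Sum>a\<in>P \<union> N. c a *\<^sub>R a)"
    using finite_simple by (intro sum.mono_neutral_right) (auto simp: P_def N_def)
  also have "\<dots> = l + (\<Sum>a\<in>N. c a *\<^sub>R a)"
    unfolding l_def using fin by (intro sum.union_disjoint) (auto simp: P_def N_def)
  finally have l2: "l = - (\<Sum>a\<in>N. c a *\<^sub>R a)" using c(2) by (simp add: eq_neg_iff_add_eq_0)
  have l3: "l = (\<Sum>a\<in>N. (- c a) *\<^sub>R a)" using l2 by (simp add: sum_negf)
  have "l \<bullet> l = (\<Sum>a\<in>P. c a *\<^sub>R a) \<bullet> (\<Sum>a\<in>N. (- c a) *\<^sub>R a)"
    using l_def l3 by simp
  also have "\<dots> = (\<Sum>a\<in>P. \<Sum>b\<in>N. (c a * (- c b)) * (a \<bullet> b))"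
    unfolding inner_sum_left by (simp add: inner_sum_right sum_negf sum_distrib_left mult.left_commute mult.assoc)
  also have "\<dots> \<le> 0"
    by (intro sum_nonpos mult_nonneg_nonpos) (auto simp: P_def N_def mult_le_0_iff intro!: simple_obtuse)
  finally have l0: "l = 0" by (metis inner_eq_zero_iff inner_ge_zero order_antisym)
  have "P = {}"
  proof (rule ccontr)
    assume "P \<noteq> {}"
    then have "0 < (\<Sum>a\<in>P. c a * (a \<bullet> x))"
      using fin by (intro sum_pos) (auto simp: P_def simple_pos)
    moreover have "(\<Sum>a\<in>P. c a * (a \<bullet> x)) = l \<bullet> x" by (simp add: l_def inner_sum_left)
    ultimately show False using l0 by simp
  qed
  moreover have "N = {}"
  proof (rule ccontr)
    assume "N \<noteq> {}"
    then have "0 < (\<Sum>a\<in>N. (- c a) * (a \<bullet> x))"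
      using fin by (intro sum_pos mult_pos_pos) (auto simp: N_def simple_pos)
    moreover have "(\<Sum>a\<in>N. (- c a) * (a \<bullet> x)) = l \<bullet> x" by (simp add: l2 inner_sum_left sum_negf)
    ultimately show False using l0 by simp
  qed
  ultimately show False using c(1) unfolding P_def N_def by (auto, metis linorder_neqE_linordered_idom)
qed

lemma omega_ex: "\<exists>v. \<forall>\<alpha>\<in>\<Delta>. \<alpha> \<bullet> v = (if \<alpha> \<in> J then 0 else 1)"
proof -
  obtain f :: "'v \<Rightarrow> real" where f: "linear f" "\<forall>\<alpha>\<in>\<Delta>. f \<alpha> = (if \<alpha> \<in> J then 0 else 1)"
    using linear_independent_extend[OF simple_independent, of "\<lambda>\<alpha>. if \<alpha> \<in> J then 0 else 1 :: real"] by blast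
  have "f \<alpha> = \<alpha> \<bullet> adjoint f 1" for \<alpha> using adjoint_works[OF f(1), of \<alpha> 1] by simp
  then show ?thesis using f(2) by (intro exI[of _ "adjoint f 1"]) simp
qed

text \<open>A sum of fundamental coweights, for the simple roots outside \<open>J\<close>: a point
  of the closed chamber lying on exactly the walls in \<open>J\<close>. The value 1 merely stands
  for a positive number.\<close>

definition omega :: "'v set \<Rightarrow> 'v" where
  "omega J = (SOME v. \<forall>\<alpha>\<in>\<Delta>. \<alpha> \<bullet> v = (if \<alpha> \<in> J then 0 else 1))"

lemma omega: "\<alpha> \<in> \<Delta> \<Longrightarrow> \<alpha> \<bullet> omega J = (if \<alpha> \<in> J then 0 else 1)"
  using someI_ex[OF omega_ex] unfolding omega_def by fast

section \<open>Regions as sign vectors on the roots\<close>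

lemma comb_at:
  assumes "h \<in> G" "\<beta> \<in> \<Phi>" "0 < \<beta> \<bullet> h x" shows "ncomb (h ` \<Delta>) \<beta>"
proof -
  have "ncomb (h ` \<Delta>) (h (ginv h \<beta>))"
    using assms lin inj_G inv_pos pos_comb by (intro ncomb_image) auto
  then show ?thesis by (simp add: inv_right[OF assms(1)])
qed

lemma simple_image_pos: "h \<in> G \<Longrightarrow> \<alpha> \<in> \<Delta> \<Longrightarrow> 0 < h \<alpha> \<bullet> h x"
  by (simp add: inner_G simple_pos)

text \<open>Equal signs mean that \<open>ginv g \<circ> h\<close> keeps every simple root positive,
  so it is the identity.\<close>

lemma region_unique:
  assumes "g \<in> G" "h \<in> G" "\<And>\<beta>. \<beta> \<in> \<Phi>p \<Longrightarrow> 0 < \<beta> \<bullet> g x \<longleftrightarrow> 0 < \<beta> \<bullet> h x" shows "g = h"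
proof -
  have s: "0 < \<beta> \<bullet> g x \<longleftrightarrow> 0 < \<beta> \<bullet> h x" if "\<beta> \<in> \<Phi>" for \<beta>
    using assms(3)[of \<beta>] assms(3)[of "- \<beta>"] pos_cases[OF that] generic_G[OF that assms(1)]
      generic_G[OF that assms(2)] by auto
  have "ginv g \<circ> h = id"
  proof (rule id_if_simple_pos)
    show "ginv g \<circ> h \<in> G" using assms comp_in inv_in by blast
    fix \<alpha> assume "\<alpha> \<in> \<Delta>"
    then have "0 < h \<alpha> \<bullet> g x" using s root_image simple_root assms simple_image_pos by blast
    then show "0 < (ginv g \<circ> h) \<alpha> \<bullet> x" using assms by (simp add: inner_inv)
  qed
  then have "ginv g (h v) = v" for v by (metis comp_apply id_apply)
  then show ?thesis using inv_right[OF assms(1)] by (metis ext)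
qed

lemma dominant_pos:
  assumes "\<And>\<alpha>. \<alpha> \<in> \<Delta> \<Longrightarrow> 0 \<le> \<alpha> \<bullet> v" "\<beta> \<in> \<Phi>p" shows "0 \<le> \<beta> \<bullet> v"
  using ncomb_inner_nonneg[OF pos_comb[OF assms(2)]] assms(1) by blast

text \<open>Some \<open>h\<close> carries \<open>y\<close> into the closed chamber; then
  \<open>ginv h x\<close> has the signs of \<open>y\<close>, because \<open>y\<close> lies on no
  hyperplane.\<close>

lemma region_ex:
  assumes "\<And>\<beta>. \<beta> \<in> \<Phi> \<Longrightarrow> \<beta> \<bullet> y \<noteq> 0"
  shows "\<exists>g\<in>G. \<forall>\<beta>\<in>\<Phi>. 0 < \<beta> \<bullet> g x \<longleftrightarrow> 0 < \<beta> \<bullet> y"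
proof -
  obtain h where h: "h \<in> G" "\<And>\<alpha>. \<alpha> \<in> \<Delta> \<Longrightarrow> 0 \<le> \<alpha> \<bullet> h y" using dominant_ex by blast
  have *: "0 < \<beta> \<bullet> y" if "\<beta> \<in> \<Phi>" "0 < \<beta> \<bullet> ginv h x" for \<beta>
  proof -
    have "h \<beta> \<in> \<Phi>p" using that h by (simp add: \<Phi>p_def root_image inner_inv')
    then have "0 \<le> h \<beta> \<bullet> h y" using dominant_pos h by blast
    then show ?thesis using assms[OF that(1)] h by (simp add: inner_G)
  qed
  have "0 < \<beta> \<bullet> ginv h x \<longleftrightarrow> 0 < \<beta> \<bullet> y" if "\<beta> \<in> \<Phi>" for \<beta>
    using *[OF that] *[OF root_neg[OF that]] generic_G[OF that inv_in[OF h(1)]]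
    by (simp add: not_less) linarith
  then show ?thesis using h inv_in by blast
qed

text \<open>The point is \<open>p + e q\<close> for small \<open>e > 0\<close>, which works for all
  of the finitely many roots at once. Such a displacement prescribes the signs off a face by
  \<open>p\<close> and the signs on it by \<open>q\<close>; iterated, it builds most of the regions
  and facet points below.\<close>

lemma lex_point:
  "\<exists>y. \<forall>\<beta>\<in>\<Phi>. sgn (\<beta> \<bullet> y) = (if \<beta> \<bullet> p \<noteq> 0 then sgn (\<beta> \<bullet> p) else sgn (\<beta> \<bullet> q))"
proof -
  have "\<forall>\<^sub>F e in at_right 0. sgn (\<beta> \<bullet> (p + e *\<^sub>R q)) = (if \<beta> \<bullet> p \<noteq> 0 then sgn (\<beta> \<bullet> p) else sgn (\<beta> \<bullet> q))"
    for \<beta> :: 'v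
  proof (cases "\<beta> \<bullet> p = 0")
    case True
    have "\<forall>\<^sub>F e in at_right 0. (0::real) < e" by (rule eventually_at_right_less)
    then show ?thesis
      by eventually_elim (use True in \<open>simp add: inner_add_right sgn_mult\<close>)
  next
    case False
    have lim: "((\<lambda>e. \<beta> \<bullet> (p + e *\<^sub>R q)) \<longlongrightarrow> \<beta> \<bullet> (p + 0 *\<^sub>R q)) (at_right 0)"
      by (intro tendsto_intros)
    show ?thesis
    proof (cases "0 < \<beta> \<bullet> p")
      case True
      then have "\<forall>\<^sub>F e in at_right 0. 0 < \<beta> \<bullet> (p + e *\<^sub>R q)" using order_tendstoD(1)[OF lim] by simp
      then show ?thesis by eventually_elim (use True in simp)
    next
      case F2: False
      then have "\<beta> \<bullet> p < 0" using False by simp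
      then have "\<forall>\<^sub>F e in at_right 0. \<beta> \<bullet> (p + e *\<^sub>R q) < 0" using order_tendstoD(2)[OF lim] by simp
      then show ?thesis by eventually_elim (use \<open>\<beta> \<bullet> p < 0\<close> in simp)
    qed
  qed
  then have "\<forall>\<^sub>F e in at_right (0::real). \<forall>\<beta>\<in>\<Phi>. sgn (\<beta> \<bullet> (p + e *\<^sub>R q)) = (if \<beta> \<bullet> p \<noteq> 0 then sgn (\<beta> \<bullet> p) else sgn (\<beta> \<bullet> q))"
    using finite_roots by (simp add: eventually_ball_finite)
  then obtain e :: real where "\<forall>\<beta>\<in>\<Phi>. sgn (\<beta> \<bullet> (p + e *\<^sub>R q)) = (if \<beta> \<bullet> p \<noteq> 0 then sgn (\<beta> \<bullet> p) else sgn (\<beta> \<bullet> q))"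
    using eventually_happens'[of "at_right (0::real)"] by auto
  then show ?thesis by blast
qed

lemma region_lex:
  assumes "\<And>\<beta>. \<beta> \<in> \<Phi> \<Longrightarrow> \<beta> \<bullet> p = 0 \<Longrightarrow> \<beta> \<bullet> q \<noteq> 0"
  shows "\<exists>g\<in>G. \<forall>\<beta>\<in>\<Phi>. 0 < \<beta> \<bullet> g x \<longleftrightarrow> 0 < \<beta> \<bullet> p \<or> \<beta> \<bullet> p = 0 \<and> 0 < \<beta> \<bullet> q"
proof -
  obtain y where y: "\<forall>\<beta>\<in>\<Phi>. sgn (\<beta> \<bullet> y) = (if \<beta> \<bullet> p \<noteq> 0 then sgn (\<beta> \<bullet> p) else sgn (\<beta> \<bullet> q))"
    using lex_point by blast
  have "\<beta> \<bullet> y \<noteq> 0" if "\<beta> \<in> \<Phi>" for \<beta>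
    using y[rule_format, OF that] assms[OF that] by (metis sgn_0_0)
  then obtain g where g: "g \<in> G" "\<forall>\<beta>\<in>\<Phi>. 0 < \<beta> \<bullet> g x \<longleftrightarrow> 0 < \<beta> \<bullet> y" using region_ex by blast
  have "0 < \<beta> \<bullet> y \<longleftrightarrow> 0 < \<beta> \<bullet> p \<or> \<beta> \<bullet> p = 0 \<and> 0 < \<beta> \<bullet> q" if "\<beta> \<in> \<Phi>" for \<beta>
    using y[rule_format, OF that] sgn_greater[of "\<beta> \<bullet> y"] by (auto split: if_splits)
  then show ?thesis using g by blast
qed

end

section \<open>Faces, walls and cutting\<close>

text \<open>The witness \<open>f\<close> is a relative interior point of the facet with normal
  \<open>\<kappa>\<close> of the cone on which all of \<open>\<Psi>\<close> is nonnegative. In this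
  form the notion passes to subsets of \<open>\<Psi>\<close> at once.\<close>

definition basic :: "'v::real_inner set \<Rightarrow> 'v \<Rightarrow> bool" where
  "basic \<Psi> \<kappa> \<longleftrightarrow> \<kappa> \<in> \<Psi> \<and> (\<exists>f. \<kappa> \<bullet> f = 0 \<and> (\<forall>\<gamma>\<in>\<Psi>. \<gamma> \<noteq> \<kappa> \<longrightarrow> 0 < \<gamma> \<bullet> f))"

lemma basic_mono: "basic \<Psi> \<kappa> \<Longrightarrow> \<Psi>' \<subseteq> \<Psi> \<Longrightarrow> \<kappa> \<in> \<Psi>' \<Longrightarrow> basic \<Psi>' \<kappa>"
  unfolding basic_def by blast

lemma span_orthogonal: "b \<in> span A \<Longrightarrow> (\<And>a. a \<in> A \<Longrightarrow> a \<bullet> v = 0) \<Longrightarrow> b \<bullet> v = 0"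
  using orthogonal_to_span[of b A v] by (simp add: orthogonal_def inner_commute)

lemma span_pairE:
  assumes "c \<in> span {a, b}" obtains r s where "c = r *\<^sub>R a + s *\<^sub>R b"
proof -
  obtain r where "c - r *\<^sub>R a \<in> span {b}" using assms span_breakdown_eq by metis
  then obtain s where "c - r *\<^sub>R a = s *\<^sub>R b" by (auto simp: span_singleton)
  then show ?thesis using that[of r s] by (simp add: algebra_simps)
qed

lemma ncomb_uminus: "ncomb (uminus ` A) (- b) \<Longrightarrow> ncomb A b"
proof -
  assume a: "ncomb (uminus ` A) (- b)"
  have "linear (uminus :: 'a \<Rightarrow> 'a)" by (intro linearI) auto
  from ncomb_image[OF this _ a] show ?thesis by (simp add: image_image)
qed

context reflection_system
begin

text \<open>
  The region \<open>w B\<close> is represented by the generic point \<open>w x\<close>. The set \<open>Star p\<close> consists of those \<open>w\<close>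
  with \<open>p \<in> w B\<close>; these sets are exactly the cosets of standard parabolic subgroups, that is, the faces
  of the permutohedron. \<open>cov w\<close> collects the positive roots of the lower walls of \<open>w B\<close>.
\<close>

definition "Star p = {h \<in> G. \<forall>\<beta>\<in>\<Phi>. 0 < \<beta> \<bullet> p \<longrightarrow> 0 < \<beta> \<bullet> h x}"
definition "\<Phi>z p = {\<beta> \<in> \<Phi>p. \<beta> \<bullet> p = 0}"
definition "cov h = {\<beta> \<in> \<Phi>p. - \<beta> \<in> h ` \<Delta>}"
definition "inversions h = {\<beta> \<in> \<Phi>p. \<beta> \<bullet> h x < 0}"
text \<open>The rank two subarrangement is replaced by the positive roots in the plane of the two
  normals; \<open>cuts_iff\<close> identifies this with the geometric relation
  \<open>cuts\<close>.\<close>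

definition "cut_by \<kappa> \<beta> \<longleftrightarrow> \<kappa> \<in> \<Phi>p \<and> \<beta> \<in> \<Phi>p \<and> \<kappa> \<noteq> \<beta> \<and>
  basic (\<Phi>p \<inter> span {\<kappa>, \<beta>}) \<kappa> \<and> \<not> basic (\<Phi>p \<inter> span {\<kappa>, \<beta>}) \<beta>"

lemma Star_G: "h \<in> Star p \<Longrightarrow> h \<in> G" by (simp add: Star_def)
lemma \<Phi>z_pos: "\<beta> \<in> \<Phi>z p \<Longrightarrow> \<beta> \<in> \<Phi>p" by (simp add: \<Phi>z_def)
lemma \<Phi>z_root: "\<beta> \<in> \<Phi>z p \<Longrightarrow> \<beta> \<in> \<Phi>" by (simp add: \<Phi>z_def \<Phi>p_def)
lemma cov_pos: "\<beta> \<in> cov h \<Longrightarrow> \<beta> \<in> \<Phi>p" by (simp add: cov_def)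
lemma cov_root: "\<beta> \<in> cov h \<Longrightarrow> \<beta> \<in> \<Phi>" by (simp add: cov_def \<Phi>p_def)

lemma Star_pos: "h \<in> Star p \<Longrightarrow> \<beta> \<in> \<Phi> \<Longrightarrow> 0 < \<beta> \<bullet> p \<Longrightarrow> 0 < \<beta> \<bullet> h x"
  by (simp add: Star_def)
lemma Star_neg: "h \<in> Star p \<Longrightarrow> \<beta> \<in> \<Phi> \<Longrightarrow> \<beta> \<bullet> p < 0 \<Longrightarrow> \<beta> \<bullet> h x < 0"
  using Star_pos[of h p "- \<beta>"] root_neg by simp
lemma Star_nonneg: "h \<in> Star p \<Longrightarrow> \<beta> \<in> \<Phi> \<Longrightarrow> 0 < \<beta> \<bullet> h x \<Longrightarrow> 0 \<le> \<beta> \<bullet> p"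
  using Star_neg[of h p \<beta>] by fastforce
lemma Star_simple: "h \<in> Star p \<Longrightarrow> \<alpha> \<in> \<Delta> \<Longrightarrow> 0 \<le> h \<alpha> \<bullet> p"
  using Star_nonneg Star_G root_image simple_image_pos simple_root by blast
lemma not_pos_G: "\<beta> \<in> \<Phi> \<Longrightarrow> h \<in> G \<Longrightarrow> \<not> 0 < \<beta> \<bullet> h x \<longleftrightarrow> \<beta> \<bullet> h x < 0"
  using generic_G by fastforce

lemma comb_at_zero:
  assumes "h \<in> Star p" "\<beta> \<in> \<Phi>" "0 < \<beta> \<bullet> h x" "\<beta> \<bullet> p = 0"
  shows "ncomb {\<gamma> \<in> h ` \<Delta>. \<gamma> \<bullet> p = 0} \<beta>"
  using assms comb_at finite_simple Star_G Star_simple by (intro ncomb_restrict) auto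

text \<open>On roots that do not vanish at \<open>p\<close>, all members of the star have the signs
  of \<open>p\<close>, so only the local signs can distinguish them.\<close>

lemma Star_unique:
  assumes "g \<in> Star p" "h \<in> Star p" "\<And>\<beta>. \<beta> \<in> \<Phi>z p \<Longrightarrow> \<beta> \<bullet> g x < 0 \<longleftrightarrow> \<beta> \<bullet> h x < 0"
  shows "g = h"
proof (rule region_unique)
  fix \<beta> assume b: "\<beta> \<in> \<Phi>p"
  consider "0 < \<beta> \<bullet> p" | "\<beta> \<bullet> p < 0" | "\<beta> \<bullet> p = 0" by linarith
  then show "0 < \<beta> \<bullet> g x \<longleftrightarrow> 0 < \<beta> \<bullet> h x"
  proof cases
    case 1 then show ?thesis using assms b pos_root Star_pos by blast
  next
    case 2 then show ?thesis using assms b pos_root Star_neg by (meson not_less_iff_gr_or_eq)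
  next
    case 3
    then have "\<beta> \<in> \<Phi>z p" using b by (simp add: \<Phi>z_def)
    then show ?thesis using assms not_pos_G[OF pos_root[OF b]] Star_G by blast
  qed
qed (use assms Star_G in auto)

lemma inversions_inj: "g \<in> G \<Longrightarrow> h \<in> G \<Longrightarrow> inversions g = inversions h \<Longrightarrow> g = h"
  by (rule Star_unique[of _ 0]) (auto simp: Star_def \<Phi>z_def inversions_def set_eq_iff)

text \<open>If \<open>- \<beta>\<close> were not a simple root of the region, it would be a
  nonnegative combination of simple roots all positive at \<open>f\<close>, against
  \<open>\<beta> \<bullet> f = 0\<close>.\<close>

lemma wall_cov:
  assumes "h \<in> G" "\<beta> \<in> \<Phi>p" "\<beta> \<bullet> h x < 0" "\<beta> \<bullet> f = 0"
    and f: "\<And>\<gamma>. \<gamma> \<in> \<Phi> \<Longrightarrow> 0 < \<gamma> \<bullet> h x \<Longrightarrow> \<gamma> \<noteq> - \<beta> \<Longrightarrow> 0 < \<gamma> \<bullet> f"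
  shows "\<beta> \<in> cov h"
proof (rule ccontr)
  assume "\<beta> \<notin> cov h"
  then have n: "- \<beta> \<notin> h ` \<Delta>" using assms by (simp add: cov_def)
  have r: "- \<beta> \<in> \<Phi>" using assms pos_root root_neg by blast
  have "ncomb (h ` \<Delta>) (- \<beta>)" using comb_at[OF assms(1) r] assms(3) by simp
  then have "0 < - \<beta> \<bullet> f"
  proof (rule ncomb_inner_pos)
    show "- \<beta> \<noteq> 0" using root_nz[OF r] .
    fix a assume a: "a \<in> h ` \<Delta>"
    then have "a \<in> \<Phi>" "0 < a \<bullet> h x" using assms(1) simple_image_pos root_image simple_root by auto
    moreover have "a \<noteq> - \<beta>" using a n by blast
    ultimately show "0 < a \<bullet> f" by (rule f)
  qed
  then show False using assms by simp
qed

lemma cov_wall: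
  assumes "h \<in> G" "\<beta> \<in> cov h"
  shows "\<exists>f. \<beta> \<bullet> f = 0 \<and> (\<forall>\<gamma>\<in>\<Phi>. 0 < \<gamma> \<bullet> h x \<longrightarrow> \<gamma> \<noteq> - \<beta> \<longrightarrow> 0 < \<gamma> \<bullet> f)"
proof -
  obtain \<alpha> where a: "\<alpha> \<in> \<Delta>" "- \<beta> = h \<alpha>" using assms by (auto simp: cov_def)
  obtain f where f: "\<alpha> \<bullet> f = 0" "\<And>\<gamma>. \<gamma> \<in> \<Phi>p \<Longrightarrow> \<gamma> \<noteq> \<alpha> \<Longrightarrow> 0 < \<gamma> \<bullet> f" using facet_point a by blast
  have "0 < \<gamma> \<bullet> h f" if "\<gamma> \<in> \<Phi>" "0 < \<gamma> \<bullet> h x" "\<gamma> \<noteq> - \<beta>" for \<gamma>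
  proof -
    have "ginv h \<gamma> \<noteq> \<alpha>" using that a inv_right[OF assms(1)] by metis
    moreover have "ginv h \<gamma> \<in> \<Phi>p" using inv_pos that assms by blast
    ultimately show ?thesis using f inner_inv[OF assms(1)] by simp
  qed
  moreover have "- \<beta> \<bullet> h f = 0" using a f assms by (simp add: inner_G)
  ultimately show ?thesis by (intro exI[of _ "h f"]) auto
qed

lemma cov_inv: "h \<in> G \<Longrightarrow> \<beta> \<in> cov h \<Longrightarrow> \<beta> \<bullet> h x < 0"
  unfolding cov_def using simple_image_pos[of h] by (auto simp: image_iff) (metis inner_minus_left neg_0_less_iff_less)

section \<open>Lowest and highest region at a point, local base, cutting hyperplanes\<close>

lemma bottom_ex: "\<exists>g\<in>Star p. \<forall>\<beta>\<in>\<Phi>z p. 0 < \<beta> \<bullet> g x"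
proof -
  obtain g where "g \<in> G" "\<forall>\<beta>\<in>\<Phi>. 0 < \<beta> \<bullet> g x \<longleftrightarrow> 0 < \<beta> \<bullet> p \<or> \<beta> \<bullet> p = 0 \<and> 0 < \<beta> \<bullet> x"
    using region_lex[of p x] generic by blast
  then show ?thesis by (intro bexI[of _ g]) (auto simp: Star_def \<Phi>z_def \<Phi>p_def)
qed

lemma top_ex: "\<exists>g\<in>Star p. \<forall>\<beta>\<in>\<Phi>z p. \<beta> \<bullet> g x < 0"
proof -
  obtain g where "g \<in> G" "\<forall>\<beta>\<in>\<Phi>. 0 < \<beta> \<bullet> g x \<longleftrightarrow> 0 < \<beta> \<bullet> p \<or> \<beta> \<bullet> p = 0 \<and> 0 < \<beta> \<bullet> (- x)"
    using region_lex[of p "- x"] generic by (metis inner_minus_right neg_equal_0_iff_equal)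
  then show ?thesis
    by (intro bexI[of _ g]) (auto simp: Star_def \<Phi>z_def \<Phi>p_def not_pos_G[symmetric])
qed

lemma bottom_simple:
  assumes "g \<in> Star p" "\<And>\<beta>. \<beta> \<in> \<Phi>z p \<Longrightarrow> 0 < \<beta> \<bullet> g x" "\<gamma> \<in> \<Phi>" "0 < \<gamma> \<bullet> g x" "\<gamma> \<bullet> p = 0"
  shows "\<gamma> \<in> \<Phi>z p"
  using pos_cases[OF assms(3)] assms(2)[of "- \<gamma>"] assms(4,5) by (auto simp: \<Phi>z_def)

text \<open>For the lowest region at \<open>p\<close>, local positivity agrees with positivity on
  the region. So the base of the local root system consists of simple roots of an actual region, and
  all facts about simple roots become available at \<open>p\<close>.\<close>

lemma bottom_basic:
  assumes g: "g \<in> Star p" "\<And>\<beta>. \<beta> \<in> \<Phi>z p \<Longrightarrow> 0 < \<beta> \<bullet> g x"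
  shows "basic (\<Phi>z p) \<beta> \<longleftrightarrow> \<beta> \<in> \<Phi>z p \<and> \<beta> \<in> g ` \<Delta>"
proof
  assume b: "basic (\<Phi>z p) \<beta>"
  then obtain f where f: "\<beta> \<in> \<Phi>z p" "\<beta> \<bullet> f = 0" "\<And>\<gamma>. \<gamma> \<in> \<Phi>z p \<Longrightarrow> \<gamma> \<noteq> \<beta> \<Longrightarrow> 0 < \<gamma> \<bullet> f"
    unfolding basic_def by blast
  have "\<beta> \<in> g ` \<Delta>"
  proof (rule ccontr)
    assume n: "\<beta> \<notin> g ` \<Delta>"
    have "ncomb {\<gamma> \<in> g ` \<Delta>. \<gamma> \<bullet> p = 0} \<beta>"
      using g f(1) by (intro comb_at_zero) (auto simp: \<Phi>z_def \<Phi>p_def)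
    then have "0 < \<beta> \<bullet> f"
    proof (rule ncomb_inner_pos)
      fix a assume a: "a \<in> {\<gamma> \<in> g ` \<Delta>. \<gamma> \<bullet> p = 0}"
      then have "a \<in> \<Phi>" "0 < a \<bullet> g x"
        using simple_image_pos root_image simple_root Star_G[OF g(1)] by auto
      moreover have "a \<noteq> \<beta>" using a n by blast
      ultimately show "0 < a \<bullet> f" using bottom_simple[OF g] f(3) a by simp
    next
      show "\<beta> \<noteq> 0" using f(1) root_nz \<Phi>z_root by simp
    qed
    then show False using f by simp
  qed
  then show "\<beta> \<in> \<Phi>z p \<and> \<beta> \<in> g ` \<Delta>" using f by simp
next
  assume "\<beta> \<in> \<Phi>z p \<and> \<beta> \<in> g ` \<Delta>"
  then obtain \<alpha> where a: "\<beta> \<in> \<Phi>z p" "\<alpha> \<in> \<Delta>" "\<beta> = g \<alpha>" by blast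
  obtain f where f: "\<alpha> \<bullet> f = 0" "\<And>\<gamma>. \<gamma> \<in> \<Phi>p \<Longrightarrow> \<gamma> \<noteq> \<alpha> \<Longrightarrow> 0 < \<gamma> \<bullet> f" using facet_point a by blast
  note gG = Star_G[OF g(1)]
  have "0 < \<gamma> \<bullet> g f" if "\<gamma> \<in> \<Phi>z p" "\<gamma> \<noteq> \<beta>" for \<gamma>
  proof -
    have "ginv g \<gamma> \<noteq> \<alpha>" using that a inv_right[OF gG] by metis
    then show ?thesis using f that g gG by (simp add: inner_inv inv_pos[symmetric] \<Phi>z_root)
  qed
  then show "basic (\<Phi>z p) \<beta>" unfolding basic_def using a f gG by (auto intro!: exI[of _ "g f"] simp: inner_G)
qed

lemma plane_zero: "\<kappa> \<bullet> p = 0 \<Longrightarrow> \<beta> \<bullet> p = 0 \<Longrightarrow> \<Phi>p \<inter> span {\<kappa>, \<beta>} \<subseteq> \<Phi>z p"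
  by (auto simp: \<Phi>z_def intro: span_orthogonal)

text \<open>If \<open>\<kappa>\<close> vanished at \<open>p\<close>, so would all roots in the
  plane, and \<open>\<beta>\<close>, being basic among all local roots, would remain basic in this
  smaller set.\<close>

lemma cut_nonzero:
  assumes "cut_by \<kappa> \<beta>" "basic (\<Phi>z p) \<beta>" shows "\<kappa> \<bullet> p \<noteq> 0"
proof
  assume "\<kappa> \<bullet> p = 0"
  moreover have "\<beta> \<bullet> p = 0" using assms by (simp add: basic_def \<Phi>z_def)
  ultimately have "basic (\<Phi>p \<inter> span {\<kappa>, \<beta>}) \<beta>"
    using assms(1) by (intro basic_mono[OF assms(2) plane_zero]) (auto simp: cut_by_def span_base)
  then show False using assms(1) by (simp add: cut_by_def)
qed

text \<open>Expanding \<open>\<beta>\<close> in the local base yields a basic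
  \<open>\<kappa>\<close> with \<open>0 < \<kappa> \<bullet> \<beta>\<close>, and
  \<open>\<delta> = reflect \<kappa> \<beta>\<close> is again a local positive root. Since
  \<open>\<beta>\<close> is the sum of \<open>\<delta>\<close> and a positive multiple of
  \<open>\<kappa>\<close>, no point of its hyperplane is positive on both, so it is not basic in the
  plane.\<close>

lemma cut_ex:
  assumes "\<beta> \<in> \<Phi>z p" "\<not> basic (\<Phi>z p) \<beta>" shows "\<exists>\<kappa>\<in>\<Phi>z p. cut_by \<kappa> \<beta>"
proof -
  obtain g where g: "g \<in> Star p" "\<And>\<beta>. \<beta> \<in> \<Phi>z p \<Longrightarrow> 0 < \<beta> \<bullet> g x" using bottom_ex by blast
  note gG = Star_G[OF g(1)]
  have bn: "\<beta> \<bullet> p = 0" "\<beta> \<in> \<Phi>" "\<beta> \<in> \<Phi>p" "0 < \<beta> \<bullet> g x" "\<beta> \<notin> g ` \<Delta>"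
    using assms g bottom_basic[OF g] by (auto simp: \<Phi>z_def \<Phi>p_def)
  have nc: "ncomb {\<gamma> \<in> g ` \<Delta>. \<gamma> \<bullet> p = 0} \<beta>" using g bn by (intro comb_at_zero) auto
  obtain \<kappa> where k: "\<kappa> \<in> g ` \<Delta>" "\<kappa> \<bullet> p = 0" "0 < \<kappa> \<bullet> \<beta>"
  proof (rule ccontr)
    assume "\<not> thesis"
    then have "0 \<le> \<beta> \<bullet> (- \<beta>)" using that by (intro ncomb_inner_nonneg[OF nc]) fastforce
    then show False using root_nz[OF bn(2)] by (metis inner_gt_zero_iff inner_minus_right neg_0_le_iff_le not_le)
  qed
  then obtain \<alpha> where a: "\<alpha> \<in> \<Delta>" "\<kappa> = g \<alpha>" by blast
  have kr: "\<kappa> \<in> \<Phi>" "0 < \<kappa> \<bullet> g x" using a root_image simple_root gG simple_image_pos by auto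
  have kz: "\<kappa> \<in> \<Phi>z p" using bottom_simple[OF g] kr k by blast
  have kb: "basic (\<Phi>z p) \<kappa>" using bottom_basic[OF g] kz k by blast
  define \<delta> where "\<delta> = reflect \<kappa> \<beta>"
  have d: "\<delta> = \<beta> - (2 * (\<kappa> \<bullet> \<beta>)) *\<^sub>R \<kappa>" by (simp add: \<delta>_def reflect_def)
  have dr: "\<delta> \<in> \<Phi>" using \<delta>_def kr bn root_reflect_in root_image by simp
  have "ginv g \<beta> \<noteq> \<alpha>"
  proof
    assume "ginv g \<beta> = \<alpha>"
    then have "\<beta> = g \<alpha>" using inv_right[OF gG, of \<beta>] by simp
    then show False using bn(5) a(1) by blast
  qed
  moreover have "ginv g \<beta> \<in> \<Phi>p" using inv_pos[OF bn(2) gG] bn(4) by blast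
  ultimately have "reflect \<alpha> (ginv g \<beta>) \<in> \<Phi>p" using simple_perm'[OF a(1)] by blast
  moreover have "ginv g \<delta> = reflect \<alpha> (ginv g \<beta>)"
  proof -
    have "reflect (g \<alpha>) (g (ginv g \<beta>)) = g (reflect \<alpha> (ginv g \<beta>))"
      using fun_cong[OF reflect_conj[OF gG]] by simp
    then show ?thesis unfolding \<delta>_def a(2) inv_right[OF gG] by (simp add: inv_left[OF gG])
  qed
  ultimately have "0 < \<delta> \<bullet> g x" using inv_pos[OF dr gG] by simp
  moreover have "\<delta> \<bullet> p = 0" using k bn by (simp add: d inner_diff_left)
  ultimately have dz: "\<delta> \<in> \<Phi>z p" using bottom_simple[OF g] dr by blast
  have "\<not> basic (\<Phi>p \<inter> span {\<kappa>, \<beta>}) \<beta>"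
  proof
    assume "basic (\<Phi>p \<inter> span {\<kappa>, \<beta>}) \<beta>"
    then obtain f where f: "\<beta> \<bullet> f = 0" "\<And>\<gamma>. \<gamma> \<in> \<Phi>p \<Longrightarrow> \<gamma> \<in> span {\<kappa>, \<beta>} \<Longrightarrow> \<gamma> \<noteq> \<beta> \<Longrightarrow> 0 < \<gamma> \<bullet> f"
      unfolding basic_def by blast
    have "\<kappa> \<noteq> \<beta>" using k bn by blast
    then have 1: "0 < \<kappa> \<bullet> f" using f(2)[of \<kappa>] kz \<Phi>z_pos by (simp add: span_base)
    have "\<delta> \<noteq> \<beta>" using d k root_nz[OF kr(1)] by simp
    moreover have "\<delta> \<in> span {\<kappa>, \<beta>}" unfolding d by (intro span_diff span_scale span_base) auto
    ultimately have "0 < \<delta> \<bullet> f" using f(2)[of \<delta>] dz \<Phi>z_pos by simp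
    moreover have "0 < (2 * (\<kappa> \<bullet> \<beta>)) * (\<kappa> \<bullet> f)" using 1 k by simp
    ultimately show False by (simp add: d inner_diff_left f(1))
  qed
  moreover have "basic (\<Phi>p \<inter> span {\<kappa>, \<beta>}) \<kappa>"
    by (rule basic_mono[OF kb plane_zero]) (use k bn kz \<Phi>z_pos in \<open>auto intro: span_base\<close>)
  moreover have "\<kappa> \<noteq> \<beta>" using k bn by blast
  ultimately have "cut_by \<kappa> \<beta>" using bn kz \<Phi>z_pos by (simp add: cut_by_def)
  then show ?thesis using kz by blast
qed

lemma pos_root_multiple:
  assumes "\<beta> \<in> \<Phi>p" "\<delta> \<in> \<Phi>p" "\<delta> = s *\<^sub>R \<beta>" shows "\<delta> = \<beta>"
proof -
  have "\<bar>s\<bar> = 1" using assms root_unit[of \<beta>] root_unit[of \<delta>] pos_root by simp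
  moreover have "0 < s" using assms by (auto simp: \<Phi>p_def zero_less_mult_iff)
  ultimately show ?thesis using assms(3) by simp
qed

text \<open>Let \<open>f\<close> be the part of \<open>\<kappa>\<close> orthogonal to
  \<open>\<beta>\<close>. Since \<open>\<beta>\<close> is not basic, \<open>f\<close> fails as a
  facet point, so some positive root \<open>\<delta>\<close> of the plane lies on the other side of
  the line of \<open>\<beta>\<close>. Positivity at \<open>x\<close> settles the sign of the
  remaining coefficient.\<close>

lemma cut_comb:
  assumes "cut_by \<kappa> \<beta>"
  obtains \<delta> a b where "\<delta> \<in> \<Phi>p" "\<delta> \<in> span {\<kappa>, \<beta>}" "0 < a" "0 < b" "\<beta> = a *\<^sub>R \<kappa> + b *\<^sub>R \<delta>"
proof -
  have c: "\<kappa> \<in> \<Phi>p" "\<beta> \<in> \<Phi>p" "\<kappa> \<noteq> \<beta>" "\<not> basic (\<Phi>p \<inter> span {\<kappa>, \<beta>}) \<beta>"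
    using assms by (auto simp: cut_by_def)
  define f where "f = \<kappa> - (\<kappa> \<bullet> \<beta>) *\<^sub>R \<beta>"
  have bf: "\<beta> \<bullet> f = 0"
    using root_unit[OF pos_root[OF c(2)]] by (simp add: f_def inner_diff_right dot_square_norm inner_commute)
  have "f \<noteq> 0"
  proof
    assume "f = 0"
    then have "\<kappa> = (\<kappa> \<bullet> \<beta>) *\<^sub>R \<beta>" by (simp add: f_def)
    then show False using pos_root_multiple[OF c(2,1)] c(3) by blast
  qed
  moreover have "\<kappa> \<bullet> f = f \<bullet> f" using bf by (subst (2) f_def) (simp add: inner_diff_left)
  ultimately have kf: "0 < \<kappa> \<bullet> f" by simp
  have "\<beta> \<in> \<Phi>p \<inter> span {\<kappa>, \<beta>}" using c by (auto intro: span_base)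
  then obtain \<delta> where d: "\<delta> \<in> \<Phi>p" "\<delta> \<in> span {\<kappa>, \<beta>}" "\<delta> \<noteq> \<beta>" "\<not> 0 < \<delta> \<bullet> f"
    using c(4) bf unfolding basic_def by blast
  obtain r s where rs: "\<delta> = r *\<^sub>R \<kappa> + s *\<^sub>R \<beta>" using d(2) by (rule span_pairE)
  have "r \<noteq> 0" using pos_root_multiple[OF c(2) d(1), of s] rs d(3) by auto
  moreover have "r * (\<kappa> \<bullet> f) \<le> 0" using d(4) bf by (simp add: rs inner_add_left)
  ultimately have r: "r < 0" using kf by (simp add: mult_le_0_iff)
  have "s *\<^sub>R \<beta> = \<delta> + (- r) *\<^sub>R \<kappa>" by (simp add: rs)
  then have "s * (\<beta> \<bullet> x) = \<delta> \<bullet> x + (- r) * (\<kappa> \<bullet> x)"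
    by (metis inner_add_left inner_scaleR_left)
  moreover have "0 < \<delta> \<bullet> x + (- r) * (\<kappa> \<bullet> x)"
    using r d c by (intro add_pos_pos mult_pos_pos) (auto simp: \<Phi>p_def)
  ultimately have "0 < s * (\<beta> \<bullet> x)" by simp
  then have s: "0 < s" using c(2) zero_less_mult_pos2 by (auto simp: \<Phi>p_def)
  have "\<beta> = (- r / s) *\<^sub>R \<kappa> + (1 / s) *\<^sub>R \<delta>" using s by (simp add: rs scaleR_add_right)
  moreover have "0 < - r / s" "0 < 1 / s" using r s by (simp_all add: divide_neg_pos)
  ultimately show ?thesis using that d(1,2) by blast
qed

lemma omega_at:
  assumes "g \<in> G" "I \<subseteq> g ` \<Delta>"
  defines "w \<equiv> g (omega (ginv g ` I))"
  shows "\<And>\<beta>. \<beta> \<in> I \<Longrightarrow> \<beta> \<bullet> w = 0"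
    and "\<And>\<beta>. \<beta> \<in> \<Phi> \<Longrightarrow> 0 < \<beta> \<bullet> g x \<Longrightarrow> 0 \<le> \<beta> \<bullet> w"
    and "\<And>\<beta>. \<beta> \<in> \<Phi> \<Longrightarrow> 0 < \<beta> \<bullet> g x \<Longrightarrow> \<beta> \<bullet> w = 0 \<Longrightarrow> ncomb I \<beta>"
proof -
  have *: "\<beta> \<bullet> w = (if \<beta> \<in> I then 0 else 1)" if b: "\<beta> \<in> g ` \<Delta>" for \<beta>
  proof -
    obtain \<alpha> where a: "\<alpha> \<in> \<Delta>" "\<beta> = g \<alpha>" using b by blast
    have "\<beta> \<in> I" if "\<alpha> \<in> ginv g ` I" using that a by (auto simp: inv_right[OF assms(1)])
    moreover have "\<alpha> \<in> ginv g ` I" if "\<beta> \<in> I"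
      using that a inv_left[OF assms(1), of \<alpha>] by (metis imageI)
    ultimately have "\<alpha> \<in> ginv g ` I \<longleftrightarrow> \<beta> \<in> I" by blast
    then show ?thesis using a assms(1) by (simp add: w_def inner_G omega)
  qed
  show "\<beta> \<bullet> w = 0" if "\<beta> \<in> I" for \<beta> using * that assms(2) by auto
  fix \<beta> assume b: "\<beta> \<in> \<Phi>" "0 < \<beta> \<bullet> g x"
  show "0 \<le> \<beta> \<bullet> w" by (rule ncomb_inner_nonneg[OF comb_at[OF assms(1) b]]) (simp add: *)
  assume "\<beta> \<bullet> w = 0"
  then have "ncomb {\<gamma> \<in> g ` \<Delta>. \<gamma> \<bullet> w = 0} \<beta>"
    using finite_simple by (intro ncomb_restrict comb_at[OF assms(1) b]) (auto simp: *)
  moreover have "{\<gamma> \<in> g ` \<Delta>. \<gamma> \<bullet> w = 0} = I" using * assms(2) by (auto split: if_splits)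
  ultimately show "ncomb I \<beta>" by simp
qed

text \<open>The functional \<open>w\<close> exposes the face generated by \<open>I\<close> of the
  cone of local positive roots. It is the recurring certificate that a local root in the span of
  \<open>I\<close> is even a nonnegative combination of \<open>I\<close>.\<close>

lemma omega_local:
  assumes "\<And>\<beta>. \<beta> \<in> I \<Longrightarrow> basic (\<Phi>z p) \<beta>"
  obtains w where "\<And>\<beta>. \<beta> \<in> \<Phi>z p \<Longrightarrow> 0 \<le> \<beta> \<bullet> w" "\<And>\<beta>. \<beta> \<in> I \<Longrightarrow> \<beta> \<bullet> w = 0"
    "\<And>\<beta>. \<beta> \<in> \<Phi>z p \<Longrightarrow> \<beta> \<bullet> w = 0 \<Longrightarrow> ncomb I \<beta>"
proof -
  obtain g where g: "g \<in> Star p" "\<And>\<beta>. \<beta> \<in> \<Phi>z p \<Longrightarrow> 0 < \<beta> \<bullet> g x" using bottom_ex by blast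
  have "I \<subseteq> g ` \<Delta>" using assms bottom_basic[OF g] by blast
  note w = omega_at[OF Star_G[OF g(1)] this]
  show ?thesis by (rule that[of "g (omega (ginv g ` I))"]) (use w g \<Phi>z_root in auto)
qed

text \<open>
  If the walls in \<open>I\<close> are uncut at \<open>p\<close>, the regions at \<open>p\<close> lying below all of them have a least
  element \<open>m\<close>.
\<close>

definition "locmin p I m \<longleftrightarrow> m \<in> Star p \<and> I \<subseteq> cov m \<and> (\<forall>\<beta>\<in>\<Phi>z p. \<beta> \<bullet> m x < 0 \<longleftrightarrow> \<beta> \<in> span I)"

text \<open>Three nested displacements give \<open>m\<close>: first the signs of \<open>p\<close>;
  then those of \<open>w\<close>, positive on the local roots outside the span of \<open>I\<close>;
  last those of \<open>- x\<close>, which inverts the local roots in that span.\<close>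

lemma locmin_ex:
  assumes I: "\<And>\<beta>. \<beta> \<in> I \<Longrightarrow> basic (\<Phi>z p) \<beta>" shows "\<exists>m. locmin p I m"
proof -
  obtain g where g: "g \<in> Star p" "\<And>\<beta>. \<beta> \<in> \<Phi>z p \<Longrightarrow> 0 < \<beta> \<bullet> g x" using bottom_ex by blast
  note gG = Star_G[OF g(1)]
  have Ig: "I \<subseteq> g ` \<Delta>" "I \<subseteq> \<Phi>z p" using I bottom_basic[OF g] by blast+
  obtain w where w: "\<And>\<beta>. \<beta> \<in> \<Phi>z p \<Longrightarrow> 0 \<le> \<beta> \<bullet> w" "\<And>\<beta>. \<beta> \<in> I \<Longrightarrow> \<beta> \<bullet> w = 0"
    "\<And>\<beta>. \<beta> \<in> \<Phi>z p \<Longrightarrow> \<beta> \<bullet> w = 0 \<Longrightarrow> ncomb I \<beta>" using omega_local[OF I] by blast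
  obtain q where q: "\<And>\<beta>. \<beta> \<in> \<Phi> \<Longrightarrow> sgn (\<beta> \<bullet> q) = (if \<beta> \<bullet> w \<noteq> 0 then sgn (\<beta> \<bullet> w) else sgn (\<beta> \<bullet> (- x)))"
    using lex_point[of w "- x"] by blast
  have q0: "\<beta> \<bullet> q \<noteq> 0" if "\<beta> \<in> \<Phi>" for \<beta> using q[OF that] generic[OF that] by (auto simp: sgn_eq_0_iff split: if_splits)
  have qpos: "0 < \<beta> \<bullet> q \<longleftrightarrow> 0 < \<beta> \<bullet> w \<or> \<beta> \<bullet> w = 0 \<and> \<beta> \<bullet> x < 0" if "\<beta> \<in> \<Phi>" for \<beta>
    using q[OF that] sgn_greater[of "\<beta> \<bullet> q"] by (auto split: if_splits)
  obtain m where m: "m \<in> G" "\<And>\<beta>. \<beta> \<in> \<Phi> \<Longrightarrow> 0 < \<beta> \<bullet> m x \<longleftrightarrow> 0 < \<beta> \<bullet> p \<or> \<beta> \<bullet> p = 0 \<and> 0 < \<beta> \<bullet> q"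
    using region_lex[of p q] q0 by blast
  have mS: "m \<in> Star p" using m by (simp add: Star_def)
  have ms: "\<beta> \<bullet> m x < 0 \<longleftrightarrow> \<beta> \<bullet> w = 0" if "\<beta> \<in> \<Phi>z p" for \<beta>
    using that w(1)[OF that] m(2)[of \<beta>] qpos[of \<beta>] not_pos_G[of \<beta> m] m(1) by (auto simp: \<Phi>z_def \<Phi>p_def)
  have "\<beta> \<bullet> w = 0 \<longleftrightarrow> \<beta> \<in> span I" if "\<beta> \<in> \<Phi>z p" for \<beta>
    using w(3)[OF that] ncomb_span span_orthogonal[of \<beta> I w] w(2) by blast
  moreover have "\<beta> \<in> cov m" if b: "\<beta> \<in> I" for \<beta>
  proof -
    obtain \<alpha> where a: "\<alpha> \<in> \<Delta>" "\<beta> = g \<alpha>" using b Ig by blast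
    obtain f where f: "\<alpha> \<bullet> f = 0" "\<And>\<gamma>. \<gamma> \<in> \<Phi>p \<Longrightarrow> \<gamma> \<noteq> \<alpha> \<Longrightarrow> 0 < \<gamma> \<bullet> f" using facet_point a by blast
    \<comment> \<open>A facet point of \<open>m\<close> for \<open>\<beta>\<close> is displaced in
      the same order: \<open>p\<close>, then \<open>w\<close>, then \<open>- g f\<close>. The minus
      sign appears because, on the span of \<open>I\<close>, the region of \<open>m\<close> is
      opposite to that of \<open>g\<close>.\<close>
    obtain f1 where f1: "\<And>\<gamma>. \<gamma> \<in> \<Phi> \<Longrightarrow> sgn (\<gamma> \<bullet> f1) = (if \<gamma> \<bullet> w \<noteq> 0 then sgn (\<gamma> \<bullet> w) else sgn (\<gamma> \<bullet> (- g f)))"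
      using lex_point[of w "- g f"] by blast
    obtain f2 where f2: "\<And>\<gamma>. \<gamma> \<in> \<Phi> \<Longrightarrow> sgn (\<gamma> \<bullet> f2) = (if \<gamma> \<bullet> p \<noteq> 0 then sgn (\<gamma> \<bullet> p) else sgn (\<gamma> \<bullet> f1))"
      using lex_point[of p f1] by blast
    have bz: "\<beta> \<in> \<Phi>z p" using b Ig by blast
    have bw: "\<beta> \<bullet> w = 0" using w(2) b by blast
    have "\<beta> \<bullet> g f = 0" using a f gG by (simp add: inner_G)
    then have b1: "sgn (\<beta> \<bullet> f1) = 0" using f1[OF \<Phi>z_root[OF bz]] bw by simp
    have b2: "\<beta> \<bullet> f2 = 0" using f2[OF \<Phi>z_root[OF bz]] b1 bz by (simp add: \<Phi>z_def sgn_eq_0_iff)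
    have neg: "\<beta> \<bullet> m x < 0" using ms[OF bz] bw by simp
    show ?thesis
    proof (rule wall_cov[OF m(1) \<Phi>z_pos[OF bz] neg b2])
      fix \<gamma> assume c: "\<gamma> \<in> \<Phi>" "0 < \<gamma> \<bullet> m x" "\<gamma> \<noteq> - \<beta>"
      then consider "0 < \<gamma> \<bullet> p" | "\<gamma> \<bullet> p = 0" "0 < \<gamma> \<bullet> w" | "\<gamma> \<bullet> p = 0" "\<gamma> \<bullet> w = 0" "\<gamma> \<bullet> x < 0"
        using m(2) qpos by blast
      then have "sgn (\<gamma> \<bullet> f2) = 1"
      proof cases
        case 1 then show ?thesis using f2[OF c(1)] by simp
      next
        case 2 then show ?thesis using f2[OF c(1)] f1[OF c(1)] by simp
      next
        case 3
        have z: "- \<gamma> \<in> \<Phi>z p" using 3 c root_neg by (simp add: \<Phi>z_def \<Phi>p_def)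
        have "ginv g (- \<gamma>) \<in> \<Phi>p" using inv_pos[OF \<Phi>z_root[OF z] gG] g(2)[OF z] by simp
        moreover have "ginv g (- \<gamma>) \<noteq> \<alpha>"
          using c(3) a(2) inv_right[OF gG, of "- \<gamma>"] by auto
        ultimately have "0 < ginv g (- \<gamma>) \<bullet> f" using f(2) by blast
        then have "0 < (- \<gamma>) \<bullet> g f" using inner_inv[OF gG] by simp
        then show ?thesis using f2[OF c(1)] f1[OF c(1)] 3 by simp
      qed
      then show "0 < \<gamma> \<bullet> f2" by (simp add: sgn_1_pos)
    qed
  qed
  ultimately have "locmin p I m" using mS ms by (auto simp: locmin_def)
  then show ?thesis by blast
qed

text \<open>Such a root is a nonnegative combination of \<open>I\<close>, and every member of
  \<open>I\<close> is inverted at \<open>y\<close>. Hence \<open>locmin\<close> has the fewest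
  inversions among the regions at \<open>p\<close> with lower walls \<open>I\<close>.\<close>

lemma span_inverted:
  assumes I: "\<And>\<beta>. \<beta> \<in> I \<Longrightarrow> basic (\<Phi>z p) \<beta>" and "y \<in> G" "I \<subseteq> cov y" "\<beta> \<in> \<Phi>z p" "\<beta> \<in> span I"
  shows "\<beta> \<bullet> y x < 0"
proof -
  obtain w where w: "\<And>\<beta>. \<beta> \<in> \<Phi>z p \<Longrightarrow> 0 \<le> \<beta> \<bullet> w" "\<And>\<beta>. \<beta> \<in> I \<Longrightarrow> \<beta> \<bullet> w = 0"
    "\<And>\<beta>. \<beta> \<in> \<Phi>z p \<Longrightarrow> \<beta> \<bullet> w = 0 \<Longrightarrow> ncomb I \<beta>" using omega_local[OF I] by blast
  have "\<beta> \<bullet> w = 0" using span_orthogonal[OF assms(5)] w(2) by blast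
  then have "ncomb I \<beta>" using w(3) assms(4) by blast
  moreover have "\<beta> \<noteq> 0" using \<Phi>z_root[OF assms(4)] root_nz by blast
  moreover have "0 < a \<bullet> (- y x)" if "a \<in> I" for a using cov_inv assms(2,3) that by auto
  ultimately have "0 < \<beta> \<bullet> (- y x)" by (rule ncomb_inner_pos)
  then show ?thesis by simp
qed

text \<open>If \<open>\<beta>\<close> is inverted at \<open>y\<close>, then \<open>- \<beta>\<close>
  is a nonnegative combination of walls of \<open>y\<close> through \<open>p\<close>. Each of them
  is a positive root or the negative of a member of \<open>I\<close>, hence nonnegative on
  \<open>w\<close>. This forces \<open>\<beta> \<bullet> w = 0\<close>, so \<open>\<beta>\<close>
  lies in the span of \<open>I\<close>.\<close>

lemma locmin_char:
  assumes I: "\<And>\<beta>. \<beta> \<in> I \<Longrightarrow> basic (\<Phi>z p) \<beta>" and m: "locmin p I m"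
    and y: "y \<in> Star p" "I \<subseteq> cov y" "\<And>\<gamma>. \<gamma> \<in> cov y \<Longrightarrow> \<gamma> \<bullet> p = 0 \<Longrightarrow> \<gamma> \<in> I"
  shows "y = m"
proof (rule Star_unique[of _ p])
  note yG = Star_G[OF y(1)]
  obtain w where w: "\<And>\<beta>. \<beta> \<in> \<Phi>z p \<Longrightarrow> 0 \<le> \<beta> \<bullet> w" "\<And>\<beta>. \<beta> \<in> I \<Longrightarrow> \<beta> \<bullet> w = 0"
    "\<And>\<beta>. \<beta> \<in> \<Phi>z p \<Longrightarrow> \<beta> \<bullet> w = 0 \<Longrightarrow> ncomb I \<beta>" using omega_local[OF I] by blast
  fix \<beta> assume b: "\<beta> \<in> \<Phi>z p"
  have "\<beta> \<in> span I" if "\<beta> \<bullet> y x < 0"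
  proof -
    have "ncomb {\<gamma> \<in> y ` \<Delta>. \<gamma> \<bullet> p = 0} (- \<beta>)"
      using that b y(1) root_neg[OF \<Phi>z_root[OF b]] by (intro comb_at_zero) (auto simp: \<Phi>z_def)
    then have "0 \<le> - \<beta> \<bullet> w"
    proof (rule ncomb_inner_nonneg)
      fix \<gamma> assume c: "\<gamma> \<in> {\<gamma> \<in> y ` \<Delta>. \<gamma> \<bullet> p = 0}"
      then have "\<gamma> \<in> \<Phi>" using root_image simple_root yG by blast
      then consider "\<gamma> \<in> \<Phi>p" | "- \<gamma> \<in> \<Phi>p" using pos_cases by blast
      then show "0 \<le> \<gamma> \<bullet> w"
      proof cases
        case 1 then show ?thesis using w(1) c by (simp add: \<Phi>z_def)
      next
        case 2
        then have "- \<gamma> \<in> I" using y(3)[of "- \<gamma>"] c by (simp add: cov_def)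
        then show ?thesis using w(2) by fastforce
      qed
    qed
    then have "\<beta> \<bullet> w = 0" using w(1)[OF b] by simp
    then show ?thesis using w(3) b ncomb_span by blast
  qed
  then show "\<beta> \<bullet> y x < 0 \<longleftrightarrow> \<beta> \<bullet> m x < 0"
    using span_inverted[OF I yG y(2) b] m b by (auto simp: locmin_def)
qed (use y m in \<open>auto simp: locmin_def\<close>)


section \<open>Confluence of descents\<close>

text \<open>Both points lie in the closed region of \<open>y\<close>, and \<open>p\<close> lies on
  every hyperplane through \<open>q\<close>. So \<open>p\<close> is in the closure of the face of
  \<open>q\<close>, and every region around \<open>q\<close> is also one around
  \<open>p\<close>.\<close>

lemma Star_transfer:
  assumes "y \<in> Star p" "y \<in> Star q" "\<And>\<beta>. \<beta> \<in> \<Phi>z q \<Longrightarrow> \<beta> \<bullet> p = 0"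
  shows "Star q \<subseteq> Star p"
proof
  fix h assume h: "h \<in> Star q"
  have "0 < \<beta> \<bullet> h x" if b: "\<beta> \<in> \<Phi>" "0 < \<beta> \<bullet> p" for \<beta>
  proof -
    have "0 \<le> \<beta> \<bullet> q" using b assms Star_pos Star_nonneg by blast
    moreover have "\<beta> \<bullet> q \<noteq> 0"
    proof
      assume "\<beta> \<bullet> q = 0"
      then have "\<beta> \<in> \<Phi>z q \<or> - \<beta> \<in> \<Phi>z q" using pos_cases[OF b(1)] by (auto simp: \<Phi>z_def)
      then have "\<beta> \<bullet> p = 0" using assms(3)[of \<beta>] assms(3)[of "- \<beta>"] by auto
      then show False using b by simp
    qed
    ultimately show ?thesis using Star_pos[OF h b(1)] by simp
  qed
  then show "h \<in> Star p" using h by (simp add: Star_def)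
qed

text \<open>
  A generic point of the face of \<open>y B\<close> in which the lower walls \<open>K\<close> of \<open>y B\<close> meet.
\<close>

definition "fpt y K = y (omega (ginv y ` uminus ` K))"

text \<open>All parts come from \<open>omega_at\<close> for \<open>- K\<close>, because walls are
  oriented into the region while \<open>cov\<close> stores positive roots. A local positive root not
  inverted at \<open>y\<close> would be a nonnegative combination of \<open>- K\<close> and so not
  positive at \<open>x\<close>; thus \<open>y\<close> is the highest region of the star.\<close>

lemma fpt:
  assumes "y \<in> G" "K \<subseteq> cov y"
  shows fpt_Star: "y \<in> Star (fpt y K)"
    and fpt_zero: "\<And>\<beta>. \<beta> \<in> K \<Longrightarrow> \<beta> \<in> \<Phi>z (fpt y K)"
    and fpt_comb: "\<And>\<beta>. \<beta> \<in> \<Phi>z (fpt y K) \<Longrightarrow> ncomb K \<beta>"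
    and fpt_inv: "\<And>\<beta>. \<beta> \<in> \<Phi>z (fpt y K) \<Longrightarrow> \<beta> \<bullet> y x < 0"
    and fpt_basic: "\<And>\<beta>. \<beta> \<in> K \<Longrightarrow> basic (\<Phi>z (fpt y K)) \<beta>"
proof -
  let ?p = "fpt y K"
  have "uminus ` K \<subseteq> y ` \<Delta>" using assms(2) by (auto simp: cov_def)
  note w = omega_at[OF assms(1) this, folded fpt_def]
  show "y \<in> Star ?p"
  proof -
    have "0 < \<beta> \<bullet> y x" if b: "\<beta> \<in> \<Phi>" "0 < \<beta> \<bullet> ?p" for \<beta>
      using w(2)[OF root_neg[OF b(1)]] b(2) not_pos_G[OF b(1) assms(1)] by fastforce
    then show ?thesis using assms(1) by (simp add: Star_def)
  qed
  show z: "\<beta> \<in> \<Phi>z ?p" if "\<beta> \<in> K" for \<beta>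
    using w(1)[of "- \<beta>"] that assms(2) cov_pos by (auto simp: \<Phi>z_def)
  show i: "\<beta> \<bullet> y x < 0" if b: "\<beta> \<in> \<Phi>z ?p" for \<beta>
  proof (rule ccontr)
    assume "\<not> ?thesis"
    then have "0 < \<beta> \<bullet> y x" using not_pos_G[OF \<Phi>z_root[OF b] assms(1)] by blast
    then have "ncomb (uminus ` K) \<beta>" using w(3)[OF \<Phi>z_root[OF b]] b by (simp add: \<Phi>z_def)
    then have "0 \<le> \<beta> \<bullet> (- x)"
    proof (rule ncomb_inner_nonneg)
      fix a assume "a \<in> uminus ` K"
      then show "0 \<le> a \<bullet> (- x)" using assms(2) cov_pos by (fastforce simp: \<Phi>p_def)
    qed
    then show False using b by (simp add: \<Phi>z_def \<Phi>p_def)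
  qed
  show "ncomb K \<beta>" if b: "\<beta> \<in> \<Phi>z ?p" for \<beta>
  proof (rule ncomb_uminus)
    show "ncomb (uminus ` K) (- \<beta>)"
      using w(3)[OF root_neg[OF \<Phi>z_root[OF b]]] i[OF b] b by (simp add: \<Phi>z_def)
  qed
  show "basic (\<Phi>z ?p) \<beta>" if b: "\<beta> \<in> K" for \<beta>
  proof -
    obtain f where f: "\<beta> \<bullet> f = 0" "\<And>\<gamma>. \<gamma> \<in> \<Phi> \<Longrightarrow> 0 < \<gamma> \<bullet> y x \<Longrightarrow> \<gamma> \<noteq> - \<beta> \<Longrightarrow> 0 < \<gamma> \<bullet> f"
      using cov_wall[OF assms(1)] assms(2) b by blast
    have "0 < \<gamma> \<bullet> (- f)" if "\<gamma> \<in> \<Phi>z ?p" "\<gamma> \<noteq> \<beta>" for \<gamma>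
      using f(2)[of "- \<gamma>"] that i[OF that(1)] root_neg[OF \<Phi>z_root[OF that(1)]] by auto
    then show ?thesis unfolding basic_def using z[OF b] f(1) by (intro conjI exI[of _ "- f"]) auto
  qed
qed

lemma fpt_span:
  assumes "y \<in> G" "K \<subseteq> cov y" "\<beta> \<in> \<Phi>p"
  shows "\<beta> \<in> \<Phi>z (fpt y K) \<longleftrightarrow> \<beta> \<in> span K"
proof
  assume "\<beta> \<in> span K"
  moreover have "\<gamma> \<bullet> fpt y K = 0" if "\<gamma> \<in> K" for \<gamma> using fpt_zero[OF assms(1,2) that] by (simp add: \<Phi>z_def)
  ultimately show "\<beta> \<in> \<Phi>z (fpt y K)" using assms(3) span_orthogonal[of \<beta> K "fpt y K"] by (simp add: \<Phi>z_def)
qed (use fpt_comb[OF assms(1,2)] ncomb_span in blast)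

lemma fpt_Star_subset:
  assumes "K \<subseteq> cov y" "y \<in> Star p" "\<And>\<beta>. \<beta> \<in> K \<Longrightarrow> \<beta> \<bullet> p = 0"
  shows "Star (fpt y K) \<subseteq> Star p"
proof (rule Star_transfer[OF assms(2)])
  show "y \<in> Star (fpt y K)" using fpt_Star assms Star_G by blast
  fix \<beta> assume "\<beta> \<in> \<Phi>z (fpt y K)"
  then have "\<beta> \<in> span K" using fpt_comb[OF Star_G[OF assms(2)] assms(1)] ncomb_span by blast
  then show "\<beta> \<bullet> p = 0" using assms(3) span_orthogonal by blast
qed

text \<open>In the span of \<open>I\<close>, the root \<open>\<gamma>\<close> would be a nonnegative
  combination of \<open>I\<close>, hence positive at its own facet point.\<close>

lemma basic_not_span:
  assumes "basic (\<Phi>z p) \<gamma>" "\<And>\<beta>. \<beta> \<in> I \<Longrightarrow> basic (\<Phi>z p) \<beta>" "\<gamma> \<notin> I" shows "\<gamma> \<notin> span I"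
proof
  assume s: "\<gamma> \<in> span I"
  obtain w where w: "\<And>\<beta>. \<beta> \<in> \<Phi>z p \<Longrightarrow> 0 \<le> \<beta> \<bullet> w" "\<And>\<beta>. \<beta> \<in> I \<Longrightarrow> \<beta> \<bullet> w = 0"
    "\<And>\<beta>. \<beta> \<in> \<Phi>z p \<Longrightarrow> \<beta> \<bullet> w = 0 \<Longrightarrow> ncomb I \<beta>" using omega_local[OF assms(2)] by blast
  have gz: "\<gamma> \<in> \<Phi>z p" using assms(1) by (simp add: basic_def)
  obtain f where f: "\<gamma> \<bullet> f = 0" "\<And>\<beta>. \<beta> \<in> \<Phi>z p \<Longrightarrow> \<beta> \<noteq> \<gamma> \<Longrightarrow> 0 < \<beta> \<bullet> f"
    using assms(1) unfolding basic_def by blast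
  have "\<gamma> \<bullet> w = 0" using span_orthogonal[OF s] w(2) by blast
  then have "ncomb I \<gamma>" using w(3) gz by blast
  moreover have "\<gamma> \<noteq> 0" using root_nz \<Phi>z_root gz by blast
  moreover have "0 < a \<bullet> f" if "a \<in> I" for a
    using f(2)[of a] assms(2)[OF that] assms(3) that by (auto simp: basic_def)
  ultimately have "0 < \<gamma> \<bullet> f" by (rule ncomb_inner_pos)
  then show False using f by simp
qed

text \<open>One rewriting step, performed at any point where the walls \<open>I\<close> are uncut.
  Requiring \<open>y \<noteq> m\<close> makes every step lose inversions, which gives
  termination.\<close>

definition "descent I y m \<longleftrightarrow> I \<subseteq> cov y \<and> y \<noteq> m \<and>
  (\<exists>p. (\<forall>\<beta>\<in>I. basic (\<Phi>z p) \<beta>) \<and> y \<in> Star p \<and> locmin p I m)"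

lemma descent_inversions:
  assumes "descent I y m" shows "inversions m \<subset> inversions y"
proof -
  obtain p where p: "I \<subseteq> cov y" "y \<noteq> m" "\<And>\<beta>. \<beta> \<in> I \<Longrightarrow> basic (\<Phi>z p) \<beta>" "y \<in> Star p" "locmin p I m"
    using assms unfolding descent_def by blast
  have mS: "m \<in> Star p" using p by (simp add: locmin_def)
  have "\<beta> \<in> inversions y" if b: "\<beta> \<in> inversions m" for \<beta>
  proof -
    have b: "\<beta> \<in> \<Phi>p" "\<beta> \<bullet> m x < 0" using b by (auto simp: inversions_def)
    consider "0 < \<beta> \<bullet> p" | "\<beta> \<bullet> p < 0" | "\<beta> \<bullet> p = 0" by linarith
    then have "\<beta> \<bullet> y x < 0"
    proof cases
      case 1 then show ?thesis using Star_pos[OF mS pos_root[OF b(1)]] b by simp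
    next
      case 2 then show ?thesis using Star_neg[OF p(4) pos_root[OF b(1)]] by simp
    next
      case 3
      then have z: "\<beta> \<in> \<Phi>z p" using b by (simp add: \<Phi>z_def)
      then have "\<beta> \<in> span I" using p(5) b by (simp add: locmin_def)
      then show ?thesis using span_inverted[OF p(3) Star_G[OF p(4)] p(1) z] by blast
    qed
    then show ?thesis using b by (simp add: inversions_def)
  qed
  moreover have "inversions m \<noteq> inversions y"
    using inversions_inj p(2) Star_G[OF mS] Star_G[OF p(4)] by metis
  ultimately show ?thesis by blast
qed

lemma descent_in: "descent I y m \<Longrightarrow> I \<subseteq> cov y \<and> I \<subseteq> cov m \<and> y \<in> G \<and> m \<in> G"
  unfolding descent_def locmin_def using Star_G by blast

text \<open>If all lower walls of \<open>y\<close> belong to \<open>I\<close>, then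
  \<open>locmin_char\<close> identifies \<open>y\<close> with the local minimum, and the step is not
  proper. So elements with \<open>cov y = I\<close> are normal forms.\<close>

lemma descent_cov:
  assumes "descent I y m" shows "\<exists>\<gamma>\<in>cov y. \<gamma> \<notin> I"
proof (rule ccontr)
  assume n: "\<not> ?thesis"
  obtain p where p: "I \<subseteq> cov y" "y \<noteq> m" "\<And>\<beta>. \<beta> \<in> I \<Longrightarrow> basic (\<Phi>z p) \<beta>" "y \<in> Star p" "locmin p I m"
    using assms unfolding descent_def by blast
  have "\<gamma> \<in> I" if "\<gamma> \<in> cov y" for \<gamma> using n that by blast
  then have "y = m" using locmin_char[OF p(3,5,4,1)] by blast
  then show False using p by simp
qed

text \<open>The step is proper because its target does not invert the extra wall
  \<open>\<gamma>\<close>, which by \<open>basic_not_span\<close> is outside the span of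
  \<open>I\<close>.\<close>

lemma descent_step:
  assumes y: "y \<in> G" and K: "K \<subseteq> cov y" "I \<subseteq> K" "\<gamma> \<in> K" "\<gamma> \<notin> I"
  obtains m where "descent I y m" "locmin (fpt y K) I m"
proof -
  have I: "basic (\<Phi>z (fpt y K)) \<beta>" if "\<beta> \<in> I" for \<beta> using fpt_basic[OF y K(1)] that K(2) by blast
  obtain m where m: "locmin (fpt y K) I m" using locmin_ex[OF I] by blast
  have g: "basic (\<Phi>z (fpt y K)) \<gamma>" using fpt_basic[OF y K(1)] K by blast
  have "\<not> \<gamma> \<bullet> m x < 0" using m basic_not_span[OF g I K(4)] g unfolding locmin_def basic_def by blast
  moreover have "\<gamma> \<bullet> y x < 0" using cov_inv y K by blast
  ultimately have "y \<noteq> m" by blast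
  then have "descent I y m" unfolding descent_def using m I K fpt_Star[OF y K(1)] by blast
  then show ?thesis using that m by blast
qed

abbreviation "descents I \<equiv> (descent I)\<^sup>*\<^sup>*"

lemma descent_to_locmin:
  assumes "\<And>\<beta>. \<beta> \<in> I \<Longrightarrow> basic (\<Phi>z p) \<beta>" "y \<in> Star p" "I \<subseteq> cov y" "locmin p I m"
  shows "descents I y m"
proof (cases "y = m")
  case False
  then have "descent I y m" unfolding descent_def using assms by blast
  then show ?thesis by blast
qed simp

lemma descents_in: "descents I y n \<Longrightarrow> I \<subseteq> cov y \<Longrightarrow> y \<in> G \<Longrightarrow> I \<subseteq> cov n \<and> n \<in> G"
  by (induction rule: rtranclp_induct) (use descent_in in blast)+

lemma normal_ex: "y \<in> G \<Longrightarrow> I \<subseteq> cov y \<Longrightarrow> \<exists>n. descents I y n \<and> cov n = I"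
proof (induction "card (inversions y)" arbitrary: y rule: less_induct)
  case less
  show ?case
  proof (cases "cov y = I")
    case False
    then obtain \<gamma> where "\<gamma> \<in> cov y" "\<gamma> \<notin> I" using less.prems by blast
    then obtain m where m: "descent I y m" using descent_step[of y "cov y" I \<gamma>] less.prems by blast
    have "card (inversions m) < card (inversions y)"
      using descent_inversions[OF m] finite_pos by (intro psubset_card_mono) (auto simp: inversions_def)
    then obtain n where "descents I m n" "cov n = I" using less descent_in[OF m] by blast
    then show ?thesis using m converse_rtranclp_into_rtranclp by metis
  qed blast
qed

text \<open>Each given step has an extra lower wall of \<open>y\<close>, \<open>g1\<close> or
  \<open>g2\<close>. Descending at the face where \<open>I\<close> meets just one of them gives
  \<open>n1\<close> or \<open>n2\<close>, which remain in the stars of the given points and so still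
  reach \<open>m1\<close> or \<open>m2\<close>. Both lie in the star of the face where all these
  walls meet, and its local minimum \<open>n\<close> joins them.\<close>

lemma descent_peak:
  assumes "descent I y m1" "descent I y m2"
  obtains n1 n2 n where "descent I y n1" "descents I n1 m1" "descents I n1 n"
    "descent I y n2" "descents I n2 m2" "descents I n2 n"
proof -
  obtain p1 where p1: "I \<subseteq> cov y" "y \<noteq> m1" "\<And>\<beta>. \<beta> \<in> I \<Longrightarrow> basic (\<Phi>z p1) \<beta>" "y \<in> Star p1" "locmin p1 I m1"
    using assms(1) unfolding descent_def by blast
  obtain p2 where p2: "y \<noteq> m2" "\<And>\<beta>. \<beta> \<in> I \<Longrightarrow> basic (\<Phi>z p2) \<beta>" "y \<in> Star p2" "locmin p2 I m2"
    using assms(2) unfolding descent_def by blast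
  note yG = Star_G[OF p1(4)]
  \<comment> \<open>By \<open>locmin_char\<close>, a proper step at \<open>p1\<close> leaves a lower
    wall of \<open>y\<close> through \<open>p1\<close> that is not in \<open>I\<close>.\<close>
  obtain g1 where g1: "g1 \<in> cov y" "g1 \<bullet> p1 = 0" "g1 \<notin> I"
    using locmin_char[OF p1(3,5,4,1)] p1(2) by blast
  obtain g2 where g2: "g2 \<in> cov y" "g2 \<bullet> p2 = 0" "g2 \<notin> I"
    using locmin_char[OF p2(2,4,3) p1(1)] p2(1) by blast
  define K1 K2 K where K: "K1 = insert g1 I" "K2 = insert g2 I" "K = insert g1 (insert g2 I)"
  have Kc: "K1 \<subseteq> cov y" "K2 \<subseteq> cov y" "K \<subseteq> cov y" "K1 \<subseteq> K" "K2 \<subseteq> K" "I \<subseteq> K1" "I \<subseteq> K2" "I \<subseteq> K"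
    using K g1 g2 p1(1) by auto
  obtain n1 where n1: "descent I y n1" "locmin (fpt y K1) I n1"
    using descent_step[OF yG Kc(1,6), of g1] g1 K by blast
  obtain n2 where n2: "descent I y n2" "locmin (fpt y K2) I n2"
    using descent_step[OF yG Kc(2,7), of g2] g2 K by blast
  obtain n where n: "locmin (fpt y K) I n"
    using descent_step[OF yG Kc(3,8), of g1] g1 K by blast
  have S1: "Star (fpt y K1) \<subseteq> Star p1"
    by (rule fpt_Star_subset[OF Kc(1) p1(4)]) (use K g1 p1(3) in \<open>auto simp: basic_def \<Phi>z_def\<close>)
  have S2: "Star (fpt y K2) \<subseteq> Star p2"
    by (rule fpt_Star_subset[OF Kc(2) p2(3)]) (use K g2 p2(2) in \<open>auto simp: basic_def \<Phi>z_def\<close>)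
  have z: "\<beta> \<bullet> fpt y K = 0" if "\<beta> \<in> K" for \<beta> using fpt_zero[OF yG Kc(3) that] by (simp add: \<Phi>z_def)
  have T1: "Star (fpt y K1) \<subseteq> Star (fpt y K)"
    by (rule fpt_Star_subset[OF Kc(1) fpt_Star[OF yG Kc(3)]]) (use z Kc in blast)
  have T2: "Star (fpt y K2) \<subseteq> Star (fpt y K)"
    by (rule fpt_Star_subset[OF Kc(2) fpt_Star[OF yG Kc(3)]]) (use z Kc in blast)
  have bK: "basic (\<Phi>z (fpt y K)) \<beta>" if "\<beta> \<in> I" for \<beta> using fpt_basic[OF yG Kc(3)] that Kc by blast
  have c: "I \<subseteq> cov n1" "I \<subseteq> cov n2" "n1 \<in> Star (fpt y K1)" "n2 \<in> Star (fpt y K2)"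
    using n1 n2 by (auto simp: locmin_def)
  show ?thesis
  proof (rule that[OF n1(1) _ _ n2(1)])
    show "descents I n1 m1" using descent_to_locmin[OF p1(3) _ c(1) p1(5)] c(3) S1 by blast
    show "descents I n2 m2" using descent_to_locmin[OF p2(2) _ c(2) p2(4)] c(4) S2 by blast
    show "descents I n1 n" using descent_to_locmin[OF bK _ c(1) n] c(3) T1 by blast
    show "descents I n2 n" using descent_to_locmin[OF bK _ c(2) n] c(4) T2 by blast
  qed
qed

lemma normal_stuck: "cov y = I \<Longrightarrow> \<not> descent I y m"
  using descent_cov by blast

text \<open>Newman's argument, by induction on the number of inversions. The elements
  \<open>a\<close> and \<open>b\<close> closing the peak are themselves proper descents of
  \<open>y\<close>, so the induction hypothesis applies to each, once towards the given normal form
  and once towards that of \<open>c\<close>.\<close>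

lemma normal_unique:
  "descents I y n1 \<Longrightarrow> cov n1 = I \<Longrightarrow> descents I y n2 \<Longrightarrow> cov n2 = I \<Longrightarrow> y \<in> G \<Longrightarrow> I \<subseteq> cov y \<Longrightarrow> n1 = n2"
proof (induction "card (inversions y)" arbitrary: y n1 n2 rule: less_induct)
  case less
  have IH: "a = b" if "descent I y z" "descents I z a" "cov a = I" "descents I z b" "cov b = I" for z a b
  proof (rule less(1))
    show "card (inversions z) < card (inversions y)"
      using descent_inversions[OF that(1)] finite_pos by (intro psubset_card_mono) (auto simp: inversions_def)
  qed (use that descent_in in blast)+
  show ?case
  proof (cases "y = n1 \<or> y = n2")
    case True
    then show ?thesis using less.prems normal_stuck by (metis converse_rtranclpE)
  next
    case False
    then obtain m1 m2 where m: "descent I y m1" "descents I m1 n1" "descent I y m2" "descents I m2 n2"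
      using less.prems by (metis converse_rtranclpE)
    obtain a b c where p: "descent I y a" "descents I a m1" "descents I a c"
      "descent I y b" "descents I b m2" "descents I b c"
      using descent_peak[OF m(1,3)] by blast
    have "c \<in> G" "I \<subseteq> cov c" using descents_in[OF p(3)] descent_in[OF p(1)] by auto
    then obtain n where n: "descents I c n" "cov n = I" using normal_ex by blast
    have "n1 = n"
      using IH[OF p(1) rtranclp_trans[OF p(2) m(2)] less.prems(2) rtranclp_trans[OF p(3) n(1)] n(2)] .
    moreover have "n2 = n"
      using IH[OF p(4) rtranclp_trans[OF p(5) m(4)] less.prems(4) rtranclp_trans[OF p(6) n(1)] n(2)] .
    ultimately show ?thesis by simp
  qed
qed

definition "normal_form I y = (THE n. descents I y n \<and> cov n = I)"

lemma normal_form: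
  assumes "y \<in> G" "I \<subseteq> cov y" shows "descents I y (normal_form I y)" "cov (normal_form I y) = I"
proof -
  have "\<exists>!n. descents I y n \<and> cov n = I"
    using ex_ex1I[OF normal_ex[OF assms]] normal_unique[OF _ _ _ _ assms] by blast
  then have "descents I y (normal_form I y) \<and> cov (normal_form I y) = I" unfolding normal_form_def by (rule theI'[where P = "\<lambda>n. descents I y n \<and> cov n = I"])
  then show "descents I y (normal_form I y)" "cov (normal_form I y) = I" by (rule conjunct1, rule conjunct2)
qed

lemma normal_eqI: "y \<in> G \<Longrightarrow> I \<subseteq> cov y \<Longrightarrow> descents I y n \<Longrightarrow> cov n = I \<Longrightarrow> normal_form I y = n"
  by (rule normal_unique[OF normal_form(1) normal_form(2)])

lemma normal_descents:
  assumes "y \<in> G" "I \<subseteq> cov y" "descents I y m" shows "normal_form I m = normal_form I y"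
proof -
  have m: "I \<subseteq> cov m" "m \<in> G" using descents_in assms by auto
  have "descents I y (normal_form I m)" using assms(3) normal_form(1)[OF m(2,1)] by (rule rtranclp_trans)
  from normal_eqI[OF assms(1,2) this normal_form(2)[OF m(2,1)]] show ?thesis by (rule HOL.sym)
qed

section \<open>Existence and uniqueness of an element with given lower walls and cutting
  sides\<close>

lemma Star_same_sign:
  assumes "y \<in> Star p" "w \<in> Star p" "\<kappa> \<in> \<Phi>" "\<kappa> \<bullet> p \<noteq> 0"
  shows "0 < \<kappa> \<bullet> y x \<longleftrightarrow> 0 < \<kappa> \<bullet> w x"
proof (cases "0 < \<kappa> \<bullet> p")
  case True
  then show ?thesis using Star_pos[OF assms(1,3)] Star_pos[OF assms(2,3)] by simp
next
  case False
  then have "\<kappa> \<bullet> p < 0" using assms(4) by simp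
  then show ?thesis using Star_neg[OF assms(1,3)] Star_neg[OF assms(2,3)] by simp
qed

text \<open>Both ends lie in the star of one point \<open>p\<close> at which \<open>\<beta>\<close>
  is basic, and by \<open>cut_nonzero\<close> no hyperplane cutting \<open>\<beta>\<close> contains
  \<open>p\<close>. The sides of the cutting hyperplanes are thus invariants of the
  rewriting.\<close>

lemma descent_sign:
  assumes "descent I y m" "\<beta> \<in> I" "cut_by \<kappa> \<beta>"
  shows "0 < \<kappa> \<bullet> y x \<longleftrightarrow> 0 < \<kappa> \<bullet> m x"
proof -
  obtain p where p: "basic (\<Phi>z p) \<beta>" "y \<in> Star p" "m \<in> Star p"
    using assms unfolding descent_def locmin_def by blast
  have "\<kappa> \<in> \<Phi>" using assms by (simp add: cut_by_def \<Phi>p_def)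
  then show ?thesis using Star_same_sign p(2,3) cut_nonzero[OF assms(3) p(1)] by blast
qed

lemma descents_sign:
  "descents I y m \<Longrightarrow> \<beta> \<in> I \<Longrightarrow> cut_by \<kappa> \<beta> \<Longrightarrow> 0 < \<kappa> \<bullet> y x \<longleftrightarrow> 0 < \<kappa> \<bullet> m x"
  by (induction rule: rtranclp_induct) (use descent_sign in auto)

text \<open>The element is the normal form of \<open>y\<close>: it loses exactly the lower walls
  outside \<open>I\<close> that \<open>y\<close> had and crosses no hyperplane cutting a wall in
  \<open>I\<close>.\<close>

lemma cov_ex:
  assumes "y \<in> G" "I \<subseteq> cov y"
  shows "\<exists>u\<in>G. cov u = I \<and> (\<forall>\<beta>\<in>I. \<forall>\<kappa>. cut_by \<kappa> \<beta> \<longrightarrow> (0 < \<kappa> \<bullet> u x \<longleftrightarrow> 0 < \<kappa> \<bullet> y x))"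
  using normal_form[OF assms] descents_in[OF normal_form(1)[OF assms] assms(2,1)]
    descents_sign[OF normal_form(1)[OF assms]] by blast

text \<open>
  The relative interior of the shard intersection of \<open>u\<close>, and below, as \<open>Psi\<close>, its closure.
\<close>

definition "cell u = {v. \<forall>\<beta>\<in>cov u. \<beta> \<bullet> v = 0 \<and> (\<forall>\<kappa>. cut_by \<kappa> \<beta> \<longrightarrow> 0 < (\<kappa> \<bullet> u x) * (\<kappa> \<bullet> v))}"

lemma convex_cell: "convex (cell u)"
proof (rule convexI)
  fix v w :: 'v and s t :: real
  assume vw: "v \<in> cell u" "w \<in> cell u" and st: "0 \<le> s" "0 \<le> t" "s + t = 1"
  have "0 < (\<kappa> \<bullet> u x) * (\<kappa> \<bullet> (s *\<^sub>R v + t *\<^sub>R w))" if "\<beta> \<in> cov u" "cut_by \<kappa> \<beta>" for \<beta> \<kappa>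
  proof -
    have "0 < s * ((\<kappa> \<bullet> u x) * (\<kappa> \<bullet> v)) + t * ((\<kappa> \<bullet> u x) * (\<kappa> \<bullet> w))"
      using convex_bound_lt[of "- ((\<kappa> \<bullet> u x) * (\<kappa> \<bullet> v))" 0 "- ((\<kappa> \<bullet> u x) * (\<kappa> \<bullet> w))" s t] vw st that
      by (auto simp: cell_def)
    then show ?thesis by (simp add: inner_add_right algebra_simps)
  qed
  then show "s *\<^sub>R v + t *\<^sub>R w \<in> cell u" using vw by (auto simp: cell_def inner_add_right)
qed

text \<open>Otherwise \<open>cut_ex\<close> gives a hyperplane through \<open>v\<close> cutting
  \<open>\<beta>\<close>, while the cell requires a strict sign there.\<close>

lemma cell_basic:
  assumes "v \<in> cell u" "\<beta> \<in> cov u" shows "basic (\<Phi>z v) \<beta>"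
proof (rule ccontr)
  assume n: "\<not> ?thesis"
  have "\<beta> \<in> \<Phi>z v" using assms cov_pos by (auto simp: cell_def \<Phi>z_def)
  then obtain \<kappa> where k: "\<kappa> \<in> \<Phi>z v" "cut_by \<kappa> \<beta>" using cut_ex n by blast
  then have "0 < (\<kappa> \<bullet> u x) * (\<kappa> \<bullet> v)" using assms unfolding cell_def by blast
  then show False using k by (simp add: \<Phi>z_def)
qed

text \<open>A generic point of the face in which all lower walls of \<open>w\<close> meet. Its star
  is the coset \<open>w W_J\<close> for the descent set \<open>J\<close> of \<open>w\<close>, with
  \<open>w\<close> as highest member.\<close>

definition "pt w = fpt w (cov w)"

lemma pt:
  assumes "w \<in> G"
  shows pt_Star: "w \<in> Star (pt w)"
    and pt_zero: "\<And>\<beta>. \<beta> \<in> cov w \<Longrightarrow> \<beta> \<in> \<Phi>z (pt w)"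
    and pt_comb: "\<And>\<beta>. \<beta> \<in> \<Phi>z (pt w) \<Longrightarrow> ncomb (cov w) \<beta>"
    and pt_inv: "\<And>\<beta>. \<beta> \<in> \<Phi>z (pt w) \<Longrightarrow> \<beta> \<bullet> w x < 0"
    and pt_basic: "\<And>\<beta>. \<beta> \<in> cov w \<Longrightarrow> basic (\<Phi>z (pt w)) \<beta>"
    and pt_span: "\<And>\<beta>. \<beta> \<in> \<Phi>p \<Longrightarrow> \<beta> \<in> \<Phi>z (pt w) \<longleftrightarrow> \<beta> \<in> span (cov w)"
  using fpt[OF assms subset_refl] fpt_span[OF assms subset_refl] unfolding pt_def by auto

lemma Star_sign: "w \<in> Star p \<Longrightarrow> \<kappa> \<in> \<Phi> \<Longrightarrow> \<kappa> \<bullet> p \<noteq> 0 \<Longrightarrow> 0 < (\<kappa> \<bullet> w x) * (\<kappa> \<bullet> p)"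
  using Star_pos[of w p \<kappa>] Star_neg[of w p \<kappa>] by (simp add: zero_less_mult_iff) linarith

lemma pt_cell:
  assumes "w \<in> G" shows "pt w \<in> cell w"
proof -
  have "0 < (\<kappa> \<bullet> w x) * (\<kappa> \<bullet> pt w)" if "\<beta> \<in> cov w" "cut_by \<kappa> \<beta>" for \<beta> \<kappa>
    using Star_sign[OF pt_Star[OF assms]] cut_nonzero[OF that(2) pt_basic[OF assms that(1)]] that(2)
    by (simp add: cut_by_def pos_root)
  then show ?thesis using pt_zero[OF assms] by (simp add: cell_def \<Phi>z_def)
qed

lemma open_same_side: "open {v. \<forall>\<beta>\<in>\<Phi>. 0 < \<beta> \<bullet> a \<longrightarrow> 0 < \<beta> \<bullet> v}"
proof -
  have "{v. \<forall>\<beta>\<in>\<Phi>. 0 < \<beta> \<bullet> a \<longrightarrow> 0 < \<beta> \<bullet> v} = (\<Inter>\<beta>\<in>{\<beta>\<in>\<Phi>. 0 < \<beta> \<bullet> a}. {v. 0 < \<beta> \<bullet> v})" by auto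
  moreover have "open \<dots>"
    using finite_roots by (intro open_INT ballI) (auto intro!: open_Collect_less continuous_intros)
  ultimately show ?thesis by simp
qed

text \<open>The data determine one cell common to \<open>u\<close> and \<open>u'\<close>. On this
  convex set the normal form of the local minimum at \<open>v\<close> is locally constant in
  \<open>v\<close>, hence constant; its value is \<open>u\<close> at \<open>pt u\<close> and
  \<open>u'\<close> at \<open>pt u'\<close>.\<close>

lemma cov_unique:
  assumes u: "u \<in> G" "u' \<in> G" and c: "cov u' = cov u"
    and s: "\<And>\<beta> \<kappa>. \<beta> \<in> cov u \<Longrightarrow> cut_by \<kappa> \<beta> \<Longrightarrow> 0 < \<kappa> \<bullet> u x \<longleftrightarrow> 0 < \<kappa> \<bullet> u' x"
  shows "u = u'"
proof -
  let ?I = "cov u"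
  have ce: "cell u' = cell u"
  proof -
    have e: "0 < (\<kappa> \<bullet> u x) * r \<longleftrightarrow> 0 < (\<kappa> \<bullet> u' x) * r" if "\<beta> \<in> ?I" "cut_by \<kappa> \<beta>" for \<beta> \<kappa> r
      using s[OF that] that(2) generic_G[of \<kappa> u] generic_G[of \<kappa> u'] u
      by (auto simp: zero_less_mult_iff cut_by_def \<Phi>p_def)
    have "(\<forall>\<kappa>. cut_by \<kappa> \<beta> \<longrightarrow> 0 < (\<kappa> \<bullet> u' x) * (\<kappa> \<bullet> v)) \<longleftrightarrow>
        (\<forall>\<kappa>. cut_by \<kappa> \<beta> \<longrightarrow> 0 < (\<kappa> \<bullet> u x) * (\<kappa> \<bullet> v))" if "\<beta> \<in> ?I" for \<beta> v
      using e[OF that, of _ "_ \<bullet> v"] by blast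
    then show ?thesis unfolding cell_def c by (intro Collect_cong ball_cong conj_cong) auto
  qed
  define mm where "mm v = (SOME m. locmin v ?I m)" for v
  have mm: "locmin v ?I (mm v)" if "v \<in> cell u" for v
  proof -
    have "\<exists>m. locmin v ?I m" using locmin_ex[OF cell_basic[OF that]] .
    then show ?thesis unfolding mm_def by (rule someI_ex)
  qed
  have "normal_form ?I (mm (pt u)) = normal_form ?I (mm (pt u'))"
  proof (rule connected_equivalence_relation[where R = "\<lambda>a b. normal_form ?I (mm a) = normal_form ?I (mm b)"])
    show "connected (cell u)" using convex_cell convex_connected by blast
    show "pt u \<in> cell u" "pt u' \<in> cell u" using pt_cell u ce by auto
    fix a assume a: "a \<in> cell u"
    \<comment> \<open>Near \<open>a\<close> no strict sign of \<open>a\<close> is lost, so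
      \<open>Star b \<subseteq> Star a\<close>, and the local minimum at \<open>b\<close> descends
      to the one at \<open>a\<close>.\<close>
    let ?T = "cell u \<inter> {v. \<forall>\<beta>\<in>\<Phi>. 0 < \<beta> \<bullet> a \<longrightarrow> 0 < \<beta> \<bullet> v}"
    have "normal_form ?I (mm a) = normal_form ?I (mm b)" if b: "b \<in> ?T" for b
    proof -
      have "mm b \<in> Star b" "?I \<subseteq> cov (mm b)" using mm[of b] b by (auto simp: locmin_def)
      moreover have "Star b \<subseteq> Star a" using b by (auto simp: Star_def)
      ultimately have "descents ?I (mm b) (mm a)"
        using descent_to_locmin[OF cell_basic[OF a] _ _ mm[OF a]] by blast
      then show ?thesis using normal_descents \<open>?I \<subseteq> cov (mm b)\<close> \<open>mm b \<in> Star b\<close> Star_G by metis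
    qed
    moreover have "openin (top_of_set (cell u)) ?T" using open_same_side by (intro openin_open_Int)
    ultimately show "\<exists>T. openin (top_of_set (cell u)) T \<and> a \<in> T \<and> (\<forall>b\<in>T. normal_form ?I (mm a) = normal_form ?I (mm b))"
      using a by (intro exI[of _ ?T]) auto
  qed auto
  moreover have "normal_form ?I (mm (pt z)) = z" if z: "z \<in> G" "cov z = ?I" "pt z \<in> cell u" for z
  proof -
    have "z = mm (pt z)"
      using locmin_char[OF cell_basic[OF z(3)] mm[OF z(3)] pt_Star[OF z(1)]] z(2) by blast
    then have e: "mm (pt z) = z" by simp
    show ?thesis unfolding e using normal_eqI[OF z(1) _ _ z(2)] z(2) by simp
  qed
  ultimately show ?thesis using u c ce pt_cell by metis
qed

definition "Psi w = {v. \<forall>\<beta>\<in>cov w. \<beta> \<bullet> v = 0 \<and> (\<forall>\<kappa>. cut_by \<kappa> \<beta> \<longrightarrow> 0 \<le> (\<kappa> \<bullet> w x) * (\<kappa> \<bullet> v))}"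

lemma cell_Psi: "cell w \<subseteq> Psi w" by (auto simp: cell_def Psi_def less_imp_le)

lemma Psi_segment:
  assumes "p \<in> cell w" "v \<in> Psi w" "0 \<le> t" "t < 1"
  shows "(1 - t) *\<^sub>R p + t *\<^sub>R v \<in> cell w"
proof -
  have "0 < (\<kappa> \<bullet> w x) * (\<kappa> \<bullet> ((1 - t) *\<^sub>R p + t *\<^sub>R v))" if "\<beta> \<in> cov w" "cut_by \<kappa> \<beta>" for \<beta> \<kappa>
  proof -
    have "0 < (1 - t) * ((\<kappa> \<bullet> w x) * (\<kappa> \<bullet> p)) + t * ((\<kappa> \<bullet> w x) * (\<kappa> \<bullet> v))"
    proof (rule add_pos_nonneg)
      have "0 < (\<kappa> \<bullet> w x) * (\<kappa> \<bullet> p)" using assms(1) that by (simp add: cell_def)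
      then show "0 < (1 - t) * ((\<kappa> \<bullet> w x) * (\<kappa> \<bullet> p))" using assms(4) by simp
      have "0 \<le> (\<kappa> \<bullet> w x) * (\<kappa> \<bullet> v)" using assms(2) that by (simp add: Psi_def)
      then show "0 \<le> t * ((\<kappa> \<bullet> w x) * (\<kappa> \<bullet> v))" by (rule mult_nonneg_nonneg[OF assms(3)])
    qed
    then show ?thesis by (simp add: inner_add_right algebra_simps)
  qed
  then show ?thesis using assms by (auto simp: cell_def Psi_def inner_add_right)
qed

text \<open>
  A hyperplane cutting some wall through the face of \<open>w\<close> without containing that face cannot cross
  the shard intersection of \<open>w\<close>: at a crossing point the root of the wall would have a positive
  coefficient outside the span of the basic roots \<open>cov w\<close>.
\<close>

lemma Psi_no_cross:
  assumes w: "w \<in> G" and b: "\<beta> \<in> \<Phi>z (pt w)" and k: "cut_by \<kappa> \<beta>" "\<kappa> \<bullet> pt w \<noteq> 0" and v: "v \<in> Psi w"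
  shows "0 \<le> (\<kappa> \<bullet> w x) * (\<kappa> \<bullet> v)"
proof (rule ccontr)
  assume n: "\<not> ?thesis"
  have kr: "\<kappa> \<in> \<Phi>" "\<kappa> \<in> \<Phi>p" using k by (auto simp: cut_by_def \<Phi>p_def)
  let ?a = "(\<kappa> \<bullet> w x) * (\<kappa> \<bullet> pt w)" and ?b = "(\<kappa> \<bullet> w x) * (\<kappa> \<bullet> v)"
  have ab: "0 < ?a" "?b < 0" using Star_sign[OF pt_Star[OF w] kr(1) k(2)] n by auto
  have "\<exists>t. 0 \<le> t \<and> t < 1 \<and> (1 - t) * a + t * b = 0" if "0 < a" "b < 0" for a b :: real
    using that by (intro exI[of _ "a / (a - b)"]) (auto simp: field_simps)
  then obtain t where t: "0 \<le> t" "t < 1" "(1 - t) * ?a + t * ?b = 0" using ab by blast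
  define q where "q = (1 - t) *\<^sub>R pt w + t *\<^sub>R v"
  have qc: "q \<in> cell w" unfolding q_def using Psi_segment[OF pt_cell[OF w] v t(1,2)] .
  have "(\<kappa> \<bullet> w x) * (\<kappa> \<bullet> q) = 0" using t(3) by (simp add: q_def inner_add_right algebra_simps)
  then have kq: "\<kappa> \<bullet> q = 0" using generic_G[OF kr(1) w] by simp
  have I: "\<And>\<beta>. \<beta> \<in> cov w \<Longrightarrow> basic (\<Phi>z q) \<beta>" using cell_basic[OF qc] .
  obtain om where om: "\<And>\<beta>. \<beta> \<in> \<Phi>z q \<Longrightarrow> 0 \<le> \<beta> \<bullet> om" "\<And>\<beta>. \<beta> \<in> cov w \<Longrightarrow> \<beta> \<bullet> om = 0"
    "\<And>\<beta>. \<beta> \<in> \<Phi>z q \<Longrightarrow> \<beta> \<bullet> om = 0 \<Longrightarrow> ncomb (cov w) \<beta>" using omega_local[OF I] by blast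
  have bs: "\<beta> \<in> span (cov w)" using pt_comb[OF w b] ncomb_span by blast
  have bq: "\<beta> \<bullet> q = 0" "\<beta> \<bullet> om = 0" using span_orthogonal[OF bs] om(2) qc by (auto simp: cell_def)
  obtain \<delta> r s where d: "\<delta> \<in> \<Phi>p" "\<delta> \<in> span {\<kappa>, \<beta>}" "0 < r" "0 < s" "\<beta> = r *\<^sub>R \<kappa> + s *\<^sub>R \<delta>"
    using cut_comb[OF k(1)] by blast
  have "\<delta> \<in> \<Phi>z q" using plane_zero[OF kq bq(1)] d by blast
  then have "0 \<le> \<delta> \<bullet> om" using om(1) by blast
  moreover have kz: "\<kappa> \<in> \<Phi>z q" using kr kq by (simp add: \<Phi>z_def)
  then have "0 \<le> \<kappa> \<bullet> om" using om(1) by blast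
  moreover have "r * (\<kappa> \<bullet> om) + s * (\<delta> \<bullet> om) = 0" using bq(2) d(5) by (simp add: inner_add_left)
  ultimately have "\<kappa> \<bullet> om = 0" using d(3,4)
    by (smt (verit) mult_nonneg_nonneg mult_pos_pos)
  then have "\<kappa> \<in> span (cov w)" using om(3)[OF kz] ncomb_span by blast
  then have "\<kappa> \<in> \<Phi>z (pt w)" using pt_span[OF w] kr by blast
  then show False using k by (simp add: \<Phi>z_def)
qed

text \<open>Inclusion is tested at the single point \<open>pt w\<close>. For the converse, roots
  vanishing there are combinations of \<open>cov w\<close> and vanish on all of
  \<open>Psi w\<close>, while the remaining cutting roots keep their sign on \<open>Psi w\<close> by
  \<open>Psi_no_cross\<close>.\<close>

lemma Psi_subset_iff:
  assumes u: "u \<in> G" and w: "w \<in> G"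
  shows "Psi w \<subseteq> Psi u \<longleftrightarrow> (\<forall>\<beta>\<in>cov u. \<beta> \<bullet> pt w = 0 \<and>
    (\<forall>\<kappa>. cut_by \<kappa> \<beta> \<and> \<kappa> \<bullet> pt w \<noteq> 0 \<longrightarrow> (0 < \<kappa> \<bullet> u x \<longleftrightarrow> 0 < \<kappa> \<bullet> w x)))" (is "_ \<longleftrightarrow> ?R")
proof
  assume "Psi w \<subseteq> Psi u"
  then have p: "pt w \<in> Psi u" using pt_cell[OF w] cell_Psi by blast
  have "0 < \<kappa> \<bullet> u x \<longleftrightarrow> 0 < \<kappa> \<bullet> w x" if k: "\<beta> \<in> cov u" "cut_by \<kappa> \<beta>" "\<kappa> \<bullet> pt w \<noteq> 0" for \<beta> \<kappa>
  proof -
    have kr: "\<kappa> \<in> \<Phi>" using k by (simp add: cut_by_def \<Phi>p_def)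
    have 1: "0 \<le> (\<kappa> \<bullet> u x) * (\<kappa> \<bullet> pt w)" using p k by (simp add: Psi_def)
    have 2: "0 < (\<kappa> \<bullet> w x) * (\<kappa> \<bullet> pt w)" using Star_sign[OF pt_Star[OF w] kr k(3)] .
    show ?thesis using 1 2 generic_G[OF kr u] by (auto simp: zero_le_mult_iff zero_less_mult_iff)
  qed
  then show ?R using p by (auto simp: Psi_def)
next
  assume R: ?R
  show "Psi w \<subseteq> Psi u"
  proof
    fix v assume v: "v \<in> Psi w"
    have v0: "\<gamma> \<bullet> v = 0" if "\<gamma> \<in> \<Phi>z (pt w)" for \<gamma>
      using span_orthogonal[of \<gamma> "cov w" v] pt_comb[OF w that] ncomb_span v by (auto simp: Psi_def)
    have bz: "\<beta> \<in> \<Phi>z (pt w)" if "\<beta> \<in> cov u" for \<beta> using R that cov_pos by (simp add: \<Phi>z_def)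
    have "0 \<le> (\<kappa> \<bullet> u x) * (\<kappa> \<bullet> v)" if k: "\<beta> \<in> cov u" "cut_by \<kappa> \<beta>" for \<beta> \<kappa>
    proof (cases "\<kappa> \<bullet> pt w = 0")
      case True
      then have "\<kappa> \<bullet> v = 0" using k(2) by (intro v0) (simp add: \<Phi>z_def cut_by_def)
      then show ?thesis by simp
    next
      case False
      have kr: "\<kappa> \<in> \<Phi>" using k by (simp add: cut_by_def \<Phi>p_def)
      have "0 \<le> (\<kappa> \<bullet> w x) * (\<kappa> \<bullet> v)" using Psi_no_cross[OF w bz[OF k(1)] k(2) False v] .
      moreover have "0 < \<kappa> \<bullet> u x \<longleftrightarrow> 0 < \<kappa> \<bullet> w x" using R k False by blast
      ultimately show ?thesis using generic_G[OF kr u] generic_G[OF kr w] by (auto simp: zero_le_mult_iff)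
    qed
    then show "v \<in> Psi u" using v0 bz by (simp add: Psi_def)
  qed
qed


section \<open>Lower intervals of the shard intersection order\<close>

lemma basic_image: 
  assumes "h \<in> G" shows "basic (h ` \<Psi>) (h \<kappa>) \<longleftrightarrow> basic \<Psi> \<kappa>"
proof
  assume "basic (h ` \<Psi>) (h \<kappa>)"
  then obtain f where f: "h \<kappa> \<in> h ` \<Psi>" "h \<kappa> \<bullet> f = 0" "\<And>\<gamma>. \<gamma> \<in> \<Psi> \<Longrightarrow> h \<gamma> \<noteq> h \<kappa> \<Longrightarrow> 0 < h \<gamma> \<bullet> f"
    unfolding basic_def by blast
  have "\<kappa> \<in> \<Psi>" using f(1) inj_G[OF assms] by (simp add: inj_image_mem_iff)
  moreover have "\<kappa> \<bullet> ginv h f = 0" using f(2) inner_inv'[OF assms] by simp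
  moreover have "0 < \<gamma> \<bullet> ginv h f" if "\<gamma> \<in> \<Psi>" "\<gamma> \<noteq> \<kappa>" for \<gamma>
    using f(3)[OF that(1)] that(2) inj_G[OF assms] inner_inv'[OF assms] by (simp add: inj_eq)
  ultimately show "basic \<Psi> \<kappa>" unfolding basic_def by blast
next
  assume "basic \<Psi> \<kappa>"
  then obtain f where f: "\<kappa> \<in> \<Psi>" "\<kappa> \<bullet> f = 0" "\<And>\<gamma>. \<gamma> \<in> \<Psi> \<Longrightarrow> \<gamma> \<noteq> \<kappa> \<Longrightarrow> 0 < \<gamma> \<bullet> f"
    unfolding basic_def by blast
  have "0 < \<gamma> \<bullet> h f" if "\<gamma> \<in> h ` \<Psi>" "\<gamma> \<noteq> h \<kappa>" for \<gamma>
  proof -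
    obtain \<delta> where d: "\<delta> \<in> \<Psi>" "\<gamma> = h \<delta>" using \<open>\<gamma> \<in> h ` \<Psi>\<close> by blast
    then have "0 < \<delta> \<bullet> f" using f(3)[of \<delta>] that(2) by blast
    then show ?thesis by (simp add: d(2) inner_G[OF assms])
  qed
  then show "basic (h ` \<Psi>) (h \<kappa>)"
    unfolding basic_def using f inner_G[OF assms] by (intro conjI exI[of _ "h f"]) auto
qed

lemma image_inv_roots: "h \<in> G \<Longrightarrow> h ` A = B \<Longrightarrow> ginv h ` B = A"
  using inv_left by (force simp: image_iff)

lemma plane_image:
  assumes "h \<in> G" "h ` \<Phi>z a = \<Phi>z b" "\<kappa> \<in> \<Phi>z a" "\<beta> \<in> \<Phi>z a"
  shows "h ` (\<Phi>p \<inter> span {\<kappa>, \<beta>}) \<subseteq> \<Phi>p \<inter> span {h \<kappa>, h \<beta>}"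
proof
  fix \<delta> assume "\<delta> \<in> h ` (\<Phi>p \<inter> span {\<kappa>, \<beta>})"
  then obtain \<gamma> where g: "\<gamma> \<in> \<Phi>p" "\<gamma> \<in> span {\<kappa>, \<beta>}" "\<delta> = h \<gamma>" by blast
  then have "\<gamma> \<in> \<Phi>z a" using plane_zero[of \<kappa> a \<beta>] assms(3,4) by (auto simp: \<Phi>z_def)
  then have "\<delta> \<in> \<Phi>p" using assms(2) g \<Phi>z_pos by blast
  moreover have "h \<gamma> \<in> span (h ` {\<kappa>, \<beta>})"
    using g(2) linear_span_image[OF lin[OF assms(1)]] by blast
  ultimately show "\<delta> \<in> \<Phi>p \<inter> span {h \<kappa>, h \<beta>}" using g by simp
qed

text \<open>Cutting is decided in the plane of the two roots, and all positive roots of that plane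
  vanish at \<open>a\<close> if these two do. So any \<open>h\<close> matching the local positive
  systems respects cutting.\<close>

lemma cut_image:
  assumes h: "h \<in> G" "h ` \<Phi>z a = \<Phi>z b" and kb: "\<kappa> \<in> \<Phi>z a" "\<beta> \<in> \<Phi>z a"
  shows "cut_by (h \<kappa>) (h \<beta>) \<longleftrightarrow> cut_by \<kappa> \<beta>"
proof -
  have hk: "h \<kappa> \<in> \<Phi>z b" "h \<beta> \<in> \<Phi>z b" using h kb by blast+
  have "ginv h ` (\<Phi>p \<inter> span {h \<kappa>, h \<beta>}) \<subseteq> \<Phi>p \<inter> span {ginv h (h \<kappa>), ginv h (h \<beta>)}"
    using plane_image[OF inv_in[OF h(1)] image_inv_roots[OF h] hk] .
  then have i: "ginv h ` (\<Phi>p \<inter> span {h \<kappa>, h \<beta>}) \<subseteq> \<Phi>p \<inter> span {\<kappa>, \<beta>}"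
    by (simp add: inv_left[OF h(1)])
  have "\<Phi>p \<inter> span {h \<kappa>, h \<beta>} \<subseteq> h ` (\<Phi>p \<inter> span {\<kappa>, \<beta>})"
  proof
    fix \<delta> assume d: "\<delta> \<in> \<Phi>p \<inter> span {h \<kappa>, h \<beta>}"
    then have "ginv h \<delta> \<in> \<Phi>p \<inter> span {\<kappa>, \<beta>}" using i by blast
    then have "h (ginv h \<delta>) \<in> h ` (\<Phi>p \<inter> span {\<kappa>, \<beta>})" by (rule imageI)
    then show "\<delta> \<in> h ` (\<Phi>p \<inter> span {\<kappa>, \<beta>})" by (simp add: inv_right[OF h(1)])
  qed
  then have e: "\<Phi>p \<inter> span {h \<kappa>, h \<beta>} = h ` (\<Phi>p \<inter> span {\<kappa>, \<beta>})"
    using plane_image[OF h kb] by blast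
  show ?thesis unfolding cut_by_def e basic_image[OF h(1)]
    using hk kb \<Phi>z_pos inj_G[OF h(1)] by (simp add: inj_eq)
qed

text \<open>A facet point \<open>f0\<close> of \<open>y\<close> is carried to \<open>b\<close>
  displaced towards \<open>h f0\<close>. Roots not vanishing at \<open>b\<close> get their sign from
  the star, and local ones are pulled back along \<open>h\<close>.\<close>

lemma cov_transport:
  assumes h: "h \<in> G" "h ` \<Phi>z a = \<Phi>z b" and y: "y \<in> G" "y' \<in> Star b"
    and s: "\<And>\<beta>. \<beta> \<in> \<Phi>z a \<Longrightarrow> h \<beta> \<bullet> y' x < 0 \<longleftrightarrow> \<beta> \<bullet> y x < 0"
    and b: "\<beta> \<in> cov y" "\<beta> \<in> \<Phi>z a"
  shows "h \<beta> \<in> cov y'"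
proof -
  note y'G = Star_G[OF y(2)]
  obtain f0 where f0: "\<beta> \<bullet> f0 = 0" "\<And>\<gamma>. \<gamma> \<in> \<Phi> \<Longrightarrow> 0 < \<gamma> \<bullet> y x \<Longrightarrow> \<gamma> \<noteq> - \<beta> \<Longrightarrow> 0 < \<gamma> \<bullet> f0"
    using cov_wall[OF y(1) b(1)] by blast
  obtain f where f: "\<And>\<gamma>. \<gamma> \<in> \<Phi> \<Longrightarrow> sgn (\<gamma> \<bullet> f) = (if \<gamma> \<bullet> b \<noteq> 0 then sgn (\<gamma> \<bullet> b) else sgn (\<gamma> \<bullet> h f0))"
    using lex_point[of b "h f0"] by blast
  have hb: "h \<beta> \<in> \<Phi>z b" using h b by blast
  have "sgn (h \<beta> \<bullet> f) = 0" using f[OF \<Phi>z_root[OF hb]] hb f0(1) inner_G[OF h(1)] by (simp add: \<Phi>z_def)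
  then have z: "h \<beta> \<bullet> f = 0" by (simp add: sgn_eq_0_iff)
  have n: "h \<beta> \<bullet> y' x < 0" using s b cov_inv[OF y(1) b(1)] by blast
  show ?thesis
  proof (rule wall_cov[OF y'G \<Phi>z_pos[OF hb] n z])
    fix \<gamma> assume c: "\<gamma> \<in> \<Phi>" "0 < \<gamma> \<bullet> y' x" "\<gamma> \<noteq> - h \<beta>"
    have "sgn (\<gamma> \<bullet> f) = 1"
    proof (cases "\<gamma> \<bullet> b = 0")
      case False
      then show ?thesis using f[OF c(1)] Star_nonneg[OF y(2) c(1,2)] by simp
    next
      case True
      define \<delta> where "\<delta> = ginv h \<gamma>"
      have hd: "h \<delta> = \<gamma>" "h (- \<delta>) = - \<gamma>" using inv_right[OF h(1)] lin[OF h(1)] by (auto simp: \<delta>_def linear_neg)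
      have dr: "\<delta> \<in> \<Phi>" using c h root_inv by (simp add: \<delta>_def)
      have "0 < \<delta> \<bullet> y x"
      proof (cases "\<gamma> \<in> \<Phi>p")
        case T: True
        then have "\<gamma> \<in> h ` \<Phi>z a" using h(2) True by (simp add: \<Phi>z_def)
        then have "\<delta> \<in> \<Phi>z a" using inv_left[OF h(1)] by (auto simp: \<delta>_def)
        then show ?thesis using s[of \<delta>] hd c(2) not_pos_G[OF dr y(1)] by auto
      next
        case False
        then have "- \<gamma> \<in> h ` \<Phi>z a" using h(2) True pos_cases[OF c(1)] by (simp add: \<Phi>z_def)
        then obtain \<delta>' where d': "\<delta>' \<in> \<Phi>z a" "- \<gamma> = h \<delta>'" by blast
        then have "\<delta>' = - \<delta>" using injD[OF inj_G[OF h(1)], of \<delta>' "- \<delta>"] hd(2) by simp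
        moreover have "h \<delta>' \<bullet> y' x < 0" using c(2) by (simp add: d'(2)[symmetric])
        ultimately show ?thesis using s[OF d'(1)] by simp
      qed
      moreover have "\<delta> \<noteq> - \<beta>" using c(3) hd(1) lin[OF h(1)] by (auto simp: linear_neg)
      ultimately have "0 < \<delta> \<bullet> f0" using f0(2) dr by blast
      then have "0 < \<gamma> \<bullet> h f0" using inner_G[OF h(1), of \<delta> f0] hd(1) by simp
      then show ?thesis using f[OF c(1)] True by simp
    qed
    then show "0 < \<gamma> \<bullet> f" by (simp add: sgn_1_pos)
  qed
qed

text \<open>
  The local arrangements at \<open>a\<close> and \<open>b\<close> are identified by \<open>h\<close>; corresponding regions at \<open>a\<close> and \<open>b\<close>
  have the same local inversions.
\<close>

definition "corr h a b y y' \<longleftrightarrow> h \<in> G \<and> h ` \<Phi>z a = \<Phi>z b \<and> y \<in> Star a \<and> y' \<in> Star b \<and>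
  (\<forall>\<beta>\<in>\<Phi>z a. h \<beta> \<bullet> y' x < 0 \<longleftrightarrow> \<beta> \<bullet> y x < 0)"

lemma corr_sym: assumes "corr h a b y y'" shows "corr (ginv h) b a y' y"
proof -
  have h: "h \<in> G" "h ` \<Phi>z a = \<Phi>z b" "y \<in> Star a" "y' \<in> Star b"
    and s: "\<And>\<beta>. \<beta> \<in> \<Phi>z a \<Longrightarrow> h \<beta> \<bullet> y' x < 0 \<longleftrightarrow> \<beta> \<bullet> y x < 0"
    using assms by (auto simp: corr_def)
  have "ginv h \<delta> \<bullet> y x < 0 \<longleftrightarrow> \<delta> \<bullet> y' x < 0" if d: "\<delta> \<in> \<Phi>z b" for \<delta>
  proof -
    obtain \<beta> where "\<beta> \<in> \<Phi>z a" "\<delta> = h \<beta>" using d h(2) by blast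
    then show ?thesis using s inv_left[OF h(1)] by simp
  qed
  then show ?thesis unfolding corr_def using image_inv_roots[OF h(1,2)] inv_in[OF h(1)] h by blast
qed

lemma corr_ex:
  assumes "h \<in> G" "h ` \<Phi>z a = \<Phi>z b" "y \<in> Star a" obtains y' where "corr h a b y y'"
proof -
  have hy: "h \<circ> y \<in> G" using assms Star_G comp_in by blast
  have "\<beta> \<bullet> h (y x) \<noteq> 0" if "\<beta> \<in> \<Phi>" for \<beta> using generic_G[OF that hy] by simp
  then obtain y' where y': "y' \<in> G" "\<forall>\<beta>\<in>\<Phi>. 0 < \<beta> \<bullet> y' x \<longleftrightarrow> 0 < \<beta> \<bullet> b \<or> \<beta> \<bullet> b = 0 \<and> 0 < \<beta> \<bullet> h (y x)"
    using region_lex[of b "h (y x)"] by blast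
  have "h \<beta> \<bullet> y' x < 0 \<longleftrightarrow> \<beta> \<bullet> y x < 0" if b: "\<beta> \<in> \<Phi>z a" for \<beta>
  proof -
    have hb: "h \<beta> \<in> \<Phi>z b" using b assms by blast
    then have "0 < h \<beta> \<bullet> y' x \<longleftrightarrow> 0 < \<beta> \<bullet> y x"
      using y'(2) \<Phi>z_root[OF hb] inner_G[OF assms(1)] by (simp add: \<Phi>z_def)
    then show ?thesis
      using not_pos_G[OF \<Phi>z_root[OF hb] y'(1)] not_pos_G[OF \<Phi>z_root[OF b] Star_G[OF assms(3)]] by blast
  qed
  then have "corr h a b y y'" unfolding corr_def using assms y' by (simp add: Star_def)
  then show ?thesis using that by blast
qed

lemma corr_inj: "corr h a b y1 y' \<Longrightarrow> corr h a b y2 y' \<Longrightarrow> y1 = y2"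
  unfolding corr_def by (intro Star_unique[of y1 a y2]) auto

lemma corr_cov: assumes "corr h a b y y'" shows "cov y' \<inter> \<Phi>z b = h ` (cov y \<inter> \<Phi>z a)"
proof
  have 1: "h \<beta> \<in> cov y'" if "corr h a b y y'" "\<beta> \<in> cov y" "\<beta> \<in> \<Phi>z a" for h a b y y' \<beta>
    using that unfolding corr_def by (intro cov_transport[of h a b y y' \<beta>]) (auto simp: Star_G)
  have h: "h \<in> G" "h ` \<Phi>z a = \<Phi>z b" using assms by (auto simp: corr_def)
  show "h ` (cov y \<inter> \<Phi>z a) \<subseteq> cov y' \<inter> \<Phi>z b" using 1[OF assms] h by blast
  show "cov y' \<inter> \<Phi>z b \<subseteq> h ` (cov y \<inter> \<Phi>z a)"
  proof
    fix \<delta> assume d: "\<delta> \<in> cov y' \<inter> \<Phi>z b"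
    then obtain \<beta> where b: "\<beta> \<in> \<Phi>z a" "\<delta> = h \<beta>" using h by blast
    have "ginv h \<delta> \<in> cov y" using 1[OF corr_sym[OF assms]] d by blast
    then show "\<delta> \<in> h ` (cov y \<inter> \<Phi>z a)" using b inv_left[OF h(1)] by auto
  qed
qed

text \<open>Moving the lowest region at \<open>p\<close> to the base region turns the star into one
  containing the identity, a standard parabolic subgroup. Local existence and uniqueness are reduced
  to the global ones there.\<close>

lemma bottom_transport:
  assumes g: "g \<in> Star p" "\<And>\<beta>. \<beta> \<in> \<Phi>z p \<Longrightarrow> 0 < \<beta> \<bullet> g x"
  shows "id \<in> Star (ginv g p)" "ginv g ` \<Phi>z p = \<Phi>z (ginv g p)"
proof -
  note gG = Star_G[OF g(1)]
  have "0 < \<beta> \<bullet> x" if "\<beta> \<in> \<Phi>" "0 < \<beta> \<bullet> ginv g p" for \<beta>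
  proof -
    have "0 < g \<beta> \<bullet> g x" using Star_pos[OF g(1) root_image[OF that(1) gG]] that(2) inner_inv'[OF gG] by simp
    then show ?thesis by (simp add: inner_G gG)
  qed
  then show "id \<in> Star (ginv g p)" using id_in by (simp add: Star_def)
  have "ginv g \<beta> \<in> \<Phi>z (ginv g p)" if "\<beta> \<in> \<Phi>z p" for \<beta>
    using inv_pos[OF \<Phi>z_root[OF that] gG] g(2)[OF that] that inner_G[OF inv_in[OF gG]] by (simp add: \<Phi>z_def)
  moreover have "\<delta> \<in> ginv g ` \<Phi>z p" if d: "\<delta> \<in> \<Phi>z (ginv g p)" for \<delta>
  proof -
    have "0 < g \<delta> \<bullet> g x" using d by (simp add: inner_G[OF gG] \<Phi>z_def \<Phi>p_def)
    moreover have "g \<delta> \<bullet> p = 0" using d by (simp add: inner_inv'[OF gG] \<Phi>z_def)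
    ultimately have "g \<delta> \<in> \<Phi>z p" using bottom_simple[OF g] root_image[OF \<Phi>z_root[OF d] gG] by blast
    then have "ginv g (g \<delta>) \<in> ginv g ` \<Phi>z p" by (rule imageI)
    then show ?thesis by (simp add: inv_left[OF gG])
  qed
  ultimately show "ginv g ` \<Phi>z p = \<Phi>z (ginv g p)" by blast
qed

lemma id_Star_inversions:
  assumes "id \<in> Star v" "u \<in> Star v" "\<beta> \<in> \<Phi>p" "\<beta> \<bullet> u x < 0" shows "\<beta> \<in> \<Phi>z v"
proof -
  have "0 \<le> \<beta> \<bullet> v" using Star_nonneg[OF assms(1) pos_root[OF assms(3)]] assms(3) by (simp add: \<Phi>p_def)
  moreover have "\<not> 0 < \<beta> \<bullet> v" using Star_pos[OF assms(2) pos_root[OF assms(3)]] assms(4) by auto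
  ultimately show ?thesis using assms(3) by (simp add: \<Phi>z_def)
qed

text \<open>If \<open>\<beta>\<close> were positive at \<open>v\<close> but inverted at
  \<open>u\<close>, then \<open>- \<beta>\<close> would be a nonnegative combination of the walls of
  \<open>u\<close>. Each wall is nonnegative at \<open>v\<close>, being a positive root or the
  negative of a member of \<open>cov u\<close>, which vanishes at \<open>v\<close>.\<close>

lemma Star_of_cov:
  assumes v: "id \<in> Star v" and u: "u \<in> G" "cov u \<subseteq> \<Phi>z v" shows "u \<in> Star v"
proof -
  have "0 < \<beta> \<bullet> u x" if b: "\<beta> \<in> \<Phi>" "0 < \<beta> \<bullet> v" for \<beta>
  proof (rule ccontr)
    assume "\<not> ?thesis"
    then have "0 < (- \<beta>) \<bullet> u x" using not_pos_G[OF b(1) u(1)] by simp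
    then have "ncomb (u ` \<Delta>) (- \<beta>)" using comb_at[OF u(1) root_neg[OF b(1)]] by blast
    then have "0 \<le> - \<beta> \<bullet> v"
    proof (rule ncomb_inner_nonneg)
      fix \<gamma> assume c: "\<gamma> \<in> u ` \<Delta>"
      then have r: "\<gamma> \<in> \<Phi>" using root_image simple_root u(1) by blast
      show "0 \<le> \<gamma> \<bullet> v"
      proof (cases "\<gamma> \<in> \<Phi>p")
        case True then show ?thesis using Star_nonneg[OF v r] by (simp add: \<Phi>p_def)
      next
        case False
        then have "- \<gamma> \<in> cov u" using c pos_cases[OF r] by (simp add: cov_def)
        then have "- \<gamma> \<in> \<Phi>z v" using u by blast
        then show ?thesis by (simp add: \<Phi>z_def)
      qed
    qed
    then show False using b by simp
  qed
  then show ?thesis using u by (simp add: Star_def)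
qed

text \<open>After transport to a parabolic subgroup every lower wall is local and no root outside
  the subgroup is inverted. So cutting roots that are not local have equal signs automatically, and
  \<open>cov_unique\<close> applies.\<close>

lemma cov_unique_local:
  assumes y: "y1 \<in> Star p" "y2 \<in> Star p" "cov y1 \<inter> \<Phi>z p = cov y2 \<inter> \<Phi>z p"
    and s: "\<And>\<beta> \<kappa>. \<beta> \<in> cov y1 \<Longrightarrow> \<beta> \<in> \<Phi>z p \<Longrightarrow> \<kappa> \<in> \<Phi>z p \<Longrightarrow> cut_by \<kappa> \<beta> \<Longrightarrow> \<kappa> \<bullet> y1 x < 0 \<longleftrightarrow> \<kappa> \<bullet> y2 x < 0"
  shows "y1 = y2"
proof -
  obtain g where g: "g \<in> Star p" "\<And>\<beta>. \<beta> \<in> \<Phi>z p \<Longrightarrow> 0 < \<beta> \<bullet> g x" using bottom_ex by blast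
  let ?v = "ginv g p" and ?h = "ginv g"
  have hG: "?h \<in> G" using inv_in Star_G g by blast
  note b = bottom_transport[OF g]
  obtain v1 where v1: "corr ?h p ?v y1 v1" using corr_ex[OF hG b(2) y(1)] .
  obtain v2 where v2: "corr ?h p ?v y2 v2" using corr_ex[OF hG b(2) y(2)] .
  have S: "v1 \<in> Star ?v" "v2 \<in> Star ?v" using v1 v2 by (auto simp: corr_def)
  have c: "cov v \<inter> \<Phi>z ?v = cov v" if "v \<in> Star ?v" for v
    using id_Star_inversions[OF b(1) that] cov_inv[OF Star_G[OF that]] cov_pos by blast
  have c1: "cov v1 = ?h ` (cov y1 \<inter> \<Phi>z p)" "cov v2 = cov v1"
    using corr_cov[OF v1] corr_cov[OF v2] c S y(3) by auto
  have "v1 = v2"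
  proof (rule cov_unique[OF Star_G[OF S(1)] Star_G[OF S(2)] c1(2)])
    fix \<beta> \<kappa> assume bk: "\<beta> \<in> cov v1" "cut_by \<kappa> \<beta>"
    then have kp: "\<kappa> \<in> \<Phi>p" by (simp add: cut_by_def)
    have "\<kappa> \<bullet> v1 x < 0 \<longleftrightarrow> \<kappa> \<bullet> v2 x < 0"
    proof (cases "\<kappa> \<in> \<Phi>z ?v")
      case True
      then obtain \<kappa>' where k': "\<kappa>' \<in> \<Phi>z p" "\<kappa> = ?h \<kappa>'" using b(2) by blast
      obtain \<beta>' where b': "\<beta>' \<in> cov y1" "\<beta>' \<in> \<Phi>z p" "\<beta> = ?h \<beta>'" using bk(1) c1(1) by blast
      have "cut_by \<kappa>' \<beta>'" using bk(2) cut_image[OF hG b(2) k'(1) b'(2)] k' b' by simp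
      then have "\<kappa>' \<bullet> y1 x < 0 \<longleftrightarrow> \<kappa>' \<bullet> y2 x < 0" using s b' k' by blast
      then show ?thesis using v1 v2 k' by (simp add: corr_def)
    next
      case False
      then show ?thesis using id_Star_inversions[OF b(1)] S kp by blast
    qed
    then show "0 < \<kappa> \<bullet> v1 x \<longleftrightarrow> 0 < \<kappa> \<bullet> v2 x"
      using not_pos_G[OF pos_root[OF kp]] Star_G S by blast
  qed
  then show ?thesis using corr_inj v1 v2 by blast
qed

text \<open>The element is found by \<open>cov_ex\<close> after transport to a parabolic subgroup;
  it stays in that subgroup by \<open>Star_of_cov\<close> and can be carried back.\<close>

lemma cov_ex_local:
  assumes y: "y \<in> Star p" and I: "I \<subseteq> cov y" "I \<subseteq> \<Phi>z p"
  shows "\<exists>y1\<in>Star p. cov y1 \<inter> \<Phi>z p = I \<and>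
    (\<forall>\<beta>\<in>I. \<forall>\<kappa>\<in>\<Phi>z p. cut_by \<kappa> \<beta> \<longrightarrow> (\<kappa> \<bullet> y1 x < 0 \<longleftrightarrow> \<kappa> \<bullet> y x < 0))"
proof -
  obtain g where g: "g \<in> Star p" "\<And>\<beta>. \<beta> \<in> \<Phi>z p \<Longrightarrow> 0 < \<beta> \<bullet> g x" using bottom_ex by blast
  let ?v = "ginv g p" and ?h = "ginv g"
  have gG: "g \<in> G" and hG: "?h \<in> G" using inv_in Star_G g by blast+
  note b = bottom_transport[OF g]
  obtain v where v: "corr ?h p ?v y v" using corr_ex[OF hG b(2) y] .
  have vS: "v \<in> Star ?v" using v by (simp add: corr_def)
  have hI: "?h ` I \<subseteq> cov v" "?h ` I \<subseteq> \<Phi>z ?v" using corr_cov[OF v] I by auto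
  obtain u where u: "u \<in> G" "cov u = ?h ` I"
    "\<forall>\<beta>\<in>?h ` I. \<forall>\<kappa>. cut_by \<kappa> \<beta> \<longrightarrow> (0 < \<kappa> \<bullet> u x \<longleftrightarrow> 0 < \<kappa> \<bullet> v x)"
    using cov_ex[OF Star_G[OF vS] hI(1)] by blast
  have uS: "u \<in> Star ?v" using Star_of_cov[OF b(1) u(1)] u(2) hI(2) by blast
  have gb: "g ` \<Phi>z ?v = \<Phi>z p"
  proof -
    have "g ` \<Phi>z ?v = g ` ?h ` \<Phi>z p" using b(2) by simp
    also have "\<dots> = \<Phi>z p" by (simp only: image_image inv_right[OF gG] image_ident)
    finally show ?thesis .
  qed
  obtain y1 where y1: "corr g ?v p u y1" using corr_ex[OF gG gb uS] .
  have y1S: "y1 \<in> Star p" using y1 by (simp add: corr_def)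
  have "cov u \<inter> \<Phi>z ?v = ?h ` I" using u(2) hI(2) by blast
  then have "cov y1 \<inter> \<Phi>z p = g ` ?h ` I" using corr_cov[OF y1] by simp
  then have c: "cov y1 \<inter> \<Phi>z p = I" unfolding image_image using inv_right[OF gG] by simp
  have s: "\<kappa> \<bullet> y1 x < 0 \<longleftrightarrow> \<kappa> \<bullet> y x < 0" if k: "\<beta> \<in> I" "\<kappa> \<in> \<Phi>z p" "cut_by \<kappa> \<beta>" for \<beta> \<kappa>
  proof -
    have "cut_by (?h \<kappa>) (?h \<beta>)" using cut_image[OF hG b(2) k(2)] k I by blast
    then have "0 < ?h \<kappa> \<bullet> u x \<longleftrightarrow> 0 < ?h \<kappa> \<bullet> v x" using u(3) k by blast
    moreover have r: "?h \<kappa> \<in> \<Phi>" using root_image[OF \<Phi>z_root[OF k(2)] hG] .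
    ultimately have "?h \<kappa> \<bullet> u x < 0 \<longleftrightarrow> ?h \<kappa> \<bullet> v x < 0"
      using not_pos_G[OF r u(1)] not_pos_G[OF r Star_G[OF vS]] by blast
    also have "\<dots> \<longleftrightarrow> \<kappa> \<bullet> y x < 0" using v k(2) by (simp add: corr_def)
    finally have 1: "?h \<kappa> \<bullet> u x < 0 \<longleftrightarrow> \<kappa> \<bullet> y x < 0" .
    have "?h \<kappa> \<in> \<Phi>z ?v" using b(2) k(2) by blast
    then have "g (?h \<kappa>) \<bullet> y1 x < 0 \<longleftrightarrow> ?h \<kappa> \<bullet> u x < 0" using y1 unfolding corr_def by blast
    then show ?thesis using 1 inv_right[OF gG] by simp
  qed
  show ?thesis using y1S c s by blast
qed

text \<open>Trades a region \<open>y\<close> at \<open>p\<close> for an element whose lower walls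
  all pass through \<open>p\<close>. In general \<open>u\<close> does not lie in the star of
  \<open>p\<close>; for \<open>p = pt w\<close> and \<open>y\<close> in the star, these
  \<open>u\<close> are the elements below \<open>w\<close>.\<close>

definition "linked p y u \<longleftrightarrow> u \<in> G \<and> cov u = cov y \<inter> \<Phi>z p \<and>
  (\<forall>\<beta>\<in>cov u. \<forall>\<kappa>. cut_by \<kappa> \<beta> \<longrightarrow> (0 < \<kappa> \<bullet> u x \<longleftrightarrow> 0 < \<kappa> \<bullet> y x))"

lemma linked_ex: assumes "y \<in> Star p" shows "\<exists>u. linked p y u"
proof -
  obtain u where "u \<in> G" "cov u = cov y \<inter> \<Phi>z p"
    "\<forall>\<beta>\<in>cov y \<inter> \<Phi>z p. \<forall>\<kappa>. cut_by \<kappa> \<beta> \<longrightarrow> (0 < \<kappa> \<bullet> u x \<longleftrightarrow> 0 < \<kappa> \<bullet> y x)"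
    using cov_ex[OF Star_G[OF assms] inf_le1] by blast
  then show ?thesis unfolding linked_def by auto
qed

lemma linked_unique: "linked p y u \<Longrightarrow> linked p y u' \<Longrightarrow> u = u'"
  unfolding linked_def by (intro cov_unique) auto

lemma linked_inj:
  assumes "y1 \<in> Star p" "y2 \<in> Star p" "linked p y1 u" "linked p y2 u" shows "y1 = y2"
proof (rule cov_unique_local[OF assms(1,2)])
  show "cov y1 \<inter> \<Phi>z p = cov y2 \<inter> \<Phi>z p" using assms by (simp add: linked_def)
  fix \<beta> \<kappa> assume k: "\<beta> \<in> cov y1" "\<beta> \<in> \<Phi>z p" "\<kappa> \<in> \<Phi>z p" "cut_by \<kappa> \<beta>"
  then have "\<beta> \<in> cov u" using assms(3) unfolding linked_def by blast
  then have "0 < \<kappa> \<bullet> y1 x \<longleftrightarrow> 0 < \<kappa> \<bullet> y2 x" using assms(3,4) k(4) unfolding linked_def by blast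
  then show "\<kappa> \<bullet> y1 x < 0 \<longleftrightarrow> \<kappa> \<bullet> y2 x < 0"
    using not_pos_G[OF \<Phi>z_root[OF k(3)]] Star_G assms(1,2) by blast
qed

lemma linked_Psi:
  assumes w: "w \<in> G" and y: "y \<in> Star (pt w)" and l: "linked (pt w) y u" shows "Psi w \<subseteq> Psi u"
proof -
  have uG: "u \<in> G" using l by (simp add: linked_def)
  have "\<beta> \<bullet> pt w = 0" if "\<beta> \<in> cov u" for \<beta> using l that by (simp add: linked_def \<Phi>z_def)
  moreover have "0 < \<kappa> \<bullet> u x \<longleftrightarrow> 0 < \<kappa> \<bullet> w x" if k: "\<beta> \<in> cov u" "cut_by \<kappa> \<beta>" "\<kappa> \<bullet> pt w \<noteq> 0" for \<beta> \<kappa>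
  proof -
    have "\<kappa> \<in> \<Phi>" using k by (simp add: cut_by_def \<Phi>p_def)
    then have "0 < \<kappa> \<bullet> y x \<longleftrightarrow> 0 < \<kappa> \<bullet> w x" using Star_same_sign[OF y pt_Star[OF w]] k by blast
    then show ?thesis using l k unfolding linked_def by blast
  qed
  ultimately show ?thesis unfolding Psi_subset_iff[OF uG w] by blast
qed

text \<open>Displacing \<open>pt w\<close> towards \<open>u x\<close> projects \<open>u\<close> into
  the star. The projection has the lower walls of \<open>u\<close> but possibly further ones through
  \<open>pt w\<close>, which a local normal form removes. Signs of roots not vanishing at
  \<open>pt w\<close> come from the inclusion of the \<open>Psi\<close> sets.\<close>

lemma linked_surj:
  assumes w: "w \<in> G" and u: "u \<in> G" "Psi w \<subseteq> Psi u"
  shows "\<exists>y\<in>Star (pt w). linked (pt w) y u"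
proof -
  let ?p = "pt w"
  have R: "\<And>\<beta>. \<beta> \<in> cov u \<Longrightarrow> \<beta> \<bullet> ?p = 0"
    "\<And>\<beta> \<kappa>. \<beta> \<in> cov u \<Longrightarrow> cut_by \<kappa> \<beta> \<Longrightarrow> \<kappa> \<bullet> ?p \<noteq> 0 \<Longrightarrow> 0 < \<kappa> \<bullet> u x \<longleftrightarrow> 0 < \<kappa> \<bullet> w x"
    using u(2) unfolding Psi_subset_iff[OF u(1) w] by blast+
  obtain y where y: "y \<in> G" "\<forall>\<beta>\<in>\<Phi>. 0 < \<beta> \<bullet> y x \<longleftrightarrow> 0 < \<beta> \<bullet> ?p \<or> \<beta> \<bullet> ?p = 0 \<and> 0 < \<beta> \<bullet> u x"
    using region_lex[of ?p "u x"] generic_G u(1) by blast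
  have yS: "y \<in> Star ?p" using y by (simp add: Star_def)
  have s: "\<beta> \<bullet> y x < 0 \<longleftrightarrow> \<beta> \<bullet> u x < 0" if b: "\<beta> \<in> \<Phi>z ?p" for \<beta>
    using y(2) not_pos_G[OF \<Phi>z_root[OF b] y(1)] not_pos_G[OF \<Phi>z_root[OF b] u(1)] b \<Phi>z_root[OF b]
    by (auto simp: \<Phi>z_def)
  have cz: "cov u \<subseteq> \<Phi>z ?p" using R(1) cov_pos by (auto simp: \<Phi>z_def)
  have "id \<beta> \<in> cov y" if "\<beta> \<in> cov u" for \<beta>
    using cz that by (intro cov_transport[OF id_in _ u(1) yS]) (auto simp: s)
  then have cy: "cov u \<subseteq> cov y" by auto
  obtain y1 where y1: "y1 \<in> Star ?p" "cov y1 \<inter> \<Phi>z ?p = cov u"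
    "\<forall>\<beta>\<in>cov u. \<forall>\<kappa>\<in>\<Phi>z ?p. cut_by \<kappa> \<beta> \<longrightarrow> (\<kappa> \<bullet> y1 x < 0 \<longleftrightarrow> \<kappa> \<bullet> y x < 0)"
    using cov_ex_local[OF yS cy cz] by blast
  have "0 < \<kappa> \<bullet> u x \<longleftrightarrow> 0 < \<kappa> \<bullet> y1 x" if k: "\<beta> \<in> cov u" "cut_by \<kappa> \<beta>" for \<beta> \<kappa>
  proof (cases "\<kappa> \<bullet> ?p = 0")
    case True
    then have kz: "\<kappa> \<in> \<Phi>z ?p" using k by (simp add: \<Phi>z_def cut_by_def)
    show ?thesis using y1(3) k kz s[OF kz] not_pos_G[OF \<Phi>z_root[OF kz]] u(1) Star_G[OF y1(1)] by blast
  next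
    case False
    have "\<kappa> \<in> \<Phi>" using k by (simp add: cut_by_def \<Phi>p_def)
    then show ?thesis using R(2)[OF k False] Star_same_sign[OF y1(1) pt_Star[OF w] _ False] by blast
  qed
  then have "linked ?p y1 u" unfolding linked_def using u y1 by simp
  then show ?thesis using y1 by blast
qed

text \<open>The relation composes \<open>corr\<close>, from the star of \<open>a\<close> to that of
  \<open>pt w\<close>, with \<open>linked\<close>. Both are one-to-one, so choosing values is
  harmless. The lower walls of the image are recorded because the recursion continues with
  them.\<close>

lemma shard_bij:
  assumes w: "w \<in> G" and h: "h \<in> G" "h ` \<Phi>z a = \<Phi>z (pt w)"
  obtains \<theta> where "bij_betw \<theta> (Star a) {u \<in> G. Psi w \<subseteq> Psi u}"
    "\<And>y. y \<in> Star a \<Longrightarrow> cov (\<theta> y) = h ` (cov y \<inter> \<Phi>z a)"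
proof -
  let ?p = "pt w"
  define R where "R y u \<longleftrightarrow> (\<exists>y'. corr h a ?p y y' \<and> linked ?p y' u)" for y u
  have ex: "\<exists>u. R y u" if y: "y \<in> Star a" for y
  proof -
    obtain y' where y': "corr h a ?p y y'" using corr_ex[OF h y] .
    then have "y' \<in> Star ?p" by (simp add: corr_def)
    then show ?thesis using linked_ex y' unfolding R_def by blast
  qed
  define \<theta> where "\<theta> y = (SOME u. R y u)" for y
  have R: "R y (\<theta> y)" if "y \<in> Star a" for y
    unfolding \<theta>_def using someI_ex[OF ex[OF that]] .
  have corrS: "y' \<in> Star ?p" if "corr h a ?p y y'" for y y' using that by (simp add: corr_def)
  have inj: "y1 = y2" if r: "R y1 u" "R y2 u" for y1 y2 u
  proof -
    obtain z1 z2 where z: "corr h a ?p y1 z1" "linked ?p z1 u" "corr h a ?p y2 z2" "linked ?p z2 u"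
      using r unfolding R_def by blast
    have "z1 = z2" using linked_inj[OF corrS[OF z(1)] corrS[OF z(3)] z(2,4)] .
    then show ?thesis using corr_inj z by blast
  qed
  have un: "u = u'" if r: "R y u" "R y u'" for y u u'
  proof -
    obtain z1 z2 where z: "corr h a ?p y z1" "linked ?p z1 u" "corr h a ?p y z2" "linked ?p z2 u'"
      using r unfolding R_def by blast
    have "z1 = z2" using corr_inj[OF corr_sym[OF z(1)] corr_sym[OF z(3)]] .
    then show ?thesis using linked_unique z by blast
  qed
  have "bij_betw \<theta> (Star a) {u \<in> G. Psi w \<subseteq> Psi u}"
  proof (rule bij_betwI')
    fix y1 y2 assume "y1 \<in> Star a" "y2 \<in> Star a"
    then show "\<theta> y1 = \<theta> y2 \<longleftrightarrow> y1 = y2" using R inj by metis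
  next
    fix y assume "y \<in> Star a"
    then obtain z where z: "corr h a ?p y z" "linked ?p z (\<theta> y)" using R R_def by blast
    then show "\<theta> y \<in> {u \<in> G. Psi w \<subseteq> Psi u}"
      using linked_Psi[OF w corrS[OF z(1)] z(2)] by (simp add: linked_def)
  next
    fix u assume u: "u \<in> {u \<in> G. Psi w \<subseteq> Psi u}"
    then obtain z where z: "z \<in> Star ?p" "linked ?p z u" using linked_surj[OF w] by blast
    obtain y where "corr (ginv h) ?p a z y" using corr_ex[OF inv_in[OF h(1)] image_inv_roots[OF h] z(1)] .
    then have "corr (ginv (ginv h)) a ?p y z" by (rule corr_sym)
    then have c: "corr h a ?p y z"
      using inv_inv_eq[of h] orthogonal_transformation_bij[OF orth[OF h(1)]] by simp
    then have "R y u" using z R_def by blast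
    moreover have yS: "y \<in> Star a" using c by (simp add: corr_def)
    ultimately have "u = \<theta> y" using R un by blast
    then show "\<exists>y\<in>Star a. u = \<theta> y" using yS by blast
  qed
  moreover have "cov (\<theta> y) = h ` (cov y \<inter> \<Phi>z a)" if "y \<in> Star a" for y
    using R[OF that] corr_cov unfolding R_def linked_def by blast
  ultimately show ?thesis using that by blast
qed


section \<open>Counting simplices and chains\<close>

text \<open>A common region \<open>y\<close> excludes opposite signs of a root at \<open>a\<close>
  and \<open>b\<close>, so nothing cancels in the sum. Adding points thus intersects faces of the
  permutohedron.\<close>

lemma Star_sum:
  assumes "y \<in> Star a" "y \<in> Star b"
  shows "Star (a + b) = Star a \<inter> Star b" "\<Phi>z (a + b) = \<Phi>z a \<inter> \<Phi>z b"
proof -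
  have same: "0 \<le> \<beta> \<bullet> a \<and> 0 \<le> \<beta> \<bullet> b \<or> \<beta> \<bullet> a \<le> 0 \<and> \<beta> \<bullet> b \<le> 0" if r: "\<beta> \<in> \<Phi>" for \<beta>
  proof (cases "0 < \<beta> \<bullet> y x")
    case True then show ?thesis using Star_nonneg[OF assms(1) r True] Star_nonneg[OF assms(2) r True] by blast
  next
    case False
    then show ?thesis using Star_pos[OF assms(1) r] Star_pos[OF assms(2) r] by (meson not_less)
  qed
  then show "\<Phi>z (a + b) = \<Phi>z a \<inter> \<Phi>z b"
    using pos_root by (force simp: \<Phi>z_def inner_add_right)
  show "Star (a + b) = Star a \<inter> Star b"
  proof (intro equalityI subsetI)
    fix h assume h: "h \<in> Star (a + b)"
    have "0 < \<beta> \<bullet> h x" if r: "\<beta> \<in> \<Phi>" "0 < \<beta> \<bullet> a \<or> 0 < \<beta> \<bullet> b" for \<beta>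
      using Star_pos[OF h r(1)] same[OF r(1)] r(2) by (simp add: inner_add_right) linarith
    then show "h \<in> Star a \<inter> Star b" using Star_G[OF h] by (simp add: Star_def)
  next
    fix h assume h: "h \<in> Star a \<inter> Star b"
    have "0 < \<beta> \<bullet> h x" if r: "\<beta> \<in> \<Phi>" "0 < \<beta> \<bullet> (a + b)" for \<beta>
    proof -
      have "0 < \<beta> \<bullet> a \<or> 0 < \<beta> \<bullet> b" using r(2) by (simp add: inner_add_right) linarith
      then show ?thesis using h r(1) Star_pos by blast
    qed
    then show "h \<in> Star (a + b)" using h by (simp add: Star_def)
  qed
qed

definition "is_top a w \<longleftrightarrow> w \<in> Star a \<and> (\<forall>\<beta>\<in>\<Phi>z a. \<beta> \<bullet> w x < 0)"

lemma is_top_unique: "is_top a w \<Longrightarrow> is_top a w' \<Longrightarrow> w = w'"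
  unfolding is_top_def by (intro Star_unique[of w a w']) auto

lemma is_top_pt: "w \<in> G \<Longrightarrow> is_top (pt w) w"
  using pt_Star pt_inv by (simp add: is_top_def)

lemma is_top_le:
  assumes "is_top a w" "y \<in> Star a" shows "inversions y \<subseteq> inversions w"
proof
  fix \<beta> assume "\<beta> \<in> inversions y"
  then have b: "\<beta> \<in> \<Phi>p" "\<beta> \<bullet> y x < 0" by (auto simp: inversions_def)
  have w: "w \<in> Star a" using assms by (simp add: is_top_def)
  have "\<not> 0 < \<beta> \<bullet> a" using Star_pos[OF assms(2) pos_root[OF b(1)]] b by auto
  then have "\<beta> \<bullet> w x < 0"
    using Star_neg[OF w pos_root[OF b(1)]] assms(1) b by (cases "\<beta> \<bullet> a = 0") (auto simp: is_top_def \<Phi>z_def)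
  then show "\<beta> \<in> inversions w" using b by (simp add: inversions_def)
qed

text \<open>A root vanishing at \<open>a\<close> is, up to sign, a combination of walls of
  \<open>w\<close> through \<open>a\<close>. As \<open>w\<close> is the top, these walls are
  negatives of members of \<open>cov w\<close>, so the root vanishes at \<open>pt w\<close>. Hence
  \<open>pt w\<close> represents the largest face with top \<open>w\<close>.\<close>

lemma is_top_Star:
  assumes "is_top a w" shows "Star a \<subseteq> Star (pt w)"
proof (rule Star_transfer)
  have wa: "w \<in> Star a" using assms by (simp add: is_top_def)
  then have wG: "w \<in> G" by (rule Star_G)
  show "w \<in> Star (pt w)" "w \<in> Star a" using pt_Star wa wG by auto
  fix \<beta> assume b: "\<beta> \<in> \<Phi>z a"
  have bw: "\<beta> \<bullet> w x < 0" using assms b by (simp add: is_top_def)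
  have "ncomb {\<gamma> \<in> w ` \<Delta>. \<gamma> \<bullet> a = 0} (- \<beta>)"
    using b bw by (intro comb_at_zero[OF wa root_neg[OF \<Phi>z_root]]) (auto simp: \<Phi>z_def)
  then have s: "- \<beta> \<in> span {\<gamma> \<in> w ` \<Delta>. \<gamma> \<bullet> a = 0}" by (rule ncomb_span)
  have "- \<beta> \<bullet> pt w = 0"
  proof (rule span_orthogonal[OF s])
    fix \<gamma> assume c: "\<gamma> \<in> {\<gamma> \<in> w ` \<Delta>. \<gamma> \<bullet> a = 0}"
    then have r: "\<gamma> \<in> \<Phi>" "0 < \<gamma> \<bullet> w x" using root_image simple_root simple_image_pos wG by auto
    have "\<gamma> \<notin> \<Phi>z a" using r(2) assms by (auto simp: is_top_def)
    then have "- \<gamma> \<in> \<Phi>p" using c pos_cases[OF r(1)] by (auto simp: \<Phi>z_def)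
    then have "- \<gamma> \<in> cov w" using c by (simp add: cov_def)
    then have "- \<gamma> \<in> \<Phi>z (pt w)" using pt_zero[OF wG] by blast
    then show "\<gamma> \<bullet> pt w = 0" by (simp add: \<Phi>z_def)
  qed
  then show "\<beta> \<bullet> pt w = 0" by simp
qed

lemma is_top_sum:
  assumes "y \<in> Star a" shows "is_top (a + pt y) y" "Star (a + pt y) = Star a \<inter> Star (pt y)"
    "\<Phi>z (a + pt y) = \<Phi>z a \<inter> \<Phi>z (pt y)"
  using Star_sum[OF assms pt_Star] pt_Star pt_inv assms Star_G[OF assms] by (auto simp: is_top_def)

text \<open>This description mentions only lower walls and local positive roots, the data that
  \<open>h\<close> respects, and not the points themselves.\<close>

lemma pt_add_comb:
  assumes "y \<in> Star a" shows "\<beta> \<in> \<Phi>z (a + pt y) \<longleftrightarrow> \<beta> \<in> \<Phi>p \<and> ncomb (cov y \<inter> \<Phi>z a) \<beta>"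
proof
  note yG = Star_G[OF assms]
  assume "\<beta> \<in> \<Phi>z (a + pt y)"
  then have b: "\<beta> \<in> \<Phi>z a" "\<beta> \<in> \<Phi>z (pt y)" using is_top_sum[OF assms] by auto
  have fin: "finite (cov y)" using finite_pos by (simp add: cov_def)
  have "ncomb {\<gamma> \<in> cov y. \<gamma> \<bullet> (- a) = 0} \<beta>"
  proof (rule ncomb_restrict[OF fin pt_comb[OF yG b(2)]])
    show "\<beta> \<bullet> - a = 0" using b by (simp add: \<Phi>z_def)
    fix \<gamma> assume c: "\<gamma> \<in> cov y"
    have "\<not> 0 < \<gamma> \<bullet> a" using Star_pos[OF assms cov_root[OF c]] cov_inv[OF yG c] by auto
    then show "0 \<le> \<gamma> \<bullet> (- a)" by simp
  qed
  moreover have "{\<gamma> \<in> cov y. \<gamma> \<bullet> (- a) = 0} = cov y \<inter> \<Phi>z a" using cov_pos by (auto simp: \<Phi>z_def)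
  ultimately show "\<beta> \<in> \<Phi>p \<and> ncomb (cov y \<inter> \<Phi>z a) \<beta>" using b \<Phi>z_pos by simp
next
  note yG = Star_G[OF assms]
  assume b: "\<beta> \<in> \<Phi>p \<and> ncomb (cov y \<inter> \<Phi>z a) \<beta>"
  then have s: "\<beta> \<in> span (cov y \<inter> \<Phi>z a)" using ncomb_span by blast
  have "\<beta> \<bullet> a = 0" by (rule span_orthogonal[OF s]) (simp add: \<Phi>z_def)
  moreover have "\<beta> \<bullet> pt y = 0" by (rule span_orthogonal[OF s]) (use pt_zero[OF yG] in \<open>auto simp: \<Phi>z_def\<close>)
  ultimately show "\<beta> \<in> \<Phi>z (a + pt y)" using b by (simp add: \<Phi>z_def inner_add_right)
qed

text \<open>
  The bijection of the lower interval carries the local root system of the next face to that of the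
  next shard intersection, which lets the induction on the number of vertices proceed.
\<close>

lemma type_transport:
  assumes h: "h \<in> G" "h ` \<Phi>z a = \<Phi>z b" and y: "y \<in> Star a" and u: "u \<in> G" "cov u = h ` (cov y \<inter> \<Phi>z a)"
  shows "h ` \<Phi>z (a + pt y) = \<Phi>z (pt u)"
proof
  show "h ` \<Phi>z (a + pt y) \<subseteq> \<Phi>z (pt u)"
  proof
    fix \<delta> assume "\<delta> \<in> h ` \<Phi>z (a + pt y)"
    then obtain \<beta> where b: "\<beta> \<in> \<Phi>z (a + pt y)" "\<delta> = h \<beta>" by blast
    then have "ncomb (cov u) \<delta>"
      using pt_add_comb[OF y] ncomb_image[OF lin[OF h(1)] inj_G[OF h(1)]] u(2) by simp
    moreover have "\<delta> \<in> \<Phi>z b" using b is_top_sum(3)[OF y] h(2) by blast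
    ultimately show "\<delta> \<in> \<Phi>z (pt u)" using pt_span[OF u(1)] ncomb_span \<Phi>z_pos by blast
  qed
  show "\<Phi>z (pt u) \<subseteq> h ` \<Phi>z (a + pt y)"
  proof
    fix \<delta> assume d: "\<delta> \<in> \<Phi>z (pt u)"
    have n: "ncomb (cov u) \<delta>" using pt_comb[OF u(1) d] .
    have "\<gamma> \<bullet> b = 0" if "\<gamma> \<in> cov u" for \<gamma>
    proof -
      have "\<gamma> \<in> \<Phi>z b" using that u(2) h(2) by blast
      then show ?thesis by (simp add: \<Phi>z_def)
    qed
    then have "\<delta> \<bullet> b = 0" using span_orthogonal[OF ncomb_span[OF n]] by blast
    then have "\<delta> \<in> h ` \<Phi>z a" using d h(2) by (simp add: \<Phi>z_def)
    then obtain \<beta> where b: "\<beta> \<in> \<Phi>z a" "\<delta> = h \<beta>" by blast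
    have "ncomb (ginv h ` cov u) (ginv h \<delta>)"
      using ncomb_image[OF lin inj_G n] inv_in[OF h(1)] by blast
    then have "ncomb (cov y \<inter> \<Phi>z a) \<beta>"
      using image_inv_roots[OF h(1) u(2)[symmetric]] b(2) inv_left[OF h(1)] by simp
    then show "\<delta> \<in> h ` \<Phi>z (a + pt y)" using pt_add_comb[OF y] b \<Phi>z_pos by blast
  qed
qed

text \<open>Mutual inclusion puts the lower walls of each element into the flat of the other, so the
  flats and their basic roots agree. A hyperplane cutting one of these walls misses
  \<open>pt w\<close>, where \<open>Psi_subset_iff\<close> compares the sides.\<close>

lemma Psi_antisym:
  assumes "u \<in> G" "w \<in> G" "Psi u = Psi w" shows "u = w"
proof (rule cov_unique[OF assms(1,2)])
  have 1: "cov u \<subseteq> cov w" if u: "u \<in> G" and w: "w \<in> G" and e: "Psi u = Psi w" for u w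
  proof
    fix \<beta> assume b: "\<beta> \<in> cov u"
    have z: "cov u \<subseteq> \<Phi>z (pt w)" "cov w \<subseteq> \<Phi>z (pt u)"
      using Psi_subset_iff[OF u w] Psi_subset_iff[OF w u] e cov_pos by (auto simp: \<Phi>z_def)
    have bas: "basic (\<Phi>z (pt w)) \<beta>"
    proof (rule basic_mono[OF pt_basic[OF u b]])
      show "\<beta> \<in> \<Phi>z (pt w)" using z b by blast
      show "\<Phi>z (pt w) \<subseteq> \<Phi>z (pt u)"
      proof
        fix \<gamma> assume c: "\<gamma> \<in> \<Phi>z (pt w)"
        have "\<gamma> \<bullet> pt u = 0"
          by (rule span_orthogonal[OF ncomb_span[OF pt_comb[OF w c]]]) (use z in \<open>auto simp: \<Phi>z_def\<close>)
        then show "\<gamma> \<in> \<Phi>z (pt u)" using \<Phi>z_pos[OF c] by (simp add: \<Phi>z_def)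
      qed
    qed
    show "\<beta> \<in> cov w"
    proof (rule ccontr)
      assume "\<beta> \<notin> cov w"
      then have "\<beta> \<notin> span (cov w)" using basic_not_span[OF bas pt_basic[OF w]] by blast
      then show False using pt_comb[OF w] ncomb_span z(1) b by blast
    qed
  qed
  show e: "cov w = cov u" using 1 assms by blast
  fix \<beta> \<kappa> assume k: "\<beta> \<in> cov u" "cut_by \<kappa> \<beta>"
  have "basic (\<Phi>z (pt w)) \<beta>" using pt_basic[OF assms(2)] k e by blast
  then have "\<kappa> \<bullet> pt w \<noteq> 0" using cut_nonzero k by blast
  then show "0 < \<kappa> \<bullet> u x \<longleftrightarrow> 0 < \<kappa> \<bullet> w x" using Psi_subset_iff[OF assms(1,2)] assms(3) k by blast
qed

text \<open>Vertex sets grow upwards: a new \<open>w\<close> is the top of a face containing all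
  earlier vertices, and \<open>w \<notin> X\<close> makes it strictly larger than them in weak
  order.\<close>

inductive Dset :: "('v \<Rightarrow> 'v) set \<Rightarrow> bool" where
  Dset_empty: "Dset {}"
| Dset_insert: "\<lbrakk>Dset X; w \<in> G; X \<subseteq> Star (pt w); w \<notin> X\<rbrakk> \<Longrightarrow> Dset (insert w X)"

lemma Dset_finite: "Dset X \<Longrightarrow> finite X \<and> X \<subseteq> G"
  by (induction rule: Dset.induct) auto

lemma Dset_first_unique:
  assumes "w \<in> X" "X \<subseteq> Star (pt w)" "w' \<in> X" "X \<subseteq> Star (pt w')" shows "w = w'"
proof -
  have G: "w \<in> G" "w' \<in> G" using assms Star_G by blast+
  have "inversions w = inversions w'"
    using is_top_le[OF is_top_pt[OF G(1)]] is_top_le[OF is_top_pt[OF G(2)]] assms by blast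
  then show ?thesis using inversions_inj G by blast
qed

lemma Dset_first:
  assumes "Dset X" "X \<noteq> {}" obtains w where "w \<in> X" "X \<subseteq> Star (pt w)" "w \<in> G"
  using assms
proof (cases rule: Dset.cases)
  case (Dset_insert X' w)
  then show ?thesis using that[of w] pt_Star by auto
qed simp

lemma Dset_remove:
  assumes "Dset X" "w \<in> X" "X \<subseteq> Star (pt w)" shows "Dset (X - {w})"
  using assms(1)
proof (cases rule: Dset.cases)
  case (Dset_insert X' w')
  then have "X \<subseteq> Star (pt w')" "w' \<in> X" using pt_Star by auto
  then have "w = w'" using Dset_first_unique assms by blast
  then show ?thesis using Dset_insert by simp
qed (use assms in simp)

text \<open>The index \<open>k\<close> counts vertices, so the dimension is \<open>k - 1\<close> and
  \<open>k = 0\<close> belongs to the empty simplex.\<close>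

definition "Dn a k = {X. Dset X \<and> X \<subseteq> Star a \<and> card X = k}"
definition "Tn a k = {X \<in> Dn a k. \<exists>w. is_top a w \<and> w \<in> X}"

lemma finite_Dn: "finite (Dn a k)"
  by (rule finite_subset[of _ "Pow G"]) (use Dset_finite finite_G in \<open>auto simp: Dn_def\<close>)

text \<open>Since \<open>y\<close> is the top of the intersection face at \<open>a + pt y\<close>,
  fixing \<open>y\<close> as the first vertex amounts to passing to that face. This closes the
  recursion.\<close>

lemma Tn_sum:
  assumes "y \<in> Star a" shows "Tn (a + pt y) k = {X \<in> Dn a k. y \<in> X \<and> X \<subseteq> Star (pt y)}"
proof -
  have "(\<exists>w. is_top (a + pt y) w \<and> w \<in> X) \<longleftrightarrow> y \<in> X" for X
    using is_top_sum(1)[OF assms] is_top_unique by metis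
  then show ?thesis unfolding Tn_def Dn_def is_top_sum(2)[OF assms] by auto
qed

lemma Dn_split:
  assumes "Y \<subseteq> Star a"
  shows "card {X \<in> Dn a k. \<exists>y\<in>Y. y \<in> X \<and> X \<subseteq> Star (pt y)} = (\<Sum>y\<in>Y. card (Tn (a + pt y) k))"
proof -
  have "{X \<in> Dn a k. \<exists>y\<in>Y. y \<in> X \<and> X \<subseteq> Star (pt y)} = (\<Union>y\<in>Y. Tn (a + pt y) k)"
    using assms by (auto simp: Tn_sum subset_iff)
  moreover have "card (\<Union>y\<in>Y. Tn (a + pt y) k) = (\<Sum>y\<in>Y. card (Tn (a + pt y) k))"
  proof (rule card_UN_disjoint)
    have "Star a \<subseteq> G" using Star_G by blast
    then show "finite Y" using assms finite_G finite_subset by (metis subset_trans)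
    show "\<forall>y\<in>Y. finite (Tn (a + pt y) k)" using finite_Dn by (simp add: Tn_def)
    show "\<forall>y\<in>Y. \<forall>z\<in>Y. y \<noteq> z \<longrightarrow> Tn (a + pt y) k \<inter> Tn (a + pt z) k = {}"
    proof (intro ballI impI)
      fix y z assume yz: "y \<in> Y" "z \<in> Y" "y \<noteq> z"
      have False if "X \<in> Tn (a + pt y) k" "X \<in> Tn (a + pt z) k" for X
        using that yz assms Dset_first_unique[of y X z] by (auto simp: Tn_sum subset_iff)
      then show "Tn (a + pt y) k \<inter> Tn (a + pt z) k = {}" by blast
    qed
  qed
  ultimately show ?thesis by simp
qed

lemma Dn_all: "Dn a (Suc k) = {X \<in> Dn a (Suc k). \<exists>y\<in>Star a. y \<in> X \<and> X \<subseteq> Star (pt y)}"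
proof -
  have "\<exists>y\<in>Star a. y \<in> X \<and> X \<subseteq> Star (pt y)" if "X \<in> Dn a (Suc k)" for X
  proof -
    have X: "Dset X" "X \<noteq> {}" "X \<subseteq> Star a" using that by (auto simp: Dn_def)
    obtain w where "w \<in> X" "X \<subseteq> Star (pt w)" "w \<in> G" by (rule Dset_first[OF X(1,2)])
    then show ?thesis using X(3) by blast
  qed
  then show ?thesis by blast
qed

lemma top_first:
  assumes t: "is_top a w" and X: "X \<subseteq> Star a" "w \<in> X" "y \<in> X" "X \<subseteq> Star (pt y)" shows "y = w"
proof -
  have G: "y \<in> G" "w \<in> G" using X Star_G by blast+
  have "inversions y = inversions w"
    using is_top_le[OF t] is_top_le[OF is_top_pt[OF G(1)]] X by blast
  then show ?thesis using inversions_inj G by blast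
qed

text \<open>Deleting the top vertex is reversible: by \<open>is_top_Star\<close>, every set of
  regions in the star of \<open>a\<close> also lies in the star of \<open>pt w\<close>.\<close>

lemma card_Tn:
  assumes t: "is_top a w" shows "card (Tn a (Suc k)) = card {X \<in> Dn a k. w \<notin> X}"
proof -
  have wa: "w \<in> Star a" using t by (simp add: is_top_def)
  note wG = Star_G[OF wa]
  have "bij_betw (insert w) {X \<in> Dn a k. w \<notin> X} (Tn a (Suc k))"
  proof (rule bij_betw_imageI)
    show "inj_on (insert w) {X \<in> Dn a k. w \<notin> X}"
      by (rule inj_onI) (metis (no_types, lifting) insert_ident mem_Collect_eq)
    show "insert w ` {X \<in> Dn a k. w \<notin> X} = Tn a (Suc k)"
    proof (intro equalityI subsetI)
      fix Y assume "Y \<in> insert w ` {X \<in> Dn a k. w \<notin> X}"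
      then obtain X where X: "Dset X" "X \<subseteq> Star a" "card X = k" "w \<notin> X" "Y = insert w X"
        by (auto simp: Dn_def)
      have "X \<subseteq> Star (pt w)" using is_top_Star[OF t] X by blast
      then have "Dset Y" using X wG Dset_insert by blast
      moreover have "card Y = Suc k" using X Dset_finite by simp
      ultimately show "Y \<in> Tn a (Suc k)" using X wa t by (auto simp: Tn_def Dn_def)
    next
      fix Y assume "Y \<in> Tn a (Suc k)"
      then have Y: "Dset Y" "Y \<subseteq> Star a" "card Y = Suc k" "w \<in> Y"
        using is_top_unique[OF t] by (auto simp: Tn_def Dn_def)
      have "Dset (Y - {w})" by (rule Dset_remove[OF Y(1,4)]) (use Y is_top_Star[OF t] in blast)
      then have "Y - {w} \<in> {X \<in> Dn a k. w \<notin> X}" using Y Dset_finite by (auto simp: Dn_def)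
      moreover have "Y = insert w (Y - {w})" using Y by blast
      ultimately show "Y \<in> insert w ` {X \<in> Dn a k. w \<notin> X}" by blast
    qed
  qed
  then show ?thesis using bij_betw_same_card by fastforce
qed

lemma card_Tn_1: assumes "is_top a w" shows "card (Tn a (Suc 0)) = 1"
proof -
  have "{X \<in> Dn a 0. w \<notin> X} = {{}}"
    using Dset_finite Dset_empty by (auto simp: Dn_def)
  then show ?thesis using card_Tn[OF assms, of 0] by simp
qed

text \<open>The second \<open>Suc\<close> guarantees that a vertex remains once the top is deleted;
  the sum runs over the greatest remaining vertex, which differs from \<open>w\<close> because
  \<open>w\<close> is the top.\<close>

lemma card_Tn_Suc:
  assumes t: "is_top a w"
  shows "card (Tn a (Suc (Suc k))) = (\<Sum>y\<in>Star a - {w}. card (Tn (a + pt y) (Suc k)))"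
proof -
  have "{X \<in> Dn a (Suc k). w \<notin> X} = {X \<in> Dn a (Suc k). \<exists>y\<in>Star a - {w}. y \<in> X \<and> X \<subseteq> Star (pt y)}"
  proof (intro Collect_cong conj_cong HOL.refl)
    fix X assume X: "X \<in> Dn a (Suc k)"
    then obtain y where y: "y \<in> Star a" "y \<in> X" "X \<subseteq> Star (pt y)" using Dn_all[of a k] by blast
    have s: "X \<subseteq> Star a" using X by (simp add: Dn_def)
    show "w \<notin> X \<longleftrightarrow> (\<exists>y\<in>Star a - {w}. y \<in> X \<and> X \<subseteq> Star (pt y))"
      using y top_first[OF t s] by blast
  qed
  then show ?thesis
    unfolding card_Tn[OF t] Dn_split[OF Diff_subset, symmetric] by (rule arg_cong)
qed

section \<open>Chains in the shard intersection order\<close>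

definition "is_chain X \<longleftrightarrow> X \<subseteq> G \<and> (\<forall>u\<in>X. \<forall>w\<in>X. Psi w \<subseteq> Psi u \<or> Psi u \<subseteq> Psi w)"
text \<open>The shard intersection order is reverse inclusion, so the maximum \<open>w\<close> of a
  chain has the smallest \<open>Psi\<close>.\<close>

definition "Cn w k = {X. is_chain X \<and> card X = k \<and> w \<in> X \<and> (\<forall>u\<in>X. Psi w \<subseteq> Psi u)}"

lemma chain_finite: assumes "is_chain X" shows "finite X"
proof -
  have "X \<subseteq> G" using assms by (simp add: is_chain_def)
  then show ?thesis using finite_G by (rule finite_subset)
qed

lemma chain_card_0: "is_chain X \<and> card X = 0 \<longleftrightarrow> X = {}"
proof
  assume "is_chain X \<and> card X = 0"
  then show "X = {}" using chain_finite[of X] by auto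
qed (simp add: is_chain_def)

lemma finite_Cn: "finite (Cn w k)"
  by (rule finite_subset[of _ "Pow G"]) (use finite_G in \<open>auto simp: Cn_def is_chain_def\<close>)

lemma chain_max:
  assumes "is_chain X" "X \<noteq> {}" shows "\<exists>w\<in>X. \<forall>u\<in>X. Psi w \<subseteq> Psi u"
proof -
  have fin: "finite (Psi ` X)" using chain_finite[OF assms(1)] by simp
  obtain m where m: "m \<in> Psi ` X" "\<forall>b\<in>Psi ` X. b \<subseteq> m \<longrightarrow> m = b"
    using finite_has_minimal[OF fin] assms(2) by blast
  then obtain w where w: "w \<in> X" "m = Psi w" by blast
  have min: "Psi w \<subseteq> Psi u" if u: "u \<in> X" for u
  proof -
    have "Psi w \<subseteq> Psi u \<or> Psi u \<subseteq> Psi w" using assms(1) w(1) u by (simp add: is_chain_def)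
    moreover have "m = Psi u" if "Psi u \<subseteq> Psi w" using m(2) u that w(2) by blast
    ultimately show ?thesis using w(2) by blast
  qed
  then show ?thesis using w(1) by blast
qed

lemma card_Cn:
  assumes w: "w \<in> G"
  shows "card (Cn w (Suc k)) = card {X. is_chain X \<and> card X = k \<and> (\<forall>u\<in>X. u \<noteq> w \<and> Psi w \<subseteq> Psi u)}" (is "_ = card ?A")
proof -
  have "bij_betw (insert w) ?A (Cn w (Suc k))"
  proof (rule bij_betw_imageI)
    show "inj_on (insert w) ?A"
    proof (rule inj_onI)
      fix X Y assume a: "X \<in> ?A" "Y \<in> ?A" "insert w X = insert w Y"
      then have "w \<notin> X" "w \<notin> Y" by auto
      then show "X = Y" using a(3) by (simp add: insert_ident)
    qed
    show "insert w ` ?A = Cn w (Suc k)"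
    proof (intro equalityI subsetI)
      fix Y assume "Y \<in> insert w ` ?A"
      then obtain X where X: "is_chain X" "card X = k" "\<forall>u\<in>X. u \<noteq> w \<and> Psi w \<subseteq> Psi u" "Y = insert w X" by blast
      have "finite X" using chain_finite X(1) .
      then have "card Y = Suc k" using X by auto
      moreover have "is_chain Y" using X w by (auto simp: is_chain_def)
      ultimately show "Y \<in> Cn w (Suc k)" using X by (auto simp: Cn_def)
    next
      fix Y assume Y: "Y \<in> Cn w (Suc k)"
      have "Y - {w} \<in> ?A" using Y by (auto simp: Cn_def is_chain_def)
      moreover have "Y = insert w (Y - {w})" using Y by (auto simp: Cn_def)
      ultimately show "Y \<in> insert w ` ?A" by (rule rev_image_eqI)
    qed
  qed
  then show ?thesis using bij_betw_same_card by fastforce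
qed

lemma card_Cn_1: assumes "w \<in> G" shows "card (Cn w (Suc 0)) = 1"
proof -
  have "is_chain X \<and> card X = 0 \<and> (\<forall>u\<in>X. u \<noteq> w \<and> Psi w \<subseteq> Psi u) \<longleftrightarrow> X = {}" for X
    unfolding conj_assoc[symmetric] chain_card_0 by auto
  then have "{X. is_chain X \<and> card X = 0 \<and> (\<forall>u\<in>X. u \<noteq> w \<and> Psi w \<subseteq> Psi u)} = {{}}" by simp
  then show ?thesis using card_Cn[OF assms, of 0] by simp
qed

lemma card_UN_Cn:
  assumes "Y \<subseteq> G" shows "card (\<Union>u\<in>Y. Cn u k) = (\<Sum>u\<in>Y. card (Cn u k))"
proof (rule card_UN_disjoint)
  show "finite Y" using assms finite_G by (rule finite_subset)
  show "\<forall>u\<in>Y. finite (Cn u k)" using finite_Cn by blast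
  show "\<forall>u\<in>Y. \<forall>v\<in>Y. u \<noteq> v \<longrightarrow> Cn u k \<inter> Cn v k = {}"
  proof (intro ballI impI)
    fix u v assume uv: "u \<in> Y" "v \<in> Y" "u \<noteq> v"
    have False if X: "X \<in> Cn u k" "X \<in> Cn v k" for X
    proof -
      have "Psi u \<subseteq> Psi v" "Psi v \<subseteq> Psi u" using X by (simp_all add: Cn_def)
      then have "Psi u = Psi v" by (rule subset_antisym)
      then show False using Psi_antisym[of u v] uv assms by blast
    qed
    then show "Cn u k \<inter> Cn v k = {}" by blast
  qed
qed

text \<open>Below the deleted maximum the chain has a maximum \<open>u\<close> of its own;
  \<open>Psi_antisym\<close> makes it unique and keeps the chain away from \<open>w\<close>.\<close>

lemma card_Cn_Suc:
  assumes w: "w \<in> G"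
  shows "card (Cn w (Suc (Suc k))) = (\<Sum>u\<in>{u \<in> G. Psi w \<subseteq> Psi u} - {w}. card (Cn u (Suc k)))"
proof -
  let ?A = "{X. is_chain X \<and> card X = Suc k \<and> (\<forall>u\<in>X. u \<noteq> w \<and> Psi w \<subseteq> Psi u)}"
  have "?A = (\<Union>u\<in>{u \<in> G. Psi w \<subseteq> Psi u} - {w}. Cn u (Suc k))"
  proof (intro equalityI subsetI)
    fix X assume X: "X \<in> ?A"
    have "X \<noteq> {}" using X by auto
    have "is_chain X" using X by simp
    obtain u where u: "u \<in> X" "\<forall>v\<in>X. Psi u \<subseteq> Psi v"
      using chain_max[OF \<open>is_chain X\<close> \<open>X \<noteq> {}\<close>] by blast
    then have "X \<in> Cn u (Suc k)" using X by (simp add: Cn_def)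
    moreover have "u \<in> {u \<in> G. Psi w \<subseteq> Psi u} - {w}" using u X by (auto simp: is_chain_def)
    ultimately show "X \<in> (\<Union>u\<in>{u \<in> G. Psi w \<subseteq> Psi u} - {w}. Cn u (Suc k))" by blast
  next
    fix X assume "X \<in> (\<Union>u\<in>{u \<in> G. Psi w \<subseteq> Psi u} - {w}. Cn u (Suc k))"
    then obtain u where u: "u \<in> G" "Psi w \<subseteq> Psi u" "u \<noteq> w" "X \<in> Cn u (Suc k)" by blast
    have "v \<noteq> w \<and> Psi w \<subseteq> Psi v" if v: "v \<in> X" for v
    proof -
      have uv: "Psi u \<subseteq> Psi v" using u v by (simp add: Cn_def)
      moreover have "v \<noteq> w" using Psi_antisym[OF u(1) w] u uv by blast
      ultimately show ?thesis using u by blast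
    qed
    then show "X \<in> ?A" using u by (simp add: Cn_def)
  qed
  moreover have "{u \<in> G. Psi w \<subseteq> Psi u} - {w} \<subseteq> G" by blast
  ultimately show ?thesis using card_Cn[OF w, of "Suc k"] card_UN_Cn by simp
qed

text \<open>Both sides satisfy the same recursion, and \<open>shard_bij\<close> matches the index
  sets of the sums. By \<open>type_transport\<close> the hypothesis holds again, with the same
  \<open>h\<close>, for \<open>a + pt y\<close> and \<open>\<theta> y\<close>; hence the induction
  is general in \<open>a\<close> and \<open>w\<close>.\<close>

lemma card_Tn_Cn:
  assumes "w \<in> G" "h \<in> G" "h ` \<Phi>z a = \<Phi>z (pt w)" shows "card (Tn a (Suc k)) = card (Cn w (Suc k))"
  using assms
proof (induction k arbitrary: a w)
  case 0
  obtain t where "is_top a t" using top_ex is_top_def by blast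
  then show ?case using card_Tn_1 card_Cn_1 0 by simp
next
  case (Suc k)
  note w = Suc.prems(1) and h = Suc.prems(2,3)
  let ?L = "{u \<in> G. Psi w \<subseteq> Psi u}"
  obtain t where t: "is_top a t" using top_ex is_top_def by blast
  obtain \<theta> where th: "bij_betw \<theta> (Star a) ?L" "\<And>y. y \<in> Star a \<Longrightarrow> cov (\<theta> y) = h ` (cov y \<inter> \<Phi>z a)"
    using shard_bij[OF w h] by blast
  have thG: "\<theta> y \<in> G" if "y \<in> Star a" for y using th(1) that by (auto simp: bij_betw_def)
  have type: "h ` \<Phi>z (a + pt y) = \<Phi>z (pt (\<theta> y))" if "y \<in> Star a" for y
    using type_transport[OF h that thG[OF that] th(2)[OF that]] .
  \<comment> \<open>It has to be shown that \<open>\<theta>\<close> sends the top to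
    \<open>w\<close>, so that both sums omit corresponding terms. At the preimage \<open>y0\<close>
    of \<open>w\<close> the local roots do not shrink on adding \<open>pt y0\<close>, so all of them
    are inverted and \<open>y0\<close> is the top.\<close>
  have "w \<in> \<theta> ` Star a" using th(1) w by (auto simp: bij_betw_def)
  then obtain y0 where y0: "y0 \<in> Star a" "w = \<theta> y0" by blast
  have "h ` \<Phi>z (a + pt y0) = h ` \<Phi>z a" using type[OF y0(1)] h(2) y0(2) by simp
  then have "\<Phi>z (a + pt y0) = \<Phi>z a" using inj_G[OF h(1)] by (simp add: inj_image_eq_iff)
  then have "is_top a y0" using is_top_sum(1)[OF y0(1)] y0(1) by (simp add: is_top_def)
  then have tw: "\<theta> t = w" using is_top_unique[OF t] y0(2) by simp
  have ta: "t \<in> Star a" using t by (simp add: is_top_def)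
  have bij: "bij_betw \<theta> (Star a - {t}) (?L - {w})"
    using bij_betw_DiffI[OF th(1), of "{t}" "{w}"] ta tw w by (auto simp: bij_betw_def)
  have "card (Tn a (Suc (Suc k))) = (\<Sum>y\<in>Star a - {t}. card (Tn (a + pt y) (Suc k)))"
    using card_Tn_Suc[OF t] .
  also have "\<dots> = (\<Sum>y\<in>Star a - {t}. card (Cn (\<theta> y) (Suc k)))"
    using Suc.IH[OF thG h(1) type] by (intro sum.cong) auto
  also have "\<dots> = (\<Sum>u\<in>?L - {w}. card (Cn u (Suc k)))"
    using sum.reindex_bij_betw[OF bij, of "\<lambda>u. card (Cn u (Suc k))"] .
  also have "\<dots> = card (Cn w (Suc (Suc k)))" using card_Cn_Suc[OF w] by simp
  finally show ?case .
qed

theorem card_Dset_chain: "card {X. Dset X \<and> card X = k} = card {X. is_chain X \<and> card X = k}"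
proof (cases k)
  case 0
  have "{X. is_chain X \<and> card X = k} = {{}}" by (simp add: 0 chain_card_0)
  moreover have "{X. Dset X \<and> card X = k} = {{}}" using 0 Dset_finite Dset_empty by auto
  ultimately show ?thesis by simp
next
  case (Suc m)
  have S0: "Star 0 = G" by (auto simp: Star_def)
  have "{X. Dset X \<and> card X = k} = Dn 0 (Suc m)"
    using Suc Dset_finite S0 by (auto simp: Dn_def)
  then have "card {X. Dset X \<and> card X = k} = (\<Sum>y\<in>G. card (Tn (0 + pt y) (Suc m)))"
    using Dn_split[of G 0 "Suc m"] Dn_all[of 0 m] S0 by simp
  \<comment> \<open>At the outermost level the two local systems are literally the same, so the
    induction starts from \<open>h = id\<close>.\<close>
  also have "\<dots> = (\<Sum>w\<in>G. card (Cn w (Suc m)))"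
    by (intro sum.cong HOL.refl card_Tn_Cn[OF _ id_in]) auto
  also have "\<dots> = card (\<Union>w\<in>G. Cn w (Suc m))" using card_UN_Cn by simp
  also have "(\<Union>w\<in>G. Cn w (Suc m)) = {X. is_chain X \<and> card X = k}"
  proof (intro equalityI subsetI)
    fix X assume "X \<in> {X. is_chain X \<and> card X = k}"
    then have X: "is_chain X" "card X = Suc m" "X \<noteq> {}" using Suc by auto
    obtain w where "w \<in> X" "\<forall>u\<in>X. Psi w \<subseteq> Psi u" using chain_max[OF X(1,3)] by blast
    then show "X \<in> (\<Union>w\<in>G. Cn w (Suc m))" using X by (auto simp: Cn_def is_chain_def)
  qed (auto simp: Cn_def Suc)
  finally show ?thesis .
qed


section \<open>The pulling triangulation of the permutohedron\<close>

definition "perm = convex hull ((\<lambda>w. w x) ` G)"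
definition "face a = convex hull ((\<lambda>w. w x) ` Star a)"
definition "vle p q \<longleftrightarrow> (\<exists>u\<in>G. \<exists>w\<in>G. p = u x \<and> q = w x \<and> inversions w \<subseteq> inversions u)"

lemma orbit_inj: "inj_on (\<lambda>w. w x) G"
proof (rule inj_onI)
  fix u w assume uw: "u \<in> G" "w \<in> G" "u x = w x"
  then have "inversions u = inversions w" by (simp add: inversions_def)
  then show "u = w" using inversions_inj uw by blast
qed

text \<open>The orbit lies on a sphere, so the tangent hyperplane at \<open>w x\<close> leaves all
  other orbit points strictly on one side.\<close>

lemma vertex_extreme:
  assumes "w \<in> G" "A \<subseteq> G" "w \<in> A" shows "w x extreme_point_of (convex hull ((\<lambda>w. w x) ` A))"
proof -
  let ?S = "(\<lambda>w. w x) ` A - {w x}"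
  have fin: "finite ?S" using assms(2) finite_G finite_subset by blast
  have "?S \<subseteq> {y. w x \<bullet> y < w x \<bullet> w x}"
  proof
    fix y assume "y \<in> ?S"
    then obtain h where h: "h \<in> A" "y = h x" "h x \<noteq> w x" by blast
    have "0 < (w x - h x) \<bullet> (w x - h x)" using h by simp
    moreover have "h x \<bullet> h x = w x \<bullet> w x" using inner_G assms h by (metis subsetD)
    ultimately show "y \<in> {y. w x \<bullet> y < w x \<bullet> w x}"
      using h(2) by (simp add: inner_diff_left inner_diff_right inner_commute)
  qed
  then have "convex hull ?S \<subseteq> {y. w x \<bullet> y < w x \<bullet> w x}"
    by (rule hull_minimal) (rule convex_halfspace_lt)
  then have "w x \<notin> convex hull ?S" by blast
  then have "w x extreme_point_of (convex hull (insert (w x) ?S))"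
    by (rule extreme_point_of_convex_hull_insert[OF fin])
  moreover have "insert (w x) ?S = (\<lambda>w. w x) ` A" using assms(3) by blast
  ultimately show ?thesis by simp
qed

lemma extreme_points_hull:
  assumes "A \<subseteq> G" shows "v extreme_point_of (convex hull ((\<lambda>w. w x) ` A)) \<longleftrightarrow> v \<in> (\<lambda>w. w x) ` A"
  using extreme_point_of_convex_hull[of v "(\<lambda>w. w x) ` A"] vertex_extreme assms by blast

lemma hull_orbit_mem:
  assumes "w \<in> G" "A \<subseteq> G" "w x \<in> convex hull ((\<lambda>w. w x) ` A)" shows "w \<in> A"
proof -
  have "w x extreme_point_of (convex hull ((\<lambda>w. w x) ` G))" using vertex_extreme assms by blast
  moreover have "convex hull ((\<lambda>w. w x) ` A) \<subseteq> convex hull ((\<lambda>w. w x) ` G)"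
    using assms by (intro hull_mono) blast
  ultimately have "w x extreme_point_of (convex hull ((\<lambda>w. w x) ` A))"
    using assms(3) unfolding extreme_point_of_def by blast
  then have "w x \<in> (\<lambda>w. w x) ` A" using extreme_point_of_convex_hull by blast
  then show ?thesis using orbit_inj assms by (auto dest: inj_onD)
qed

lemma Star_subset_G: "Star a \<subseteq> G" using Star_G by blast

text \<open>For \<open>w\<close> in the star, \<open>ginv w a\<close> is dominant, so
  \<open>dom_max\<close> bounds \<open>a\<close> on the orbit of \<open>x\<close>. Equality at
  \<open>h\<close> makes \<open>ginv h a\<close> maximal in its orbit, hence dominant, which says
  that \<open>h\<close> lies in the star.\<close>

lemma Star_maximizes:
  assumes "h \<in> G" "w \<in> Star a" shows "a \<bullet> h x \<le> a \<bullet> w x" "a \<bullet> h x = a \<bullet> w x \<longleftrightarrow> h \<in> Star a"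
proof -
  note wG = Star_G[OF assms(2)]
  have dom: "0 \<le> \<alpha> \<bullet> ginv w a" if "\<alpha> \<in> \<Delta>" for \<alpha>
    using Star_simple[OF assms(2) that] inner_inv'[OF wG] by simp
  have e: "a \<bullet> h x = (ginv h \<circ> w) (ginv w a) \<bullet> x" if "h \<in> G" for h
    using inner_inv[OF that] inv_right[OF wG] by simp
  have e2: "a \<bullet> w x = ginv w a \<bullet> x" using inner_inv[OF wG] by simp
  show le: "a \<bullet> h x \<le> a \<bullet> w x"
    unfolding e[OF assms(1)] e2 by (rule dom_max[OF comp_in[OF inv_in[OF assms(1)] wG] dom])
  have le': "a \<bullet> k x \<le> a \<bullet> w x" if "k \<in> G" for k
    unfolding e[OF that] e2 by (rule dom_max[OF comp_in[OF inv_in[OF that] wG] dom])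
  show "a \<bullet> h x = a \<bullet> w x \<longleftrightarrow> h \<in> Star a"
  proof
    assume eq: "a \<bullet> h x = a \<bullet> w x"
    have d: "0 \<le> \<alpha> \<bullet> ginv h a" if "\<alpha> \<in> \<Delta>" for \<alpha>
    proof (rule max_dom[OF _ that])
      fix g assume g: "g \<in> G"
      have "g (ginv h a) \<bullet> x = a \<bullet> h (ginv g x)" using inner_inv'[OF g] inner_inv'[OF inv_in[OF assms(1)]]
          inner_inv[OF assms(1)] by simp
      also have "\<dots> \<le> a \<bullet> w x" using le'[OF comp_in[OF assms(1) inv_in[OF g]]] by simp
      also have "\<dots> = ginv h a \<bullet> x" using eq inner_inv[OF assms(1)] by simp
      finally show "g (ginv h a) \<bullet> x \<le> ginv h a \<bullet> x" .
    qed
    have "0 < \<beta> \<bullet> h x" if b: "\<beta> \<in> \<Phi>" "0 < \<beta> \<bullet> a" for \<beta>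
    proof (rule ccontr)
      assume "\<not> ?thesis"
      then have "0 < (- \<beta>) \<bullet> h x" using not_pos_G[OF b(1) assms(1)] by simp
      then have "ginv h (- \<beta>) \<in> \<Phi>p" using inv_pos[OF root_neg[OF b(1)] assms(1)] by blast
      then have "0 \<le> ginv h (- \<beta>) \<bullet> ginv h a" using dominant_pos d by blast
      then show False using b(2) inner_G[OF inv_in[OF assms(1)]] by simp
    qed
    then show "h \<in> Star a" using assms(1) by (simp add: Star_def)
  next
    assume h: "h \<in> Star a"
    have "0 \<le> \<alpha> \<bullet> ginv h a" if "\<alpha> \<in> \<Delta>" for \<alpha>
      using Star_simple[OF h that] inner_inv'[OF assms(1)] by simp
    then have "(ginv w \<circ> h) (ginv h a) \<bullet> x \<le> ginv h a \<bullet> x"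
      by (intro dom_max comp_in inv_in wG assms(1))
    then have "ginv w a \<bullet> x \<le> ginv h a \<bullet> x" using inv_right[OF assms(1)] by simp
    then have "a \<bullet> w x \<le> a \<bullet> h x" using inner_inv[OF wG] inner_inv[OF assms(1)] by simp
    then show "a \<bullet> h x = a \<bullet> w x" using le by simp
  qed
qed

lemma Star_ne: "Star a \<noteq> {}" using bottom_ex by blast

text \<open>The functional \<open>a\<close> supports the polytope. A face of the hull of a finite
  set is the hull of some of its points, and those attaining the maximum of \<open>a\<close> are
  given by the star.\<close>

lemma face_of_perm: "face a face_of perm" 
  and face_eq: "w \<in> Star a \<Longrightarrow> face a = perm \<inter> {y. a \<bullet> y = a \<bullet> w x}"
proof -
  have *: "face a face_of perm \<and> face a = perm \<inter> {y. a \<bullet> y = a \<bullet> w x}" if w: "w \<in> Star a" for w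
  proof -
    let ?r = "a \<bullet> w x"
    have le: "perm \<subseteq> {y. a \<bullet> y \<le> ?r}"
      unfolding perm_def using Star_maximizes(1)[OF _ w]
      by (intro hull_minimal) (auto simp: convex_halfspace_le)
    have f: "(perm \<inter> {y. a \<bullet> y = ?r}) face_of perm"
      using le by (intro face_of_Int_supporting_hyperplane_le) (auto simp: perm_def)
    have "perm \<inter> {y. a \<bullet> y = ?r} = face a"
    proof
      show "face a \<subseteq> perm \<inter> {y. a \<bullet> y = ?r}"
        unfolding face_def
      proof (rule hull_minimal)
        show "convex (perm \<inter> {y. a \<bullet> y = ?r})"
          unfolding perm_def by (intro convex_Int convex_convex_hull convex_hyperplane)
        show "(\<lambda>w. w x) ` Star a \<subseteq> perm \<inter> {y. a \<bullet> y = ?r}"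
          using Star_maximizes(2)[OF _ w] Star_G by (auto simp: perm_def intro!: hull_inc)
      qed
      obtain S where S: "S \<subseteq> (\<lambda>w. w x) ` G" "perm \<inter> {y. a \<bullet> y = ?r} = convex hull S"
        using face_of_convex_hull_subset[of "(\<lambda>w. w x) ` G" "perm \<inter> {y. a \<bullet> y = ?r}"] f finite_G
        by (auto simp: perm_def finite_imp_compact)
      have "S \<subseteq> (\<lambda>w. w x) ` Star a"
      proof
        fix v assume v: "v \<in> S"
        then obtain h where h: "h \<in> G" "v = h x" using S by blast
        have "v \<in> convex hull S" using v by (rule hull_inc)
        then have "a \<bullet> h x = ?r" using S(2) h by blast
        then show "v \<in> (\<lambda>w. w x) ` Star a" using Star_maximizes(2)[OF h(1) w] h by blast
      qed
      then show "perm \<inter> {y. a \<bullet> y = ?r} \<subseteq> face a" unfolding S(2) face_def by (rule hull_mono)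
    qed
    then show ?thesis using f by simp
  qed
  show "face a face_of perm" using * Star_ne by blast
  show "face a = perm \<inter> {y. a \<bullet> y = a \<bullet> w x}" if "w \<in> Star a" using * that by blast
qed

lemma face_mem: "w \<in> G \<Longrightarrow> w x \<in> face a \<longleftrightarrow> w \<in> Star a"
  using hull_orbit_mem[of w "Star a"] Star_subset_G by (auto simp: face_def intro: hull_inc)

lemma face_zero: "face 0 = perm"
proof -
  have "Star 0 = G" by (auto simp: Star_def)
  then show ?thesis by (simp add: face_def perm_def)
qed

text \<open>Faces of a polytope are exposed, and the exposing normal serves as the point
  \<open>a\<close>. Nonemptiness forces the bound \<open>b\<close> to be the maximum of this
  functional.\<close>

lemma faces_perm:
  assumes "F face_of perm" "F \<noteq> {}" obtains a where "F = face a"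
proof -
  have "polyhedron perm" unfolding perm_def
    using finite_G by (intro polytope_imp_polyhedron) (auto simp: polytope_def)
  then have "F exposed_face_of perm" using assms(1) exposed_face_of_polyhedron by blast
  then obtain a b where ab: "perm \<subseteq> {y. a \<bullet> y \<le> b}" "F = perm \<inter> {y. a \<bullet> y = b}"
    unfolding exposed_face_of_def by blast
  obtain w where w: "w \<in> Star a" using Star_ne by blast
  have wp: "w x \<in> perm" using Star_G[OF w] by (auto simp: perm_def intro: hull_inc)
  have "perm \<subseteq> {y. a \<bullet> y \<le> a \<bullet> w x}"
    unfolding perm_def using Star_maximizes(1)[OF _ w]
    by (intro hull_minimal) (auto simp: convex_halfspace_le)
  moreover obtain y where "y \<in> perm" "a \<bullet> y = b" using ab assms(2) by blast
  ultimately have "b \<le> a \<bullet> w x" by blast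
  then have "b = a \<bullet> w x" using ab(1) wp by fastforce
  then have "F = face a" using face_eq[OF w] ab(2) by simp
  then show ?thesis by (rule that)
qed

text \<open>The vertex order reverses the weak order, so the vertex pulled in a face is the one with
  the most inversions.\<close>

lemma minimal_face:
  assumes "is_top a w" shows "minimal_vertices vle (face a) = {w x}"
proof -
  have wS: "w \<in> Star a" using assms by (simp add: is_top_def)
  have ext: "v extreme_point_of face a \<longleftrightarrow> (\<exists>h\<in>Star a. v = h x)" for v
    unfolding face_def extreme_points_hull[OF Star_subset_G] by blast
  have vle: "vle (u x) (h x) \<longleftrightarrow> inversions h \<subseteq> inversions u" if "u \<in> G" "h \<in> G" for u h
    unfolding vle_def using orbit_inj that by (metis inj_onD)
  have "v \<in> minimal_vertices vle (face a) \<longleftrightarrow> v = w x" for v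
  proof
    assume v: "v \<in> minimal_vertices vle (face a)"
    then obtain h where h: "h \<in> Star a" "v = h x" using ext by (auto simp: minimal_vertices_def)
    have "vle (w x) v" using vle[OF Star_G[OF wS] Star_G[OF h(1)]] is_top_le[OF assms h(1)] h by simp
    moreover have "w x extreme_point_of face a" using ext wS by blast
    ultimately show "v = w x" using v by (auto simp: minimal_vertices_def)
  next
    assume v: "v = w x"
    have "u = w x" if u: "u extreme_point_of face a" "vle u (w x)" for u
    proof -
      obtain h where h: "h \<in> Star a" "u = h x" using ext u by blast
      have "inversions w \<subseteq> inversions h" using vle[OF Star_G[OF h(1)] Star_G[OF wS]] u h by simp
      then have "inversions h = inversions w" using is_top_le[OF assms h(1)] by blast
      then show ?thesis using inversions_inj Star_G h wS by blast
    qed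
    then show "v \<in> minimal_vertices vle (face a)" using v ext wS by (auto simp: minimal_vertices_def)
  qed
  then show ?thesis by blast
qed

lemma is_top_ex: "\<exists>w. is_top a w" using top_ex is_top_def by blast

abbreviation "vhull X \<equiv> convex hull ((\<lambda>w. w x) ` X)"

text \<open>In the cone case the apex is the top \<open>w\<close> of \<open>P = face a\<close>. The
  other vertices lie in \<open>face a\<close>, hence in the star of \<open>pt w\<close>, and they
  differ from \<open>w\<close> because \<open>F\<close> avoids the apex.\<close>

lemma pulling_imp_Dset:
  assumes "pulling_simplex vle P \<sigma>" "P face_of perm"
  shows "\<exists>X. Dset X \<and> (\<lambda>w. w x) ` X \<subseteq> P \<and> \<sigma> = vhull X"
  using assms
proof (induction rule: pulling_simplex.induct)
  case empty
  then show ?case using Dset_empty by (intro exI[of _ "{}"]) simp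
next
  case (base P v F \<sigma>)
  then have "F face_of perm" using face_of_trans by blast
  then show ?case using base face_of_imp_subset by blast
next
  case (cone P v F \<sigma>)
  then have Fp: "F face_of perm" using face_of_trans by blast
  then obtain X where X: "Dset X" "(\<lambda>w. w x) ` X \<subseteq> F" "\<sigma> = vhull X" using cone by blast
  have "P \<noteq> {}" using cone(1) by (auto simp: minimal_vertices_def extreme_point_of_def)
  then obtain a where a: "P = face a" using faces_perm cone by metis
  obtain w where w: "is_top a w" using is_top_ex by blast
  then have v: "v = w x" using minimal_face cone(1) a by simp
  have wS: "w \<in> Star a" using w by (simp add: is_top_def)
  note wG = Star_G[OF wS]
  have XG: "X \<subseteq> G" using Dset_finite X by blast
  have XP: "(\<lambda>w. w x) ` X \<subseteq> face a" using X(2) face_of_imp_subset[OF cone(2)] a by blast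
  then have "X \<subseteq> Star a" using face_mem XG by blast
  then have "X \<subseteq> Star (pt w)" using is_top_Star[OF w] by blast
  moreover have "w \<notin> X" using X(2) cone(3) v by blast
  ultimately have "Dset (insert w X)" using X wG by (intro Dset_insert) auto
  moreover have "(\<lambda>w. w x) ` insert w X \<subseteq> P" using XP a face_mem[OF wG] wS by simp
  moreover have "convex hull (insert v \<sigma>) = vhull (insert w X)"
    unfolding X(3) v image_insert by (rule hull_insert[symmetric])
  ultimately show ?case by blast
qed

lemma face_subface: "Star a \<subseteq> Star b \<Longrightarrow> face a face_of face b"
  by (rule face_of_subset[OF face_of_perm _ face_of_imp_subset[OF face_of_perm]])
    (unfold face_def, intro hull_mono image_mono)

lemma pulling_base:
  assumes "pulling_simplex vle (face b) \<sigma>" "Star b \<subseteq> Star a" "is_top a w" "w \<notin> Star b"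
  shows "pulling_simplex vle (face a) \<sigma>" "pulling_simplex vle (face a) (convex hull (insert (w x) \<sigma>))"
proof -
  have "w \<in> Star a" using assms(3) by (simp add: is_top_def)
  then have "w \<in> G" by (rule Star_G)
  then have "w x \<notin> face b" using face_mem assms by blast
  then show "pulling_simplex vle (face a) \<sigma>" "pulling_simplex vle (face a) (convex hull (insert (w x) \<sigma>))"
    using pulling_simplex.base[OF minimal_face[OF assms(3)] face_subface[OF assms(2)] _ assms(1)]
      pulling_simplex.cone[OF minimal_face[OF assms(3)] face_subface[OF assms(2)] _ assms(1)] by auto
qed

lemma pulling_empty_face:
  assumes "is_top a w"
  shows "pulling_simplex vle (face a) {}" "pulling_simplex vle (face a) (convex hull {w x})"
  using pulling_simplex.base[OF minimal_face[OF assms] empty_face_of _ pulling_simplex.empty]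
    pulling_simplex.cone[OF minimal_face[OF assms] empty_face_of _ pulling_simplex.empty] by auto

text \<open>Each application of a pulling rule needs a face avoiding the top. If \<open>w\<close> is
  the top, the rest \<open>X\<close> with greatest vertex \<open>v\<close> lies in the face at
  \<open>b + pt v\<close>, whose top \<open>v\<close> is smaller than \<open>w\<close>. If the top
  is some other \<open>t\<close>, one passes first to the face at \<open>a + pt w\<close>, which
  misses \<open>t\<close> for the same reason.\<close>

lemma Dset_imp_pulling:
  "Dset X \<Longrightarrow> X \<subseteq> Star a \<Longrightarrow> pulling_simplex vle (face a) (vhull X)"
proof (induction arbitrary: a rule: Dset.induct)
  case Dset_empty
  obtain w where "is_top a w" using is_top_ex by blast
  then show ?case using pulling_empty_face by simp
next
  case (Dset_insert X w)
  have top_case: "pulling_simplex vle (face b) (vhull (insert w X))"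
    if t: "is_top b w" and X: "X \<subseteq> Star b" for b
  proof (cases "X = {}")
    case True
    then show ?thesis using pulling_empty_face(2)[OF t] by simp
  next
    case False
    obtain v where v: "v \<in> X" "X \<subseteq> Star (pt v)" "v \<in> G" by (rule Dset_first[OF Dset_insert(1) False])
    have vb: "v \<in> Star b" using v X by blast
    let ?c = "b + pt v"
    have c: "Star ?c = Star b \<inter> Star (pt v)" "is_top ?c v" using is_top_sum[OF vb] by auto
    have wn: "w \<notin> Star ?c"
    proof
      assume "w \<in> Star ?c"
      then have "inversions w \<subseteq> inversions v" using is_top_le[OF c(2)] by blast
      moreover have "inversions v \<subseteq> inversions w" using is_top_le[OF t vb] .
      ultimately have "v = w" using inversions_inj v Dset_insert(2) by blast
      then show False using v Dset_insert by blast
    qed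
    have "pulling_simplex vle (face ?c) (vhull X)" using Dset_insert.IH[of ?c] c v X by blast
    then have "pulling_simplex vle (face b) (convex hull (insert (w x) (vhull X)))"
      using pulling_base(2)[OF _ _ t wn] c by blast
    moreover have "convex hull (insert (w x) (vhull X)) = vhull (insert w X)"
      unfolding image_insert by (rule hull_insert[symmetric])
    ultimately show ?thesis by simp
  qed
  have wa: "w \<in> Star a" "X \<subseteq> Star a" using Dset_insert.prems by auto
  obtain t where t: "is_top a t" using is_top_ex by blast
  show ?case
  proof (cases "t = w")
    case True
    then show ?thesis using top_case t wa by blast
  next
    case False
    let ?c = "a + pt w"
    have c: "Star ?c = Star a \<inter> Star (pt w)" "is_top ?c w" using is_top_sum[OF wa(1)] by auto
    have tn: "t \<notin> Star ?c"
    proof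
      assume "t \<in> Star ?c"
      then have "inversions t \<subseteq> inversions w" using is_top_le[OF c(2)] by blast
      moreover have "inversions w \<subseteq> inversions t" using is_top_le[OF t wa(1)] .
      moreover have "t \<in> Star a" using t by (simp add: is_top_def)
      then have "t \<in> G" by (rule Star_G)
      ultimately have "t = w" using inversions_inj Dset_insert(2) by blast
      then show False using False by blast
    qed
    have "X \<subseteq> Star ?c" using c wa Dset_insert(3) by blast
    then have "pulling_simplex vle (face ?c) (vhull (insert w X))" using top_case c by blast
    then show ?thesis using pulling_base(1)[OF _ _ t tn] c by blast
  qed
qed

lemma pulling_triangulation_Dset: "pulling_triangulation vle perm = vhull ` {X. Dset X}"
proof (intro equalityI subsetI)
  fix \<sigma> assume "\<sigma> \<in> pulling_triangulation vle perm"
  moreover have "perm face_of perm" by (rule face_of_refl) (simp add: perm_def)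
  ultimately show "\<sigma> \<in> vhull ` {X. Dset X}"
    using pulling_imp_Dset unfolding pulling_triangulation_def by blast
next
  fix \<sigma> assume "\<sigma> \<in> vhull ` {X. Dset X}"
  then obtain X where X: "Dset X" "\<sigma> = vhull X" by blast
  have "X \<subseteq> Star 0" using Dset_finite[OF X(1)] by (auto simp: Star_def)
  then show "\<sigma> \<in> pulling_triangulation vle perm"
    using Dset_imp_pulling[OF X(1), of 0] X(2) face_zero by (simp add: pulling_triangulation_def)
qed

lemma simplex_inj: "inj_on (\<lambda>X. vhull X) {X. Dset X}"
proof (rule inj_onI)
  have 1: "X \<subseteq> Y" if "Dset X" "Dset Y" "vhull X = vhull Y" for X Y
  proof
    fix w assume w: "w \<in> X"
    then have "w x \<in> vhull Y" using that(3) hull_inc[of "w x" "(\<lambda>w. w x) ` X" convex] by simp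
    then show "w \<in> Y" using hull_orbit_mem[of w Y] Dset_finite that w by blast
  qed
  fix X Y assume "X \<in> {X. Dset X}" "Y \<in> {X. Dset X}" "vhull X = vhull Y"
  then show "X = Y" using 1[of X Y] 1[of Y X] by simp
qed

text \<open>If \<open>v\<close> is the greatest vertex of \<open>X\<close>, the functional
  \<open>pt v\<close> is constant on the vertices from \<open>X\<close> but takes another value at
  \<open>w\<close>, which is outside \<open>Star (pt v)\<close>.\<close>

lemma Dset_affine_independent: "Dset X \<Longrightarrow> \<not> affine_dependent ((\<lambda>w. w x) ` X)"
proof (induction rule: Dset.induct)
  case Dset_empty
  then show ?case by simp
next
  case (Dset_insert X w)
  have "w x \<notin> affine hull ((\<lambda>w. w x) ` X)"
  proof (cases "X = {}")
    case False
    obtain v where v: "v \<in> X" "X \<subseteq> Star (pt v)" "v \<in> G" by (rule Dset_first[OF Dset_insert(1) False])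
    have vw: "v \<in> Star (pt w)" using v Dset_insert(3) by blast
    have wn: "w \<notin> Star (pt v)"
    proof
      assume "w \<in> Star (pt v)"
      then have "inversions w = inversions v"
        using is_top_le[OF is_top_pt[OF v(3)]] is_top_le[OF is_top_pt[OF Dset_insert(2)] vw] by blast
      then show False using inversions_inj v Dset_insert by blast
    qed
    have vS: "v \<in> Star (pt v)" using v by blast
    have "affine hull ((\<lambda>w. w x) ` X) \<subseteq> {y. pt v \<bullet> y = pt v \<bullet> v x}"
      using Star_maximizes(2)[OF _ vS] v(2) Star_G
      by (intro hull_minimal) (auto simp: affine_hyperplane)
    moreover have "pt v \<bullet> w x \<noteq> pt v \<bullet> v x" using Star_maximizes(2)[OF Dset_insert(2) vS] wn by blast
    ultimately show ?thesis by blast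
  qed simp
  then show ?case using affine_independent_insert[OF Dset_insert.IH] by simp
qed

lemma aff_dim_simplex:
  assumes "Dset X" shows "aff_dim (vhull X) = int (card X) - 1"
proof -
  have "inj_on (\<lambda>w. w x) X" using Dset_finite[OF assms] orbit_inj inj_on_subset by blast
  then have "card ((\<lambda>w. w x) ` X) = card X" by (rule card_image)
  then show ?thesis
    using aff_dim_affine_independent[OF Dset_affine_independent[OF assms]] by (simp add: aff_dim_convex_hull)
qed

end

section \<open>Hyperplane arrangements and geometric shards\<close>

definition hyp :: "'v::euclidean_space \<Rightarrow> 'v set" where "hyp a = {v. a \<bullet> v = 0}"

text \<open>A connected set avoiding the hyperplanes cannot change a sign, and conversely the set of
  points with given signs is convex.\<close>

lemma component_cell:
  fixes H :: "'v::euclidean_space set"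
  assumes H: "convex H" and z: "z \<in> H" "\<And>\<kappa>. \<kappa> \<in> K \<Longrightarrow> \<kappa> \<bullet> z \<noteq> 0"
  shows "connected_component_set (H - \<Union>(hyp ` K)) z = {v \<in> H. \<forall>\<kappa>\<in>K. 0 < (\<kappa> \<bullet> z) * (\<kappa> \<bullet> v)}" (is "?C = ?D")
proof
  show "?C \<subseteq> ?D"
  proof
    fix v assume "v \<in> ?C"
    then obtain T where T: "connected T" "T \<subseteq> H - \<Union>(hyp ` K)" "z \<in> T" "v \<in> T"
      by (auto simp: connected_component_def)
    have "0 < (\<kappa> \<bullet> z) * (\<kappa> \<bullet> v)" if k: "\<kappa> \<in> K" for \<kappa>
    proof (rule ccontr)
      assume n: "\<not> ?thesis"
      have ne: "\<kappa> \<bullet> y \<noteq> 0" if "y \<in> T" for y using T(2) k that by (auto simp: hyp_def)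
      have "\<kappa> \<bullet> z \<le> 0 \<and> 0 \<le> \<kappa> \<bullet> v \<or> \<kappa> \<bullet> v \<le> 0 \<and> 0 \<le> \<kappa> \<bullet> z"
        using n by (auto simp: zero_less_mult_iff)
      then have "\<exists>y\<in>T. \<kappa> \<bullet> y = 0"
        using connected_ivt_hyperplane[OF T(1), of z v \<kappa> 0] connected_ivt_hyperplane[OF T(1), of v z \<kappa> 0] T by blast
      then show False using ne by blast
    qed
    then show "v \<in> ?D" using T by auto
  qed
  have "convex ?D"
  proof -
    have "?D = H \<inter> (\<Inter>\<kappa>\<in>K. {v. ((\<kappa> \<bullet> z) *\<^sub>R \<kappa>) \<bullet> v > 0})" by auto
    then show ?thesis using H by (simp only:) (intro convex_Int convex_INT convex_halfspace_gt)
  qed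
  moreover have "0 < (\<kappa> \<bullet> z) * (\<kappa> \<bullet> z)" if "\<kappa> \<in> K" for \<kappa>
    using z(2)[OF that] not_real_square_gt_zero by blast
  then have "z \<in> ?D" using z(1) by blast
  moreover have "?D \<subseteq> H - \<Union>(hyp ` K)" by (auto simp: hyp_def)
  ultimately show "?D \<subseteq> ?C" by (intro connected_component_maximal convex_connected)
qed

text \<open>A small move from a point of the weak cell towards \<open>z\<close> makes all the
  inequalities strict.\<close>

lemma closure_cell:
  fixes H :: "'v::euclidean_space set"
  assumes H: "convex H" "closed H" and z: "z \<in> H" "\<And>\<kappa>. \<kappa> \<in> K \<Longrightarrow> \<kappa> \<bullet> z \<noteq> 0"
  shows "closure {v \<in> H. \<forall>\<kappa>\<in>K. 0 < (\<kappa> \<bullet> z) * (\<kappa> \<bullet> v)} = {v \<in> H. \<forall>\<kappa>\<in>K. 0 \<le> (\<kappa> \<bullet> z) * (\<kappa> \<bullet> v)}" (is "closure ?D = ?E")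
proof
  have "?E = H \<inter> (\<Inter>\<kappa>\<in>K. {v. ((\<kappa> \<bullet> z) *\<^sub>R \<kappa>) \<bullet> v \<ge> 0})" by auto
  moreover have "closed (H \<inter> (\<Inter>\<kappa>\<in>K. {v. ((\<kappa> \<bullet> z) *\<^sub>R \<kappa>) \<bullet> v \<ge> 0}))"
    using H by (intro closed_Int closed_INT ballI closed_halfspace_ge)
  ultimately have "closed ?E" by simp
  then show "closure ?D \<subseteq> ?E" by (rule closure_minimal[rotated]) (auto simp: less_imp_le)
  show "?E \<subseteq> closure ?D"
  proof
    fix v assume v: "v \<in> ?E"
    let ?g = "\<lambda>t::real. (1 - t) *\<^sub>R v + t *\<^sub>R z"
    have "(?g \<longlongrightarrow> (1 - 0) *\<^sub>R v + 0 *\<^sub>R z) (at_right 0)" by (intro tendsto_intros)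
    then have lim: "(?g \<longlongrightarrow> v) (at_right 0)" by simp
    have "\<forall>\<^sub>F t in at_right 0. (0::real) < t \<and> t < 1"
      using eventually_at_right_real[of 0 "1::real"] by (simp add: greaterThanLessThan_iff)
    then have "\<forall>\<^sub>F t in at_right 0. ?g t \<in> closure ?D"
    proof eventually_elim
      case (elim t)
      have "0 < (\<kappa> \<bullet> z) * (\<kappa> \<bullet> ?g t)" if k: "\<kappa> \<in> K" for \<kappa>
      proof -
        have "0 \<le> (\<kappa> \<bullet> z) * (\<kappa> \<bullet> v)" using v k by blast
        then have "0 \<le> (1 - t) * ((\<kappa> \<bullet> z) * (\<kappa> \<bullet> v))" using elim by (intro mult_nonneg_nonneg[of "1 - t"]) auto
        moreover have "0 < t * ((\<kappa> \<bullet> z) * (\<kappa> \<bullet> z))"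
          using z(2)[OF k] not_real_square_gt_zero elim by (intro mult_pos_pos[of t]) blast+
        ultimately show ?thesis by (simp add: inner_add_right algebra_simps)
      qed
      moreover have "?g t \<in> H" using v z elim H(1) by (intro convexD) auto
      ultimately have "?g t \<in> ?D" by blast
      then show ?case by (rule subsetD[OF closure_subset])
    qed
    then show "v \<in> closure ?D"
      using Lim_in_closed_set[OF closed_closure _ _ lim] by simp
  qed
qed

lemma closure_components:
  fixes H :: "'v::euclidean_space set"
  assumes H: "convex H" "closed H"
  shows "C \<in> closure ` components (H - \<Union>(hyp ` K)) \<longleftrightarrow>
    (\<exists>z\<in>H. (\<forall>\<kappa>\<in>K. \<kappa> \<bullet> z \<noteq> 0) \<and> C = {v \<in> H. \<forall>\<kappa>\<in>K. 0 \<le> (\<kappa> \<bullet> z) * (\<kappa> \<bullet> v)})"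
proof -
  have m: "z \<in> H - \<Union>(hyp ` K) \<longleftrightarrow> z \<in> H \<and> (\<forall>\<kappa>\<in>K. \<kappa> \<bullet> z \<noteq> 0)" for z by (auto simp: hyp_def)
  have c: "closure (connected_component_set (H - \<Union>(hyp ` K)) z) = {v \<in> H. \<forall>\<kappa>\<in>K. 0 \<le> (\<kappa> \<bullet> z) * (\<kappa> \<bullet> v)}"
    if "z \<in> H" "\<forall>\<kappa>\<in>K. \<kappa> \<bullet> z \<noteq> 0" for z
    using component_cell[OF H(1) that(1), of K] closure_cell[OF H that(1), of K] that(2) by simp
  have "C \<in> closure ` components (H - \<Union>(hyp ` K)) \<longleftrightarrow>
    (\<exists>z. z \<in> H - \<Union>(hyp ` K) \<and> C = closure (connected_component_set (H - \<Union>(hyp ` K)) z))"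
    by (auto simp: components_def)
  also have "\<dots> \<longleftrightarrow> (\<exists>z\<in>H. (\<forall>\<kappa>\<in>K. \<kappa> \<bullet> z \<noteq> 0) \<and> C = {v \<in> H. \<forall>\<kappa>\<in>K. 0 \<le> (\<kappa> \<bullet> z) * (\<kappa> \<bullet> v)})"
    unfolding m Bex_def conj_assoc
    by (intro arg_cong[of _ _ Ex] ext conj_cong HOL.refl) (simp add: c)
  finally show ?thesis .
qed

lemma hyp_subset_scale:
  assumes "norm b = 1" "hyp b \<subseteq> hyp a" shows "a = (a \<bullet> b) *\<^sub>R b"
proof -
  let ?d = "a - (a \<bullet> b) *\<^sub>R b"
  have bd: "b \<bullet> ?d = 0" using assms(1) by (simp add: inner_diff_right dot_square_norm inner_commute)
  then have "a \<bullet> ?d = 0" using assms(2) by (auto simp: hyp_def)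
  then have "?d \<bullet> ?d = 0" using bd by (simp add: inner_diff_left)
  then show ?thesis by simp
qed

lemma hyp_subset_eq:
  assumes "norm a = 1" "norm b = 1" "0 < a \<bullet> x" "0 < b \<bullet> x" "hyp b \<subseteq> hyp a" shows "a = b"
proof -
  have e: "a = (a \<bullet> b) *\<^sub>R b" using hyp_subset_scale assms by blast
  then have "norm a = \<bar>a \<bullet> b\<bar> * norm b" by (metis norm_scaleR)
  then have "\<bar>a \<bullet> b\<bar> = 1" using assms by simp
  moreover have "a \<bullet> x = (a \<bullet> b) * (b \<bullet> x)" using e by (metis inner_scaleR_left)
  then have "0 < a \<bullet> b" using assms zero_less_mult_pos2 by metis
  ultimately show ?thesis using e by simp
qed

lemma hyp_aff_dim: "a \<noteq> 0 \<Longrightarrow> aff_dim (hyp (a::'v::euclidean_space)) = int DIM('v) - 1"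
  unfolding hyp_def by (simp add: aff_dim_hyperplane)

lemma affine_hyp: "affine (hyp a)"
  unfolding hyp_def by (rule affine_hyperplane)

lemma closed_hyp: "closed (hyp a)"
  unfolding hyp_def by (rule closed_hyperplane)

lemma affine_hull_hyp:
  fixes T :: "'v::euclidean_space set"
  assumes "T \<subseteq> hyp a" "a \<noteq> 0" "aff_dim T = int DIM('v) - 1" "T \<noteq> {}" shows "affine hull T = hyp a"
  using assms hyp_aff_dim[OF assms(2)]
  by (intro affine_dim_equal) (auto simp: affine_hyp hull_minimal)

lemma affine_hull_near:
  fixes T :: "'v::euclidean_space set"
  assumes "T \<subseteq> hyp a" "a \<noteq> 0" "open U" "f \<in> U" "a \<bullet> f = 0" "U \<inter> hyp a \<subseteq> T"
  shows "affine hull T = hyp a" "aff_dim T = int DIM('v) - 1"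
proof -
  have "hyp a \<inter> U \<noteq> {}" using assms by (auto simp: hyp_def)
  then have "affine hull (hyp a \<inter> U) = affine hull (hyp a)"
    by (rule affine_hull_affine_Int_open[OF affine_hyp assms(3)])
  then have "affine hull (hyp a \<inter> U) = hyp a" using hull_same[of affine "hyp a"] affine_hyp by simp
  moreover have "affine hull (hyp a \<inter> U) \<subseteq> affine hull T" using assms(6) by (intro hull_mono) blast
  moreover have "affine hull T \<subseteq> hyp a" using assms(1) affine_hyp by (rule hull_minimal)
  ultimately show e: "affine hull T = hyp a" by simp
  then show "aff_dim T = int DIM('v) - 1" using aff_dim_affine_hull[of T] hyp_aff_dim[OF assms(2)] by simp
qed

lemma relint_zero:
  fixes T :: "'v::euclidean_space set"
  assumes "convex T" "c \<in> rel_interior T" "\<And>v. v \<in> T \<Longrightarrow> 0 \<le> g \<bullet> v" "g \<bullet> c = 0" shows "T \<subseteq> hyp g"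
proof -
  have f: "T \<inter> {v. g \<bullet> v = 0} face_of T"
    using assms(1,3) by (rule face_of_Int_supporting_hyperplane_ge)
  have "c \<in> T" using assms(2) rel_interior_subset by blast
  then have "(T \<inter> {v. g \<bullet> v = 0}) \<inter> rel_interior T \<noteq> {}" using assms(2,4) by blast
  then have "T \<subseteq> T \<inter> {v. g \<bullet> v = 0}" by (rule subset_of_face_of[OF f order_refl])
  then show ?thesis by (auto simp: hyp_def)
qed

lemma open_positive:
  fixes \<Psi> :: "'v::euclidean_space set"
  shows "finite \<Psi> \<Longrightarrow> open {v. \<forall>\<gamma>\<in>\<Psi>. 0 < \<gamma> \<bullet> v}"
proof -
  assume "finite \<Psi>"
  then have "open (\<Inter>\<gamma>\<in>\<Psi>. {v. \<gamma> \<bullet> v > 0})" by (intro open_INT ballI open_halfspace_gt)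
  moreover have "(\<Inter>\<gamma>\<in>\<Psi>. {v. \<gamma> \<bullet> v > 0}) = {v. \<forall>\<gamma>\<in>\<Psi>. 0 < \<gamma> \<bullet> v}" by auto
  ultimately show ?thesis by simp
qed

text \<open>Take a relative interior point \<open>c\<close> of a facet. Every member of
  \<open>\<Psi>\<close> vanishing at \<open>c\<close> vanishes on the facet, whose affine hull is
  one hyperplane; unit length and positivity at \<open>x\<close> then leave a single member, and
  \<open>c\<close> is its witness. Conversely, near a witness the hyperplane is contained in the
  cone.\<close>

lemma facets_of_cone:
  fixes \<Psi> :: "'v::euclidean_space set"
  assumes fin: "finite \<Psi>" and u: "\<And>\<gamma>. \<gamma> \<in> \<Psi> \<Longrightarrow> norm \<gamma> = 1" and x: "\<And>\<gamma>. \<gamma> \<in> \<Psi> \<Longrightarrow> 0 < \<gamma> \<bullet> x"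
  shows "facet_hyperplanes {v. \<forall>\<gamma>\<in>\<Psi>. 0 \<le> \<gamma> \<bullet> v} = hyp ` {\<kappa>. basic \<Psi> \<kappa>}"
proof -
  let ?R = "{v. \<forall>\<gamma>\<in>\<Psi>. 0 \<le> \<gamma> \<bullet> v}"
  have O: "open {v. \<forall>\<gamma>\<in>\<Psi>. 0 < \<gamma> \<bullet> v}" by (rule open_positive[OF fin])
  have sub: "{v. \<forall>\<gamma>\<in>\<Psi>. 0 < \<gamma> \<bullet> v} \<subseteq> interior ?R" using O by (intro interior_maximal) (auto simp: less_imp_le)
  then have "interior ?R \<noteq> {}" using x by blast
  then have dim: "aff_dim ?R = int DIM('v)" by (rule aff_dim_nonempty_interior)
  have conv: "convex ?R"
  proof -
    have "?R = (\<Inter>\<gamma>\<in>\<Psi>. {v. \<gamma> \<bullet> v \<ge> 0})" by auto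
    then show ?thesis by (simp only:) (intro convex_INT convex_halfspace_ge)
  qed
  have nz: "\<gamma> \<noteq> 0" if "\<gamma> \<in> \<Psi>" for \<gamma> using u[OF that] by auto
  show ?thesis
  proof (intro equalityI subsetI)
    fix H assume "H \<in> facet_hyperplanes ?R"
    then obtain F where F: "F face_of ?R" "F \<noteq> {}" "aff_dim F = aff_dim ?R - 1" "H = affine hull F"
      by (auto simp: facet_hyperplanes_def facet_of_def)
    have cF: "convex F" using F(1) by (rule face_of_imp_convex)
    then obtain c where c: "c \<in> rel_interior F" using F(2) rel_interior_eq_empty by blast
    then have cF2: "c \<in> F" using rel_interior_subset by blast
    have FR: "F \<subseteq> ?R" using F(1) by (rule face_of_imp_subset)
    have zero: "F \<subseteq> hyp \<gamma>" if "\<gamma> \<in> \<Psi>" "\<gamma> \<bullet> c = 0" for \<gamma>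
      using relint_zero[OF cF c, of \<gamma>] FR that by blast
    have hull: "affine hull F = hyp \<gamma>" if "\<gamma> \<in> \<Psi>" "\<gamma> \<bullet> c = 0" for \<gamma>
      using affine_hull_hyp[OF zero[OF that] nz[OF that(1)]] F(2,3) dim by simp
    have "F \<noteq> ?R" using F(3) by auto
    then have "c \<notin> interior ?R" using face_of_disjoint_interior[OF F(1)] cF2 by blast
    then have "\<not> (\<forall>\<gamma>\<in>\<Psi>. 0 < \<gamma> \<bullet> c)" using sub by blast
    then obtain \<kappa> where k: "\<kappa> \<in> \<Psi>" "\<not> 0 < \<kappa> \<bullet> c" by blast
    then have k0: "\<kappa> \<bullet> c = 0" using FR cF2 by force
    have "0 < \<gamma> \<bullet> c" if g: "\<gamma> \<in> \<Psi>" "\<gamma> \<noteq> \<kappa>" for \<gamma>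
    proof (rule ccontr)
      assume "\<not> ?thesis"
      then have "\<gamma> \<bullet> c = 0" using FR cF2 g by force
      then have "hyp \<kappa> \<subseteq> hyp \<gamma>" using hull[OF g(1)] hull[OF k(1) k0] by simp
      then show False using hyp_subset_eq[of \<gamma> \<kappa> x] u x g k by blast
    qed
    then have "basic \<Psi> \<kappa>" using k k0 by (auto simp: basic_def)
    then show "H \<in> hyp ` {\<kappa>. basic \<Psi> \<kappa>}" using hull[OF k(1) k0] F(4) by blast
  next
    fix H assume "H \<in> hyp ` {\<kappa>. basic \<Psi> \<kappa>}"
    then obtain \<kappa> f where k: "\<kappa> \<in> \<Psi>" "H = hyp \<kappa>" "\<kappa> \<bullet> f = 0" "\<forall>\<gamma>\<in>\<Psi>. \<gamma> \<noteq> \<kappa> \<longrightarrow> 0 < \<gamma> \<bullet> f"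
      by (auto simp: basic_def)
    let ?F = "?R \<inter> {v. \<kappa> \<bullet> v = 0}"
    let ?O = "{v. \<forall>\<gamma>\<in>\<Psi> - {\<kappa>}. 0 < \<gamma> \<bullet> v}"
    have o: "open ?O" "f \<in> ?O" using fin k by (auto intro: open_positive)
    have n: "?O \<inter> hyp \<kappa> \<subseteq> ?F"
    proof
      fix v assume v: "v \<in> ?O \<inter> hyp \<kappa>"
      have "0 \<le> \<gamma> \<bullet> v" if "\<gamma> \<in> \<Psi>" for \<gamma>
        using v that by (cases "\<gamma> = \<kappa>") (auto simp: hyp_def less_imp_le)
      then show "v \<in> ?F" using v by (auto simp: hyp_def)
    qed
    have s: "?F \<subseteq> hyp \<kappa>" by (auto simp: hyp_def)
    note A = affine_hull_near[OF s nz[OF k(1)] o k(3) n]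
    have "?F face_of ?R" using conv k(1) by (intro face_of_Int_supporting_hyperplane_ge) auto
    moreover have "f \<in> ?O \<inter> hyp \<kappa>" using o(2) k(3) by (simp add: hyp_def)
    then have "?F \<noteq> {}" using n by blast
    ultimately have "?F facet_of ?R" using A(2) dim by (simp add: facet_of_def)
    then show "H \<in> facet_hyperplanes ?R" using A(1) k(2) unfolding facet_hyperplanes_def by blast
  qed
qed

text \<open>The part of \<open>c\<close> orthogonal to the plane of \<open>a\<close> and
  \<open>b\<close> lies on both hyperplanes, hence is orthogonal to \<open>c\<close> and vanishes.
  This converts codimension two intersections into planes of roots.\<close>

lemma hyp_Int_subset: "hyp a \<inter> hyp b \<subseteq> hyp c \<longleftrightarrow> c \<in> span {a, b}"
proof
  assume s: "hyp a \<inter> hyp b \<subseteq> hyp c"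
  obtain y z where yz: "y \<in> span {a, b}" "\<And>w. w \<in> span {a, b} \<Longrightarrow> orthogonal z w" "c = y + z"
    using orthogonal_subspace_decomp_exists[of "{a, b}" c] by blast
  have "orthogonal z a" "orthogonal z b" "orthogonal z y" using yz by (auto intro: span_base)
  then have "a \<bullet> z = 0" "b \<bullet> z = 0" "y \<bullet> z = 0" by (auto simp: orthogonal_def inner_commute)
  moreover from this have "c \<bullet> z = 0" using s by (auto simp: hyp_def)
  ultimately have "z \<bullet> z = 0" using yz(3) by (simp add: inner_add_left)
  then show "c \<in> span {a, b}" using yz by simp
next
  assume "c \<in> span {a, b}"
  then show "hyp a \<inter> hyp b \<subseteq> hyp c" using span_orthogonal[of c "{a, b}"] by (auto simp: hyp_def)
qed

section \<open>Regions, cutting and shards expressed by roots\<close>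

context reflection_system
begin

definition "arr = hyp ` \<Phi>p"
definition "base = {v. \<forall>\<beta>\<in>\<Phi>p. 0 \<le> \<beta> \<bullet> v}"

lemma hyp_eq: "\<beta> \<in> \<Phi>p \<Longrightarrow> \<gamma> \<in> \<Phi>p \<Longrightarrow> hyp \<beta> \<subseteq> hyp \<gamma> \<Longrightarrow> \<beta> = \<gamma>"
  using hyp_subset_eq[of \<gamma> \<beta> x] root_unit by (auto simp: \<Phi>p_def)

lemma hyp_inj: "inj_on hyp \<Phi>p"
  by (rule inj_onI) (use hyp_eq in blast)

lemma x_base: "x \<in> base" by (auto simp: base_def \<Phi>p_def)

lemma region_image:
  assumes w: "w \<in> G" shows "w ` base = {v. \<forall>\<beta>\<in>\<Phi>p. 0 \<le> (\<beta> \<bullet> w x) * (\<beta> \<bullet> v)}"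
proof (intro equalityI subsetI)
  fix v assume "v \<in> w ` base"
  then obtain b where b: "b \<in> base" "v = w b" by blast
  have "0 \<le> (\<beta> \<bullet> w x) * (\<beta> \<bullet> v)" if "\<beta> \<in> \<Phi>p" for \<beta>
  proof -
    have "0 \<le> (\<gamma> \<bullet> x) * (\<gamma> \<bullet> b)" if "\<gamma> \<in> \<Phi>" for \<gamma>
      using pos_cases[OF that]
    proof
      assume "\<gamma> \<in> \<Phi>p"
      then show ?thesis using b(1) by (simp add: base_def \<Phi>p_def)
    next
      assume g: "- \<gamma> \<in> \<Phi>p"
      then have "0 \<le> - \<gamma> \<bullet> b" using b(1) unfolding base_def by blast
      then show ?thesis using g by (simp add: \<Phi>p_def zero_le_mult_iff)
    qed
    then show ?thesis using root_inv[OF pos_root[OF that] w] b(2) inner_inv[OF w] by simp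
  qed
  then show "v \<in> {v. \<forall>\<beta>\<in>\<Phi>p. 0 \<le> (\<beta> \<bullet> w x) * (\<beta> \<bullet> v)}" by blast
next
  fix v assume v: "v \<in> {v. \<forall>\<beta>\<in>\<Phi>p. 0 \<le> (\<beta> \<bullet> w x) * (\<beta> \<bullet> v)}"
  have "0 \<le> \<gamma> \<bullet> ginv w v" if g: "\<gamma> \<in> \<Phi>p" for \<gamma>
  proof -
    have r: "w \<gamma> \<in> \<Phi>" using g w pos_root root_image by blast
    have "0 \<le> (w \<gamma> \<bullet> w x) * (w \<gamma> \<bullet> v)" using v pos_cases[OF r] by fastforce
    moreover have "0 < w \<gamma> \<bullet> w x" using g inner_G[OF w] by (simp add: \<Phi>p_def)
    ultimately have "0 \<le> w \<gamma> \<bullet> v" by (simp add: zero_le_mult_iff)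
    then show ?thesis using inner_inv'[OF w] by simp
  qed
  then have "w (ginv w v) \<in> w ` base" by (auto simp: base_def)
  then show "v \<in> w ` base" by (simp add: inv_right[OF w])
qed

text \<open>Any separating normal is a multiple of \<open>\<beta>\<close>, and since the base region
  contains \<open>x\<close>, the factor is positive.\<close>

lemma separates_iff:
  assumes w: "w \<in> G" and b: "\<beta> \<in> \<Phi>p" shows "separates (hyp \<beta>) (w ` base) base \<longleftrightarrow> \<beta> \<in> inversions w"
proof
  assume "separates (hyp \<beta>) (w ` base) base"
  then obtain a where a: "a \<noteq> 0" "hyp \<beta> = hyp a" "w ` base \<subseteq> {v. a \<bullet> v \<le> 0}" "base \<subseteq> {v. 0 \<le> a \<bullet> v}"
    by (auto simp: separates_def hyp_def)
  define c where "c = a \<bullet> \<beta>"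
  have ac: "a = c *\<^sub>R \<beta>"
    unfolding c_def using hyp_subset_scale[of \<beta> a] a root_unit pos_root b by blast
  have "0 \<le> c * (\<beta> \<bullet> x)" using a(4) x_base ac by auto
  then have c: "0 < c" using a(1) ac b by (auto simp: \<Phi>p_def zero_le_mult_iff less_le)
  have "c * (\<beta> \<bullet> w x) \<le> 0" using a(3) x_base ac by auto
  then have "\<beta> \<bullet> w x \<le> 0" using c by (simp add: mult_le_0_iff)
  then show "\<beta> \<in> inversions w" using generic_G[OF pos_root[OF b] w] b by (simp add: inversions_def)
next
  assume "\<beta> \<in> inversions w"
  then have "\<beta> \<bullet> w x < 0" by (simp add: inversions_def)
  then have "w ` base \<subseteq> {v. \<beta> \<bullet> v \<le> 0}" unfolding region_image[OF w] using b by (auto simp: zero_le_mult_iff)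
  moreover have "base \<subseteq> {v. 0 \<le> \<beta> \<bullet> v}" using b by (auto simp: base_def)
  ultimately show "separates (hyp \<beta>) (w ` base) base"
    using root_nz[OF pos_root[OF b]] unfolding separates_def hyp_def by blast
qed

lemma separating_set_eq: "w \<in> G \<Longrightarrow> separating_set arr base (w ` base) = hyp ` inversions w"
  using separates_iff by (auto simp: separating_set_def arr_def inversions_def)

lemma separating_subset:
  assumes "u \<in> G" "w \<in> G"
  shows "separating_set arr base (u ` base) \<subseteq> separating_set arr base (w ` base) \<longleftrightarrow> inversions u \<subseteq> inversions w"
  unfolding separating_set_eq[OF assms(1)] separating_set_eq[OF assms(2)]
  by (rule inj_on_image_subset_iff[OF hyp_inj]) (auto simp: inversions_def)

lemma rank_two_eq: "rank_two_subarrangement arr (hyp \<kappa>) (hyp \<beta>) = hyp ` (\<Phi>p \<inter> span {\<kappa>, \<beta>})"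
  using hyp_Int_subset by (auto simp: rank_two_subarrangement_def arr_def)

text \<open>A region of the rank two subarrangement containing \<open>base\<close> contains
  \<open>x\<close>, which fixes all its signs. So the definite description denotes the cone of the
  roots in the plane, and \<open>facets_of_cone\<close> applies.\<close>

lemma basic_hyperplanes_eq:
  "basic_hyperplanes arr base (hyp \<kappa>) (hyp \<beta>) = hyp ` {\<gamma>. basic (\<Phi>p \<inter> span {\<kappa>, \<beta>}) \<gamma>}"
proof -
  let ?P = "\<Phi>p \<inter> span {\<kappa>, \<beta>}"
  let ?R = "{v. \<forall>\<gamma>\<in>?P. 0 \<le> \<gamma> \<bullet> v}"
  have reg: "R \<in> regions (hyp ` ?P) \<longleftrightarrow> (\<exists>z. (\<forall>\<gamma>\<in>?P. \<gamma> \<bullet> z \<noteq> 0) \<and> R = {v. \<forall>\<gamma>\<in>?P. 0 \<le> (\<gamma> \<bullet> z) * (\<gamma> \<bullet> v)})" for R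
    using closure_components[of UNIV R ?P] by (simp add: regions_def Compl_eq_Diff_UNIV)
  have cell: "{v. \<forall>\<gamma>\<in>?P. 0 \<le> (\<gamma> \<bullet> z) * (\<gamma> \<bullet> v)} = ?R" if "\<And>\<gamma>. \<gamma> \<in> ?P \<Longrightarrow> 0 < \<gamma> \<bullet> z" for z
  proof -
    have "0 \<le> (\<gamma> \<bullet> z) * r \<longleftrightarrow> 0 \<le> r" if "\<gamma> \<in> ?P" for \<gamma> r
      using \<open>\<And>\<gamma>. \<gamma> \<in> ?P \<Longrightarrow> 0 < \<gamma> \<bullet> z\<close>[OF that] by (simp add: zero_le_mult_iff)
    then show ?thesis by (intro Collect_cong ball_cong HOL.refl)
  qed
  have px: "0 < \<gamma> \<bullet> x" if "\<gamma> \<in> ?P" for \<gamma> using that by (simp add: \<Phi>p_def)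
  have "(THE R. R \<in> regions (hyp ` ?P) \<and> base \<subseteq> R) = ?R"
  proof (rule the_equality)
    have "?R \<in> regions (hyp ` ?P)" unfolding reg using cell[OF px] px by (intro exI[of _ x]) force
    then show "?R \<in> regions (hyp ` ?P) \<and> base \<subseteq> ?R" by (auto simp: base_def)
    fix R assume R: "R \<in> regions (hyp ` ?P) \<and> base \<subseteq> R"
    then obtain z where z: "\<forall>\<gamma>\<in>?P. \<gamma> \<bullet> z \<noteq> 0" "R = {v. \<forall>\<gamma>\<in>?P. 0 \<le> (\<gamma> \<bullet> z) * (\<gamma> \<bullet> v)}" using reg by blast
    have "0 < \<gamma> \<bullet> z" if g: "\<gamma> \<in> ?P" for \<gamma>
    proof -
      have "0 \<le> (\<gamma> \<bullet> z) * (\<gamma> \<bullet> x)" using R z(2) x_base g by blast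
      then show ?thesis using z(1) g px[OF g] by (auto simp: zero_le_mult_iff less_le)
    qed
    then show "R = ?R" using cell z(2) by blast
  qed
  moreover have "facet_hyperplanes ?R = hyp ` {\<gamma>. basic ?P \<gamma>}"
  proof (rule facets_of_cone)
    show "finite ?P" using finite_pos by simp
    show "norm \<gamma> = 1" if "\<gamma> \<in> ?P" for \<gamma> using that root_unit pos_root by blast
    show "0 < \<gamma> \<bullet> x" if "\<gamma> \<in> ?P" for \<gamma> using px[OF that] .
  qed
  ultimately show ?thesis unfolding basic_hyperplanes_def rank_two_eq by simp
qed

lemma cuts_iff:
  assumes "\<kappa> \<in> \<Phi>p" "\<beta> \<in> \<Phi>p" shows "cuts arr base (hyp \<kappa>) (hyp \<beta>) \<longleftrightarrow> cut_by \<kappa> \<beta>"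
proof -
  have "hyp \<gamma> \<in> hyp ` {\<gamma>. basic (\<Phi>p \<inter> span {\<kappa>, \<beta>}) \<gamma>} \<longleftrightarrow> basic (\<Phi>p \<inter> span {\<kappa>, \<beta>}) \<gamma>" if "\<gamma> \<in> \<Phi>p" for \<gamma>
    using hyp_inj that by (auto simp: basic_def dest: inj_onD)
  moreover have "hyp \<kappa> = hyp \<beta> \<longleftrightarrow> \<kappa> = \<beta>" using hyp_inj assms by (auto dest: inj_onD)
  ultimately show ?thesis unfolding cuts_def basic_hyperplanes_eq cut_by_def using assms by (auto simp: arr_def)
qed

text \<open>The parameter \<open>z\<close> only supplies the sides of the cutting hyperplanes and
  need not lie on the hyperplane of \<open>\<beta>\<close>; so \<open>w x\<close> can be used for
  the lower shards of \<open>w\<close>.\<close>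

definition "shard \<beta> z = {v. \<beta> \<bullet> v = 0 \<and> (\<forall>\<kappa>. cut_by \<kappa> \<beta> \<longrightarrow> 0 \<le> (\<kappa> \<bullet> z) * (\<kappa> \<bullet> v))}"

lemma shards_in_iff:
  assumes "\<beta> \<in> \<Phi>p"
  shows "\<Sigma> \<in> shards_in arr base (hyp \<beta>) \<longleftrightarrow>
    (\<exists>z. \<beta> \<bullet> z = 0 \<and> (\<forall>\<kappa>. cut_by \<kappa> \<beta> \<longrightarrow> \<kappa> \<bullet> z \<noteq> 0) \<and> \<Sigma> = shard \<beta> z)"
proof -
  have "{K. cuts arr base K (hyp \<beta>)} = hyp ` {\<kappa>. cut_by \<kappa> \<beta>}"
  proof (intro equalityI subsetI)
    fix K assume "K \<in> {K. cuts arr base K (hyp \<beta>)}"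
    then have K: "cuts arr base K (hyp \<beta>)" by simp
    then obtain \<kappa> where "\<kappa> \<in> \<Phi>p" "K = hyp \<kappa>" by (auto simp: cuts_def arr_def)
    then show "K \<in> hyp ` {\<kappa>. cut_by \<kappa> \<beta>}" using K cuts_iff assms by blast
  qed (use cuts_iff assms in \<open>auto simp: cut_by_def\<close>)
  then have "\<Sigma> \<in> shards_in arr base (hyp \<beta>) \<longleftrightarrow>
    (\<exists>z\<in>hyp \<beta>. (\<forall>\<kappa>\<in>{\<kappa>. cut_by \<kappa> \<beta>}. \<kappa> \<bullet> z \<noteq> 0) \<and>
      \<Sigma> = {v \<in> hyp \<beta>. \<forall>\<kappa>\<in>{\<kappa>. cut_by \<kappa> \<beta>}. 0 \<le> (\<kappa> \<bullet> z) * (\<kappa> \<bullet> v)})"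
    unfolding shards_in_def
    using closure_components[of "hyp \<beta>" \<Sigma> "{\<kappa>. cut_by \<kappa> \<beta>}"]
    by (simp add: affine_imp_convex affine_hyp closed_hyp)
  also have "\<dots> \<longleftrightarrow> (\<exists>z. \<beta> \<bullet> z = 0 \<and> (\<forall>\<kappa>. cut_by \<kappa> \<beta> \<longrightarrow> \<kappa> \<bullet> z \<noteq> 0) \<and> \<Sigma> = shard \<beta> z)"
    unfolding shard_def hyp_def by simp
  finally show ?thesis .
qed

lemma shard_sign:
  assumes "\<And>\<kappa>. cut_by \<kappa> \<beta> \<Longrightarrow> 0 < (\<kappa> \<bullet> y) * (\<kappa> \<bullet> z)" shows "shard \<beta> y = shard \<beta> z"
proof -
  have "0 \<le> (\<kappa> \<bullet> y) * r \<longleftrightarrow> 0 \<le> (\<kappa> \<bullet> z) * r" if "cut_by \<kappa> \<beta>" for \<kappa> r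
    using assms[OF that] by (auto simp: zero_less_mult_iff zero_le_mult_iff)
  then show ?thesis unfolding shard_def by blast
qed

lemma finite_cut: "finite {\<kappa>. cut_by \<kappa> \<beta>}"
  by (rule finite_subset[OF _ finite_pos]) (auto simp: cut_by_def)

lemma open_same_sign:
  fixes z :: 'v
  assumes "finite A" shows "open {v. \<forall>\<gamma>\<in>A. 0 < (\<gamma> \<bullet> z) * (\<gamma> \<bullet> v)}"
  using open_positive[of "(\<lambda>\<gamma>. (\<gamma> \<bullet> z) *\<^sub>R \<gamma>) ` A"] assms by simp

lemma shard_hyperplane_eq:
  assumes b: "\<beta> \<in> \<Phi>p" and z: "\<beta> \<bullet> z = 0" "\<And>\<kappa>. cut_by \<kappa> \<beta> \<Longrightarrow> \<kappa> \<bullet> z \<noteq> 0"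
  shows "shard_hyperplane arr (shard \<beta> z) = hyp \<beta>"
proof -
  have s: "shard \<beta> z \<subseteq> hyp \<beta>" by (auto simp: shard_def hyp_def)
  let ?O = "{v. \<forall>\<kappa>\<in>{\<kappa>. cut_by \<kappa> \<beta>}. 0 < (\<kappa> \<bullet> z) * (\<kappa> \<bullet> v)}"
  have "0 < (\<kappa> \<bullet> z) * (\<kappa> \<bullet> z)" if "cut_by \<kappa> \<beta>" for \<kappa>
    using z(2)[OF that] not_real_square_gt_zero by blast
  then have "z \<in> ?O" by blast
  moreover have "?O \<inter> hyp \<beta> \<subseteq> shard \<beta> z" by (auto simp: shard_def hyp_def less_imp_le)
  ultimately have h: "affine hull (shard \<beta> z) = hyp \<beta>"
    using affine_hull_near(1)[OF s root_nz[OF pos_root[OF b]] open_same_sign[OF finite_cut] _ z(1)] by blast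
  show ?thesis unfolding shard_hyperplane_def
  proof (rule the_equality)
    show "hyp \<beta> \<in> arr \<and> shard \<beta> z \<subseteq> hyp \<beta>" using b s by (auto simp: arr_def)
    fix H assume H: "H \<in> arr \<and> shard \<beta> z \<subseteq> H"
    then obtain \<gamma> where g: "\<gamma> \<in> \<Phi>p" "H = hyp \<gamma>" by (auto simp: arr_def)
    have "hyp \<beta> \<subseteq> hyp \<gamma>" unfolding h[symmetric] using H g affine_hyp by (intro hull_minimal) auto
    then show "H = hyp \<beta>" using hyp_eq b g by blast
  qed
qed

text \<open>At a relative interior point of the intersection of region and shard,
  \<open>\<beta>\<close> is the only positive root that vanishes. It is thus a facet point for
  \<open>\<beta>\<close>, and the cutting roots have there the signs they have at
  \<open>w x\<close>. Conversely, around the facet point from \<open>cov_wall\<close> the hyperplane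
  lies in both region and shard, which gives the dimension.\<close>

lemma lower_shards_eq:
  assumes w: "w \<in> G" shows "lower_shards arr base (w ` base) = (\<lambda>\<beta>. shard \<beta> (w x)) ` cov w"
proof (intro equalityI subsetI)
  fix \<Sigma> assume "\<Sigma> \<in> lower_shards arr base (w ` base)"
  then have L: "\<Sigma> \<in> shards arr base" "aff_dim (w ` base \<inter> \<Sigma>) = int DIM('v) - 1"
    "shard_hyperplane arr \<Sigma> \<in> separating_set arr base (w ` base)" by (auto simp: lower_shards_def)
  obtain \<beta> where b: "\<beta> \<in> \<Phi>p" "\<Sigma> \<in> shards_in arr base (hyp \<beta>)" using L(1) by (auto simp: shards_def arr_def)
  obtain z where z: "\<beta> \<bullet> z = 0" "\<And>\<kappa>. cut_by \<kappa> \<beta> \<Longrightarrow> \<kappa> \<bullet> z \<noteq> 0" "\<Sigma> = shard \<beta> z"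
    using b(2) unfolding shards_in_iff[OF b(1)] by blast
  have "hyp \<beta> \<in> hyp ` inversions w"
  proof -
    have "shard_hyperplane arr \<Sigma> = hyp \<beta>"
      unfolding z(3) by (rule shard_hyperplane_eq[OF b(1) z(1)]) (rule z(2))
    then show ?thesis using L(3) separating_set_eq[OF w] by simp
  qed
  then have "\<beta> \<in> inversions w" using hyp_inj b(1) by (auto simp: inversions_def dest: inj_onD)
  then have bw: "\<beta> \<bullet> w x < 0" by (simp add: inversions_def)
  let ?T = "w ` base \<inter> \<Sigma>"
  have wb: "w ` base = (\<Inter>\<gamma>\<in>\<Phi>p. {v. ((\<gamma> \<bullet> w x) *\<^sub>R \<gamma>) \<bullet> v \<ge> 0})" unfolding region_image[OF w] by auto
  have sg: "\<Sigma> = hyp \<beta> \<inter> (\<Inter>\<kappa>\<in>{\<kappa>. cut_by \<kappa> \<beta>}. {v. ((\<kappa> \<bullet> z) *\<^sub>R \<kappa>) \<bullet> v \<ge> 0})"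
    unfolding z(3) shard_def hyp_def by auto
  have "convex (w ` base)" unfolding wb by (intro convex_INT convex_halfspace_ge)
  moreover have "convex \<Sigma>" unfolding sg by (intro convex_Int convex_INT convex_halfspace_ge affine_imp_convex affine_hyp)
  ultimately have cT: "convex ?T" by (rule convex_Int)
  have Tb: "?T \<subseteq> hyp \<beta>" unfolding sg by blast
  have "?T \<noteq> {}"
  proof
    assume "?T = {}"
    then have "int DIM('v) - 1 = - 1" using L(2) by (simp only: aff_dim_empty)
    then show False using DIM_positive[where 'a='v] by linarith
  qed
  then obtain c where c: "c \<in> rel_interior ?T" using cT rel_interior_eq_empty by blast
  then have cT2: "c \<in> ?T" using rel_interior_subset by blast
  have hull: "affine hull ?T = hyp \<beta>"
    using affine_hull_hyp[OF Tb root_nz[OF pos_root[OF b(1)]] L(2) \<open>?T \<noteq> {}\<close>] .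
  have nz: "\<gamma> \<bullet> c \<noteq> 0" if g: "\<gamma> \<in> \<Phi>p" "\<gamma> \<noteq> \<beta>" for \<gamma>
  proof
    assume g0: "\<gamma> \<bullet> c = 0"
    have "?T \<subseteq> hyp ((\<gamma> \<bullet> w x) *\<^sub>R \<gamma>)"
    proof (rule relint_zero[OF cT c])
      fix v assume "v \<in> ?T"
      then have "0 \<le> (\<gamma> \<bullet> w x) * (\<gamma> \<bullet> v)" using g(1) unfolding region_image[OF w] by blast
      then show "0 \<le> ((\<gamma> \<bullet> w x) *\<^sub>R \<gamma>) \<bullet> v" by simp
    qed (simp add: g0)
    then have "?T \<subseteq> hyp \<gamma>" using generic_G[OF pos_root[OF g(1)] w] by (auto simp: hyp_def)
    then have "hyp \<beta> \<subseteq> hyp \<gamma>" unfolding hull[symmetric] using affine_hyp by (rule hull_minimal)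
    then show False using hyp_eq b(1) g by blast
  qed
  have sgn: "0 < (\<gamma> \<bullet> w x) * (\<gamma> \<bullet> c)" if g: "\<gamma> \<in> \<Phi>p" "\<gamma> \<noteq> \<beta>" for \<gamma>
  proof -
    have "0 \<le> (\<gamma> \<bullet> w x) * (\<gamma> \<bullet> c)" using cT2 g(1) unfolding region_image[OF w] by blast
    then show ?thesis using nz[OF g] generic_G[OF pos_root[OF g(1)] w] by (simp add: less_le)
  qed
  have bc: "\<beta> \<bullet> c = 0" using cT2 Tb by (auto simp: hyp_def)
  have "\<beta> \<in> cov w"
  proof (rule wall_cov[OF w b(1) bw bc])
    fix \<gamma> assume g: "\<gamma> \<in> \<Phi>" "0 < \<gamma> \<bullet> w x" "\<gamma> \<noteq> - \<beta>"
    have "\<gamma> \<noteq> \<beta>" using g bw by auto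
    consider "\<gamma> \<in> \<Phi>p" | "- \<gamma> \<in> \<Phi>p" using pos_cases[OF g(1)] by blast
    then have "0 < (\<gamma> \<bullet> w x) * (\<gamma> \<bullet> c)"
    proof cases
      case 1 then show ?thesis using sgn \<open>\<gamma> \<noteq> \<beta>\<close> by blast
    next
      case 2
      then have "- \<gamma> \<noteq> \<beta>" using g(3) by auto
      then show ?thesis using sgn[OF 2] by simp
    qed
    then show "0 < \<gamma> \<bullet> c" using g(2) by (simp add: zero_less_mult_iff)
  qed
  moreover have "shard \<beta> z = shard \<beta> (w x)"
  proof (rule shard_sign)
    fix \<kappa> assume k: "cut_by \<kappa> \<beta>"
    then have kp: "\<kappa> \<in> \<Phi>p" "\<kappa> \<noteq> \<beta>" by (auto simp: cut_by_def)
    have "0 \<le> (\<kappa> \<bullet> z) * (\<kappa> \<bullet> c)" using cT2 k z(3) by (auto simp: shard_def)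
    then show "0 < (\<kappa> \<bullet> z) * (\<kappa> \<bullet> w x)"
      using sgn[OF kp] z(2)[OF k] by (auto simp: zero_le_mult_iff zero_less_mult_iff)
  qed
  ultimately show "\<Sigma> \<in> (\<lambda>\<beta>. shard \<beta> (w x)) ` cov w" using z(3) by blast
next
  fix \<Sigma> assume "\<Sigma> \<in> (\<lambda>\<beta>. shard \<beta> (w x)) ` cov w"
  then obtain \<beta> where b: "\<beta> \<in> cov w" "\<Sigma> = shard \<beta> (w x)" by blast
  have bp: "\<beta> \<in> \<Phi>p" using b cov_pos by blast
  obtain f where f: "\<beta> \<bullet> f = 0" "\<And>\<gamma>. \<gamma> \<in> \<Phi> \<Longrightarrow> 0 < \<gamma> \<bullet> w x \<Longrightarrow> \<gamma> \<noteq> - \<beta> \<Longrightarrow> 0 < \<gamma> \<bullet> f"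
    using cov_wall[OF w b(1)] by blast
  have sgn: "0 < (\<gamma> \<bullet> w x) * (\<gamma> \<bullet> f)" if g: "\<gamma> \<in> \<Phi>p" "\<gamma> \<noteq> \<beta>" for \<gamma>
  proof (cases "0 < \<gamma> \<bullet> w x")
    case True
    have "\<gamma> \<noteq> - \<beta>" using pos_neg[OF g(1)] bp by auto
    then show ?thesis using f(2)[OF pos_root[OF g(1)] True] True by simp
  next
    case False
    then have n: "\<gamma> \<bullet> w x < 0" using not_pos_G[OF pos_root[OF g(1)] w] by blast
    have "0 < (- \<gamma>) \<bullet> f" using f(2)[OF root_neg[OF pos_root[OF g(1)]]] n g(2) by simp
    then show ?thesis using n by (simp add: zero_less_mult_iff)
  qed
  have kf: "0 < (\<kappa> \<bullet> w x) * (\<kappa> \<bullet> f)" if "cut_by \<kappa> \<beta>" for \<kappa> using sgn that by (simp add: cut_by_def)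
  have e: "\<Sigma> = shard \<beta> f" unfolding b(2) by (rule shard_sign) (rule kf)
  have f0: "\<kappa> \<bullet> f \<noteq> 0" if "cut_by \<kappa> \<beta>" for \<kappa> using kf[OF that] by auto
  have "\<Sigma> \<in> shards_in arr base (hyp \<beta>)" unfolding shards_in_iff[OF bp] using f(1) f0 e by blast
  then have 1: "\<Sigma> \<in> shards arr base" using bp by (auto simp: shards_def arr_def)
  have 2: "shard_hyperplane arr \<Sigma> \<in> separating_set arr base (w ` base)"
  proof -
    have "shard_hyperplane arr \<Sigma> = hyp \<beta>"
      unfolding e by (rule shard_hyperplane_eq[OF bp f(1)]) (rule f0)
    moreover have "\<beta> \<in> inversions w" using cov_inv[OF w b(1)] bp by (simp add: inversions_def)
    ultimately show ?thesis unfolding separating_set_eq[OF w] by simp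
  qed
  let ?O = "{v. \<forall>\<gamma>\<in>\<Phi>p - {\<beta>}. 0 < (\<gamma> \<bullet> w x) * (\<gamma> \<bullet> v)}"
  have o: "open ?O" "f \<in> ?O" using open_same_sign[of "\<Phi>p - {\<beta>}" "w x"] finite_pos sgn by auto
  have s: "w ` base \<inter> \<Sigma> \<subseteq> hyp \<beta>" using b(2) by (auto simp: shard_def hyp_def)
  have n: "?O \<inter> hyp \<beta> \<subseteq> w ` base \<inter> \<Sigma>"
  proof
    fix v assume v: "v \<in> ?O \<inter> hyp \<beta>"
    have "0 \<le> (\<gamma> \<bullet> w x) * (\<gamma> \<bullet> v)" if "\<gamma> \<in> \<Phi>p" for \<gamma>
      using v that by (cases "\<gamma> = \<beta>") (auto simp: hyp_def less_imp_le)
    moreover from this have "v \<in> \<Sigma>" using v b(2) by (auto simp: shard_def hyp_def cut_by_def)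
    ultimately show "v \<in> w ` base \<inter> \<Sigma>" unfolding region_image[OF w] by blast
  qed
  have "aff_dim (w ` base \<inter> \<Sigma>) = int DIM('v) - 1"
    using affine_hull_near(2)[OF s root_nz[OF pos_root[OF bp]] o f(1) n] .
  then show "\<Sigma> \<in> lower_shards arr base (w ` base)" using 1 2 by (simp add: lower_shards_def)
qed

text \<open>If \<open>cov w\<close> is empty, both sides are the whole space, as the convention for
  the empty intersection demands.\<close>

lemma Inter_lower_shards: "w \<in> G \<Longrightarrow> \<Inter>(lower_shards arr base (w ` base)) = Psi w"
  unfolding lower_shards_eq by (auto simp: shard_def Psi_def)

end

section \<open>Coxeter groups acting by reflections\<close>

text \<open>Bijections between the fibres over each \<open>k\<close> are glued together. Here the
  counting is turned into a map, and nothing canonical is chosen.\<close>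

lemma card_eq_bij:
  assumes "finite A" "finite B" "\<And>k. card {a \<in> A. f a = k} = card {b \<in> B. g b = k}"
  shows "\<exists>F. bij_betw F A B \<and> (\<forall>a\<in>A. g (F a) = f a)"
proof -
  have "\<exists>h. bij_betw h {a \<in> A. f a = k} {b \<in> B. g b = k}" for k
    using assms by (intro finite_same_card_bij) auto
  then obtain h where h: "\<And>k. bij_betw (h k) {a \<in> A. f a = k} {b \<in> B. g b = k}" by metis
  define F where "F a = h (f a) a" for a
  have F: "F a \<in> B" "g (F a) = f a" if "a \<in> A" for a
    using bij_betwE[OF h[of "f a"]] that by (auto simp: F_def)
  have "bij_betw F A B"
  proof (rule bij_betwI')
    fix a b assume ab: "a \<in> A" "b \<in> A"
    show "F a = F b \<longleftrightarrow> a = b"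
    proof
      assume e: "F a = F b"
      then have "f a = f b" using F ab by metis
      then show "a = b" using bij_betw_imp_inj_on[OF h[of "f a"]] e ab by (auto simp: F_def dest: inj_onD)
    qed simp
  next
    fix b assume b: "b \<in> B"
    then have "b \<in> h (g b) ` {a \<in> A. f a = g b}" using bij_betw_imp_surj_on[OF h[of "g b"]] by simp
    then obtain a where a: "a \<in> A" "f a = g b" "b = h (g b) a" by blast
    then have "b = F a" by (simp add: F_def)
    then show "\<exists>a\<in>A. b = F a" using a(1) by blast
  qed (use F in blast)
  then show ?thesis using F by blast
qed

lemma reflect_uminus: "reflect (- a) = reflect a"
  by (simp add: reflect_def fun_eq_iff)

text \<open>The vectors negated by a reflection form a line, which determines its unit normal up to
  sign.\<close>

lemma reflect_inj:
  assumes "norm a = 1" "norm b = 1" "reflect a = reflect b" shows "a = b \<or> a = - b"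
proof -
  have "reflect b a = - a" using assms reflect_self[of a] by metis
  then have two: "2 *\<^sub>R a = 2 *\<^sub>R ((b \<bullet> a) *\<^sub>R b)" by (simp add: reflect_def scaleR_2 algebra_simps)
  have e: "a = (b \<bullet> a) *\<^sub>R b" by (rule scaleR_left_imp_eq[OF _ two]) simp
  then have "norm a = \<bar>b \<bullet> a\<bar> * norm b" by (metis norm_scaleR)
  then have "b \<bullet> a = 1 \<or> b \<bullet> a = - 1" using assms by auto
  then show ?thesis using e by (metis scaleR_minus1_left scaleR_one)
qed

lemma reflect_fixed: "norm a = 1 \<Longrightarrow> {v. reflect a v = v} = hyp a"
  by (auto simp: reflect_def hyp_def)

lemma hyp_uminus: "hyp (- a) = hyp a"
  by (simp add: hyp_def)

lemma is_reflection_reflect: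
  assumes "is_reflection f" shows "\<exists>a. norm a = 1 \<and> f = reflect a"
proof -
  obtain a where a: "a \<noteq> 0" "\<And>v. f v = v - (2 * (a \<bullet> v) / (a \<bullet> a)) *\<^sub>R a"
    using assms by (auto simp: is_reflection_def)
  let ?b = "(1 / norm a) *\<^sub>R a"
  have "f v = reflect ?b v" for v
    using a(1) by (simp add: a(2) reflect_def dot_square_norm power2_eq_square field_simps)
  then show ?thesis using a(1) by (intro exI[of _ ?b]) auto
qed

lemma word_append: "word (as @ bs) = word as \<circ> word bs"
  by (induction as) (simp_all add: comp_assoc)

locale reflection_action =
  fixes W :: "('g, 'b) monoid_scheme" and S :: "'g set"
    and \<rho> :: "'g \<Rightarrow> 'v::euclidean_space \<Rightarrow> 'v" and B :: "'v set" and x :: 'v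
  assumes grp: "group W" and S_sub: "S \<subseteq> carrier W" and S_gen: "generate W S = carrier W"
    and fin: "finite (carrier W)" and act: "acts_as_reflection_group W S \<rho>"
    and B_reg: "B \<in> regions (reflection_arrangement W S \<rho>)"
    and B_facets: "facet_hyperplanes B = fixed_hyperplane \<rho> ` S"
    and x_int: "x \<in> interior B"
begin

abbreviation "ref \<equiv> reflections W S"
definition "grp_maps = \<rho> ` carrier W"
definition "unit_roots = {\<beta>. norm \<beta> = 1 \<and> (\<exists>t\<in>ref. \<rho> t = reflect \<beta>)}"
definition "pos_roots = {\<beta> \<in> unit_roots. 0 < \<beta> \<bullet> x}"
text \<open>Read off from the region: the unit inward normals of the facets of \<open>B\<close>. The
  link to \<open>S\<close> is made by \<open>facets_simple\<close>.\<close>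

definition "simple_roots = {\<kappa>. basic pos_roots \<kappa>}"

lemma faithful: "faithful_action W UNIV \<rho>"
  using act by (simp add: acts_as_reflection_group_def)

lemma ga: "group_action W UNIV \<rho>"
  using faithful by (rule faithful_action.axioms)

lemma rho_one: "\<rho> \<one>\<^bsub>W\<^esub> = id"
  using group_action.id_eq_one[OF ga] by (simp add: fun_eq_iff)

lemma rho_mult: "g \<in> carrier W \<Longrightarrow> h \<in> carrier W \<Longrightarrow> \<rho> (g \<otimes>\<^bsub>W\<^esub> h) = \<rho> g \<circ> \<rho> h"
  using group_action.composition_rule[OF ga] by (simp add: fun_eq_iff)

lemma rho_inj: "inj_on \<rho> (carrier W)"
  using faithful by (simp add: faithful_action_def faithful_action_axioms_def)

lemma rho_inv: assumes "g \<in> carrier W" shows "\<rho> (inv\<^bsub>W\<^esub> g) = ginv (\<rho> g)"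
proof -
  have "\<rho> g \<circ> \<rho> (inv\<^bsub>W\<^esub> g) = id" "\<rho> (inv\<^bsub>W\<^esub> g) \<circ> \<rho> g = id"
    using rho_mult[of g "inv\<^bsub>W\<^esub> g"] rho_mult[of "inv\<^bsub>W\<^esub> g" g] rho_one assms
      group.inv_closed[OF grp assms] group.r_inv[OF grp assms] group.l_inv[OF grp assms] by simp_all
  then show ?thesis by (metis inv_unique_comp)
qed

lemma rho_orth: "g \<in> carrier W \<Longrightarrow> orthogonal_transformation (\<rho> g)"
  using act by (simp add: acts_as_reflection_group_def)

lemma S_root: "s \<in> S \<Longrightarrow> \<exists>a. norm a = 1 \<and> \<rho> s = reflect a"
  using act unfolding acts_as_reflection_group_def by (intro is_reflection_reflect) blast

lemma reflect_image:
  assumes "g \<in> carrier W" shows "\<rho> g \<circ> reflect a \<circ> ginv (\<rho> g) = reflect (\<rho> g a)"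
proof -
  have "\<rho> g (reflect a v) = reflect (\<rho> g a) (\<rho> g v)" for v
    using rho_orth[OF assms] orthogonal_transformation_linear[of "\<rho> g"]
    by (simp add: reflect_def linear_diff linear_cmul orthogonal_transformation_def)
  moreover have "\<rho> g (ginv (\<rho> g) v) = v" for v
    using orthogonal_transformation_surj[OF rho_orth[OF assms]] by (simp add: surj_f_inv_f)
  ultimately show ?thesis by (simp add: fun_eq_iff)
qed

lemma rho_conj:
  assumes "w \<in> carrier W" "t \<in> carrier W" "\<rho> t = reflect a"
  shows "\<rho> (w \<otimes>\<^bsub>W\<^esub> t \<otimes>\<^bsub>W\<^esub> inv\<^bsub>W\<^esub> w) = reflect (\<rho> w a)"
  using assms rho_mult rho_inv[OF assms(1)] reflect_image[OF assms(1)]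
    group.inv_closed[OF grp assms(1)] monoid.m_closed[OF group.is_monoid[OF grp]] by simp

lemma rho_norm: "w \<in> carrier W \<Longrightarrow> norm (\<rho> w a) = norm a"
  using rho_orth orthogonal_transformation_norm by blast

lemma ref_carrier: "t \<in> ref \<Longrightarrow> t \<in> carrier W"
  using S_sub group.inv_closed[OF grp] monoid.m_closed[OF group.is_monoid[OF grp]]
  by (auto simp: reflections_def subset_iff)

lemma S_ref: assumes "s \<in> S" shows "s \<in> ref"
proof -
  have c: "s \<in> carrier W" using assms S_sub by blast
  have "\<one>\<^bsub>W\<^esub> \<otimes>\<^bsub>W\<^esub> s \<otimes>\<^bsub>W\<^esub> inv\<^bsub>W\<^esub> \<one>\<^bsub>W\<^esub> = s"
    using c grp monoid.inv_one[OF group.is_monoid[OF grp]] monoid.l_one[OF group.is_monoid[OF grp] c]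
      monoid.r_one[OF group.is_monoid[OF grp] c] by simp
  moreover have "\<one>\<^bsub>W\<^esub> \<in> carrier W" by (rule monoid.one_closed[OF group.is_monoid[OF grp]])
  ultimately show ?thesis using assms unfolding reflections_def mem_Collect_eq by metis
qed

lemma ref_root:
  assumes "t \<in> ref" shows "\<exists>w\<in>carrier W. \<exists>s\<in>S. \<exists>a. norm a = 1 \<and> \<rho> s = reflect a \<and> \<rho> t = reflect (\<rho> w a)"
proof -
  obtain w s where w: "w \<in> carrier W" "s \<in> S" "t = w \<otimes>\<^bsub>W\<^esub> s \<otimes>\<^bsub>W\<^esub> inv\<^bsub>W\<^esub> w"
    using assms by (auto simp: reflections_def)
  obtain a where a: "norm a = 1" "\<rho> s = reflect a" using S_root w by blast
  then have "\<rho> t = reflect (\<rho> w a)" using rho_conj[OF w(1) _ a(2)] w S_sub by blast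
  then show ?thesis using w a by blast
qed

lemma ref_unit_root: assumes "t \<in> ref" shows "\<exists>a\<in>unit_roots. \<rho> t = reflect a"
proof -
  obtain w a where w: "w \<in> carrier W" "norm a = 1" "\<rho> t = reflect (\<rho> w a)" using ref_root[OF assms] by blast
  then have "\<rho> w a \<in> unit_roots" using assms rho_norm[OF w(1)] unfolding unit_roots_def by auto
  then show ?thesis using w(3) by blast
qed

lemma ref_conj:
  assumes "g \<in> carrier W" "t \<in> ref" shows "g \<otimes>\<^bsub>W\<^esub> t \<otimes>\<^bsub>W\<^esub> inv\<^bsub>W\<^esub> g \<in> ref"
proof -
  interpret group W by (rule grp)
  obtain w s where w: "w \<in> carrier W" "s \<in> S" "t = w \<otimes>\<^bsub>W\<^esub> s \<otimes>\<^bsub>W\<^esub> inv\<^bsub>W\<^esub> w"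
    using assms by (auto simp: reflections_def)
  have s: "s \<in> carrier W" using w S_sub by blast
  have "g \<otimes>\<^bsub>W\<^esub> t \<otimes>\<^bsub>W\<^esub> inv\<^bsub>W\<^esub> g = (g \<otimes>\<^bsub>W\<^esub> w) \<otimes>\<^bsub>W\<^esub> s \<otimes>\<^bsub>W\<^esub> inv\<^bsub>W\<^esub> (g \<otimes>\<^bsub>W\<^esub> w)"
    using assms(1) w s by (simp add: inv_mult_group m_assoc)
  moreover have "g \<otimes>\<^bsub>W\<^esub> w \<in> carrier W" using assms(1) w by simp
  ultimately show ?thesis using w(2) unfolding reflections_def by blast
qed

lemma unit_roots_image:
  assumes "g \<in> carrier W" "\<beta> \<in> unit_roots" shows "\<rho> g \<beta> \<in> unit_roots"
proof -
  obtain t where t: "t \<in> ref" "\<rho> t = reflect \<beta>" "norm \<beta> = 1" using assms by (auto simp: unit_roots_def)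
  have "\<rho> (g \<otimes>\<^bsub>W\<^esub> t \<otimes>\<^bsub>W\<^esub> inv\<^bsub>W\<^esub> g) = reflect (\<rho> g \<beta>)" using rho_conj[OF assms(1) ref_carrier[OF t(1)] t(2)] .
  then show ?thesis using ref_conj[OF assms(1) t(1)] rho_norm[OF assms(1)] t(3) unfolding unit_roots_def by auto
qed

lemma unit_roots_neg: "\<beta> \<in> unit_roots \<Longrightarrow> - \<beta> \<in> unit_roots"
  by (simp add: unit_roots_def reflect_uminus)

lemma arrangement_eq: "reflection_arrangement W S \<rho> = hyp ` unit_roots"
proof (intro equalityI subsetI)
  fix H assume "H \<in> reflection_arrangement W S \<rho>"
  then obtain t where t: "t \<in> ref" "H = {v. \<rho> t v = v}" by (auto simp: reflection_arrangement_def fixed_hyperplane_def)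
  obtain a where a: "a \<in> unit_roots" "\<rho> t = reflect a" using ref_unit_root[OF t(1)] by blast
  have "H = hyp a" unfolding t(2) a(2) using a(1) by (intro reflect_fixed) (simp add: unit_roots_def)
  then show "H \<in> hyp ` unit_roots" using a by blast
next
  fix H assume "H \<in> hyp ` unit_roots"
  then obtain a t where a: "norm a = 1" "H = hyp a" "t \<in> ref" "\<rho> t = reflect a" by (auto simp: unit_roots_def)
  then have "H = fixed_hyperplane \<rho> t" using reflect_fixed[OF a(1)] by (simp add: fixed_hyperplane_def)
  then show "H \<in> reflection_arrangement W S \<rho>" using a by (auto simp: reflection_arrangement_def)
qed

text \<open>As a region, \<open>B\<close> is the closed sign cell of some generic \<open>z\<close>.
  An interior point of \<open>B\<close> is interior to each bounding half-space, so it has the signs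
  of \<open>z\<close> strictly.\<close>

lemma x_generic_B: "\<exists>z. B = {v. \<forall>\<kappa>\<in>unit_roots. 0 \<le> (\<kappa> \<bullet> z) * (\<kappa> \<bullet> v)} \<and> (\<forall>\<kappa>\<in>unit_roots. 0 < (\<kappa> \<bullet> z) * (\<kappa> \<bullet> x))"
proof -
  have "B \<in> closure ` components (UNIV - \<Union>(hyp ` unit_roots))"
    using B_reg by (simp add: regions_def arrangement_eq Compl_eq_Diff_UNIV)
  then obtain z where z: "\<forall>\<kappa>\<in>unit_roots. \<kappa> \<bullet> z \<noteq> 0" "B = {v. \<forall>\<kappa>\<in>unit_roots. 0 \<le> (\<kappa> \<bullet> z) * (\<kappa> \<bullet> v)}"
    using closure_components[of UNIV B unit_roots] by auto
  have "0 < (\<kappa> \<bullet> z) * (\<kappa> \<bullet> x)" if k: "\<kappa> \<in> unit_roots" for \<kappa>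
  proof -
    let ?c = "(\<kappa> \<bullet> z) *\<^sub>R \<kappa>"
    have c0: "?c \<noteq> 0" using z(1) k by (auto simp: unit_roots_def)
    have "B \<subseteq> {v. ?c \<bullet> v \<ge> 0}" unfolding z(2) using k by auto
    then have "interior B \<subseteq> interior {v. ?c \<bullet> v \<ge> 0}" by (rule interior_mono)
    also have "\<dots> = {v. ?c \<bullet> v > 0}" by (rule interior_halfspace_ge[OF c0])
    finally show ?thesis using x_int by auto
  qed
  then show ?thesis using z by blast
qed

lemma unit_roots_generic: "\<kappa> \<in> unit_roots \<Longrightarrow> \<kappa> \<bullet> x \<noteq> 0"
  using x_generic_B by force

lemma unit_roots_cases: "\<kappa> \<in> unit_roots \<Longrightarrow> \<kappa> \<in> pos_roots \<or> - \<kappa> \<in> pos_roots"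
  using unit_roots_generic unit_roots_neg by (auto simp: pos_roots_def not_less less_le)

lemma B_eq: "B = {v. \<forall>\<kappa>\<in>pos_roots. 0 \<le> \<kappa> \<bullet> v}"
proof -
  obtain z where z: "B = {v. \<forall>\<kappa>\<in>unit_roots. 0 \<le> (\<kappa> \<bullet> z) * (\<kappa> \<bullet> v)}"
    "\<forall>\<kappa>\<in>unit_roots. 0 < (\<kappa> \<bullet> z) * (\<kappa> \<bullet> x)" using x_generic_B by blast
  have pz: "0 < \<kappa> \<bullet> z" if "\<kappa> \<in> pos_roots" for \<kappa>
    using z(2) that by (auto simp: pos_roots_def zero_less_mult_iff)
  show ?thesis
  proof (intro equalityI subsetI)
    fix v assume v: "v \<in> B"
    have "0 \<le> \<kappa> \<bullet> v" if k: "\<kappa> \<in> pos_roots" for \<kappa>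
    proof -
      have "0 \<le> (\<kappa> \<bullet> z) * (\<kappa> \<bullet> v)" using v k unfolding z(1) pos_roots_def by blast
      then show ?thesis using pz[OF k] by (simp add: zero_le_mult_iff)
    qed
    then show "v \<in> {v. \<forall>\<kappa>\<in>pos_roots. 0 \<le> \<kappa> \<bullet> v}" by blast
  next
    fix v assume v: "v \<in> {v. \<forall>\<kappa>\<in>pos_roots. 0 \<le> \<kappa> \<bullet> v}"
    have "0 \<le> (\<kappa> \<bullet> z) * (\<kappa> \<bullet> v)" if k: "\<kappa> \<in> unit_roots" for \<kappa>
      using unit_roots_cases[OF k]
    proof
      assume p: "\<kappa> \<in> pos_roots"
      then have "0 \<le> \<kappa> \<bullet> v" using v by blast
      then show ?thesis using pz[OF p] by simp
    next
      assume p: "- \<kappa> \<in> pos_roots"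
      then have "0 \<le> - \<kappa> \<bullet> v" using v by blast
      then show ?thesis using pz[OF p] by (simp add: zero_le_mult_iff)
    qed
    then show "v \<in> B" unfolding z(1) by blast
  qed
qed

lemma finite_maps: "finite grp_maps"
  unfolding grp_maps_def using fin by simp

lemma finite_pos_roots: "finite pos_roots"
proof (rule inj_on_finite[of reflect _ grp_maps])
  show "inj_on reflect pos_roots"
  proof (rule inj_onI)
    fix a b assume ab: "a \<in> pos_roots" "b \<in> pos_roots" "reflect a = reflect b"
    then have "a = b \<or> a = - b" by (intro reflect_inj) (auto simp: pos_roots_def unit_roots_def)
    moreover have "a \<noteq> - b" using ab by (auto simp: pos_roots_def)
    ultimately show "a = b" by blast
  qed
  show "reflect ` pos_roots \<subseteq> grp_maps"
    using ref_carrier by (auto simp: pos_roots_def unit_roots_def grp_maps_def) (metis imageI)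
qed (rule finite_maps)

lemma facets_simple: "hyp ` simple_roots = fixed_hyperplane \<rho> ` S"
proof -
  have "facet_hyperplanes {v. \<forall>\<gamma>\<in>pos_roots. 0 \<le> \<gamma> \<bullet> v} = hyp ` {\<kappa>. basic pos_roots \<kappa>}"
    by (rule facets_of_cone[OF finite_pos_roots]) (auto simp: pos_roots_def unit_roots_def)
  then show ?thesis using B_facets unfolding B_eq[symmetric] simple_roots_def by simp
qed

lemma simple_sub: "simple_roots \<subseteq> pos_roots"
  by (auto simp: simple_roots_def basic_def)

lemma pos_hyp_eq: "a \<in> pos_roots \<Longrightarrow> b \<in> pos_roots \<Longrightarrow> hyp a = hyp b \<Longrightarrow> a = b"
  using hyp_subset_eq[of a b x] by (auto simp: pos_roots_def unit_roots_def)

lemma S_pos_root: assumes "s \<in> S" obtains a where "a \<in> pos_roots" "\<rho> s = reflect a" "fixed_hyperplane \<rho> s = hyp a"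
proof -
  obtain b where b: "norm b = 1" "\<rho> s = reflect b" using S_root assms by blast
  then have "b \<in> unit_roots" using S_ref assms by (auto simp: unit_roots_def)
  then obtain a where a: "a \<in> pos_roots" "\<rho> s = reflect a"
    using unit_roots_cases[of b] b(2) reflect_uminus[of b] by metis
  have "fixed_hyperplane \<rho> s = hyp a"
    unfolding fixed_hyperplane_def a(2) using a(1) by (intro reflect_fixed) (simp add: pos_roots_def unit_roots_def)
  then show ?thesis using that a by blast
qed

lemma S_simple_root: assumes "s \<in> S" shows "\<exists>a\<in>simple_roots. \<rho> s = reflect a"
proof -
  obtain a where a: "a \<in> pos_roots" "\<rho> s = reflect a" "fixed_hyperplane \<rho> s = hyp a" using S_pos_root[OF assms] .
  have "hyp a \<in> hyp ` simple_roots" unfolding facets_simple using a(3) assms by blast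
  then obtain b where b: "b \<in> simple_roots" "hyp a = hyp b" by blast
  then have "a = b" using pos_hyp_eq a(1) simple_sub by blast
  then show ?thesis using a b by blast
qed

lemma simple_root_S: assumes "a \<in> simple_roots" shows "\<exists>s\<in>S. \<rho> s = reflect a"
proof -
  have "hyp a \<in> fixed_hyperplane \<rho> ` S" unfolding facets_simple[symmetric] using assms by blast
  then obtain s where s: "s \<in> S" "hyp a = fixed_hyperplane \<rho> s" by blast
  obtain b where b: "b \<in> pos_roots" "\<rho> s = reflect b" "fixed_hyperplane \<rho> s = hyp b" using S_pos_root[OF s(1)] .
  have "a = b" using pos_hyp_eq b s assms simple_sub by auto
  then show ?thesis using s b by blast
qed

text \<open>Every reflection is conjugate to a simple one, which yields its normal up to sign. The
  sign is absorbed by a further simple reflection, which sends \<open>a\<close> to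
  \<open>- a\<close>.\<close>

lemma roots_eq: "roots grp_maps simple_roots = unit_roots"
proof (intro equalityI subsetI)
  fix \<beta> assume "\<beta> \<in> roots grp_maps simple_roots"
  then obtain g a where "g \<in> carrier W" "a \<in> simple_roots" "\<beta> = \<rho> g a" by (auto simp: roots_def grp_maps_def)
  then show "\<beta> \<in> unit_roots" using unit_roots_image simple_sub by (auto simp: pos_roots_def)
next
  fix \<beta> assume "\<beta> \<in> unit_roots"
  then obtain t where t: "norm \<beta> = 1" "t \<in> ref" "\<rho> t = reflect \<beta>" by (auto simp: unit_roots_def)
  obtain w s where w: "w \<in> carrier W" "s \<in> S" "t = w \<otimes>\<^bsub>W\<^esub> s \<otimes>\<^bsub>W\<^esub> inv\<^bsub>W\<^esub> w"
    using t(2) by (auto simp: reflections_def)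
  have sc: "s \<in> carrier W" using w S_sub by blast
  obtain a where a: "a \<in> simple_roots" "\<rho> s = reflect a" using S_simple_root w by blast
  have an: "norm a = 1" using a simple_sub by (auto simp: pos_roots_def unit_roots_def)
  have "reflect \<beta> = reflect (\<rho> w a)" using rho_conj[OF w(1) sc a(2)] w(3) t(3) by simp
  then have "\<beta> = \<rho> w a \<or> \<beta> = - \<rho> w a" using reflect_inj[OF t(1), of "\<rho> w a"] rho_norm[OF w(1)] an by simp
  then show "\<beta> \<in> roots grp_maps simple_roots"
  proof
    assume "\<beta> = \<rho> w a"
    then show ?thesis using w a by (auto simp: roots_def grp_maps_def)
  next
    assume b: "\<beta> = - \<rho> w a"
    have "\<rho> (w \<otimes>\<^bsub>W\<^esub> s) a = \<rho> w (- a)" using rho_mult[OF w(1) sc] a(2) reflect_self[OF an] by simp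
    also have "\<dots> = \<beta>" using b rho_orth[OF w(1)] by (simp add: linear_neg orthogonal_transformation_linear)
    finally have "\<beta> = \<rho> (w \<otimes>\<^bsub>W\<^esub> s) a" by simp
    moreover have "w \<otimes>\<^bsub>W\<^esub> s \<in> carrier W" using monoid.m_closed[OF group.is_monoid[OF grp] w(1) sc] .
    ultimately show ?thesis using a by (auto simp: roots_def grp_maps_def)
  qed
qed

lemma word_ex: assumes "w \<in> carrier W" shows "\<exists>as. set as \<subseteq> simple_roots \<and> \<rho> w = word as"
proof -
  have "w \<in> generate W S" using assms S_gen by simp
  then have "w \<in> carrier W \<and> (\<exists>as. set as \<subseteq> simple_roots \<and> \<rho> w = word as)"
  proof (induction rule: generate.induct)
    case one
    then show ?case using rho_one monoid.one_closed[OF group.is_monoid[OF grp]]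
      by (intro conjI exI[of _ "[]"]) auto
  next
    case (incl h)
    obtain a where "a \<in> simple_roots" "\<rho> h = reflect a" using S_simple_root incl by blast
    then show ?case using incl S_sub by (intro conjI exI[of _ "[a]"]) auto
  next
    case (inv h)
    have hc: "h \<in> carrier W" using inv S_sub by blast
    obtain a where a: "a \<in> simple_roots" "\<rho> h = reflect a" using S_simple_root inv by blast
    have "norm a = 1" using a simple_sub by (auto simp: pos_roots_def unit_roots_def)
    then have "ginv (reflect a) = reflect a" by (intro inv_unique_comp) (auto simp: fun_eq_iff reflect_reflect)
    then have "\<rho> (inv\<^bsub>W\<^esub> h) = word [a]" using rho_inv[OF hc] a by simp
    then show ?case using a(1) group.inv_closed[OF grp hc] by (intro conjI exI[of _ "[a]"]) auto
  next
    case (eng h1 h2)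
    then obtain as bs where ab: "set as \<subseteq> simple_roots" "\<rho> h1 = word as" "set bs \<subseteq> simple_roots" "\<rho> h2 = word bs" by blast
    then have "\<rho> (h1 \<otimes>\<^bsub>W\<^esub> h2) = word (as @ bs)" using rho_mult eng.IH by (simp add: word_append)
    then show ?case using ab eng.IH monoid.m_closed[OF group.is_monoid[OF grp]]
      by (intro conjI exI[of _ "as @ bs"]) auto
  qed
  then show ?thesis by blast
qed

lemma reflection_system: "reflection_system grp_maps simple_roots x"
proof
  show "finite grp_maps" by (rule finite_maps)
  show "orthogonal_transformation g" if "g \<in> grp_maps" for g using that rho_orth by (auto simp: grp_maps_def)
  show "id \<in> grp_maps"
    unfolding grp_maps_def rho_one[symmetric] by (intro imageI monoid.one_closed[OF group.is_monoid[OF grp]])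
  show "g \<circ> h \<in> grp_maps" if gh: "g \<in> grp_maps" "h \<in> grp_maps" for g h
  proof -
    obtain u v where "u \<in> carrier W" "g = \<rho> u" "v \<in> carrier W" "h = \<rho> v" using gh by (auto simp: grp_maps_def)
    then show ?thesis unfolding grp_maps_def
      using rho_mult[of u v] monoid.m_closed[OF group.is_monoid[OF grp]] by (metis imageI)
  qed
  show "ginv g \<in> grp_maps" if g: "g \<in> grp_maps" for g
  proof -
    obtain u where u: "u \<in> carrier W" "g = \<rho> u" using g by (auto simp: grp_maps_def)
    show ?thesis unfolding grp_maps_def u(2) rho_inv[OF u(1), symmetric]
      by (intro imageI group.inv_closed[OF grp u(1)])
  qed
  show "finite simple_roots" using finite_pos_roots simple_sub by (rule rev_finite_subset)
  show "norm \<alpha> = 1" if "\<alpha> \<in> simple_roots" for \<alpha> using that simple_sub by (auto simp: pos_roots_def unit_roots_def)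
  show "reflect \<alpha> \<in> grp_maps" if "\<alpha> \<in> simple_roots" for \<alpha>
    using simple_root_S[OF that] S_sub unfolding grp_maps_def by (metis imageI subsetD)
  show "\<exists>as. set as \<subseteq> simple_roots \<and> g = word as" if "g \<in> grp_maps" for g
    using that word_ex by (auto simp: grp_maps_def)
  show "\<beta> \<bullet> x \<noteq> 0" if "\<beta> \<in> roots grp_maps simple_roots" for \<beta> using that unit_roots_generic roots_eq by blast
  show "0 < \<alpha> \<bullet> x" if "\<alpha> \<in> simple_roots" for \<alpha> using that simple_sub by (auto simp: pos_roots_def)
  fix \<alpha> \<beta> assume a: "\<alpha> \<in> simple_roots" and b: "\<beta> \<in> roots grp_maps simple_roots" "0 < \<beta> \<bullet> x" "\<beta> \<noteq> \<alpha>"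
  \<comment> \<open>The facet point \<open>f\<close> decides the sign of
    \<open>reflect \<alpha> \<beta>\<close>: there the root has the same positive value as
    \<open>\<beta>\<close>, whereas the negative of a positive root is never positive at
    \<open>f\<close>.\<close>
  obtain f where f: "\<alpha> \<bullet> f = 0" "\<And>\<gamma>. \<gamma> \<in> pos_roots \<Longrightarrow> \<gamma> \<noteq> \<alpha> \<Longrightarrow> 0 < \<gamma> \<bullet> f"
    using a by (auto simp: simple_roots_def basic_def)
  have bp: "\<beta> \<in> pos_roots" using b by (simp add: roots_eq pos_roots_def)
  obtain s where s: "s \<in> S" "\<rho> s = reflect \<alpha>" using simple_root_S[OF a] by blast
  then have "s \<in> carrier W" using S_sub by blast
  then have r: "reflect \<alpha> \<beta> \<in> unit_roots" using unit_roots_image[of s \<beta>] s(2) bp by (simp add: pos_roots_def)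
  have "reflect \<alpha> \<beta> \<bullet> f = \<beta> \<bullet> f" using f(1) by (simp add: reflect_def inner_diff_left)
  then have pf: "0 < reflect \<alpha> \<beta> \<bullet> f" using f(2)[OF bp b(3)] by simp
  show "0 < reflect \<alpha> \<beta> \<bullet> x"
  proof (rule ccontr)
    assume n: "\<not> ?thesis"
    then have "- reflect \<alpha> \<beta> \<in> pos_roots" using unit_roots_cases[OF r] by (auto simp: pos_roots_def)
    then have "0 \<le> - reflect \<alpha> \<beta> \<bullet> f"
      using f(1) f(2)[of "- reflect \<alpha> \<beta>"] by (cases "- reflect \<alpha> \<beta> = \<alpha>") (simp, linarith)
    then show False using pf by simp
  qed
qed

section \<open>Transfer from the group of maps to the abstract group\<close>

sublocale sys: reflection_system grp_maps simple_roots x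
  by (rule reflection_system)

lemma sys_pos: "sys.\<Phi>p = pos_roots"
  by (simp add: sys.\<Phi>p_def roots_eq pos_roots_def)

lemma sys_base: "sys.base = B"
  by (simp add: sys.base_def sys_pos B_eq)

lemma sys_arr: "sys.arr = reflection_arrangement W S \<rho>"
proof -
  have "hyp b \<in> hyp ` pos_roots" if "b \<in> unit_roots" for b
    using unit_roots_cases[OF that] hyp_uminus[of b] by (metis imageI)
  then show ?thesis unfolding sys.arr_def sys_pos arrangement_eq by (auto simp: pos_roots_def)
qed

lemma rho_in: "w \<in> carrier W \<Longrightarrow> \<rho> w \<in> grp_maps"
  by (simp add: grp_maps_def)

lemma Bex_grp_maps: "(\<exists>g\<in>grp_maps. Q g) \<longleftrightarrow> (\<exists>w\<in>carrier W. Q (\<rho> w))"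
  by (simp add: grp_maps_def)

lemma sys_weak:
  assumes "u \<in> carrier W" "w \<in> carrier W"
  shows "weak_le \<rho> (reflection_arrangement W S \<rho>) B u w \<longleftrightarrow> sys.inversions (\<rho> u) \<subseteq> sys.inversions (\<rho> w)"
  using sys.separating_subset[OF rho_in[OF assms(1)] rho_in[OF assms(2)]]
  by (simp add: weak_le_def sys_base sys_arr)

lemma sys_vle: "reverse_weak_vertex_le W \<rho> (reflection_arrangement W S \<rho>) B x = sys.vle"
proof (intro ext)
  fix p q
  show "reverse_weak_vertex_le W \<rho> (reflection_arrangement W S \<rho>) B x p q = sys.vle p q"
    unfolding reverse_weak_vertex_le_def sys.vle_def Bex_grp_maps
    by (intro bex_cong conj_cong HOL.refl) (rule sys_weak)
qed

lemma sys_perm: "permutohedron W \<rho> x = sys.perm"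
proof -
  have "{\<rho> w x |w. w \<in> carrier W} = (\<lambda>w. w x) ` grp_maps" by (auto simp: grp_maps_def)
  then show ?thesis by (simp add: permutohedron_def sys.perm_def)
qed

lemma sys_Psi:
  assumes "w \<in> carrier W" shows "shard_intersection \<rho> (reflection_arrangement W S \<rho>) B w = sys.Psi (\<rho> w)"
  using sys.Inter_lower_shards[OF rho_in[OF assms]] by (simp add: shard_intersection_def sys_arr sys_base)

lemma chains_bij:
  "bij_betw ((`) \<rho>) (order_complex (carrier W) (shard_le \<rho> (reflection_arrangement W S \<rho>) B)) {X. sys.is_chain X}"
proof (rule bij_betw_imageI)
  let ?E = "order_complex (carrier W) (shard_le \<rho> (reflection_arrangement W S \<rho>) B)"
  have iff: "C \<in> ?E \<longleftrightarrow> sys.is_chain (\<rho> ` C)" if C: "C \<subseteq> carrier W" for C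
  proof -
    have "finite C" using C fin by (rule finite_subset)
    moreover have "\<rho> ` C \<subseteq> grp_maps" using C by (auto simp: grp_maps_def)
    moreover have "shard_le \<rho> (reflection_arrangement W S \<rho>) B u w \<longleftrightarrow> sys.Psi (\<rho> w) \<subseteq> sys.Psi (\<rho> u)"
      if "u \<in> C" "w \<in> C" for u w
      using that C sys_Psi by (simp add: shard_le_def subset_iff)
    ultimately show ?thesis using C
      unfolding order_complex_def sys.is_chain_def Complete_Partial_Order.chain_def by simp
  qed
  have sub: "C \<subseteq> carrier W" if "C \<in> ?E" for C using that by (simp add: order_complex_def)
  show "inj_on ((`) \<rho>) ?E"
    using rho_inj sub by (intro inj_onI) (metis inj_on_image_eq_iff)
  show "(`) \<rho> ` ?E = {X. sys.is_chain X}"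
  proof (intro equalityI subsetI)
    fix X assume "X \<in> (`) \<rho> ` ?E"
    then obtain C where "C \<in> ?E" "X = \<rho> ` C" by blast
    then show "X \<in> {X. sys.is_chain X}" using iff[OF sub] by blast
  next
    fix X assume X: "X \<in> {X. sys.is_chain X}"
    then have "X \<subseteq> grp_maps" by (simp add: sys.is_chain_def)
    then have "X \<subseteq> \<rho> ` carrier W" by (simp only: grp_maps_def)
    then obtain C where C: "C \<subseteq> carrier W" "X = \<rho> ` C" by (auto simp: subset_image_iff)
    then have "C \<in> ?E" using iff X by blast
    then show "X \<in> (`) \<rho> ` ?E" using C by blast
  qed
qed

lemma simplex_chain_bijection:
  defines "T \<equiv> pulling_triangulation (reverse_weak_vertex_le W \<rho> (reflection_arrangement W S \<rho>) B x) (permutohedron W \<rho> x)"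
    and "E \<equiv> order_complex (carrier W) (shard_le \<rho> (reflection_arrangement W S \<rho>) B)"
  shows "\<exists>f. bij_betw f T E \<and> (\<forall>\<sigma>\<in>T. aff_dim \<sigma> = int (card (f \<sigma>)) - 1)"
proof -
  let ?D = "{X. sys.Dset X}" and ?C = "{X. sys.is_chain X}"
  have T: "T = sys.vhull ` ?D" unfolding T_def sys_vle sys_perm by (rule sys.pulling_triangulation_Dset)
  have "?D \<subseteq> Pow grp_maps" "?C \<subseteq> Pow grp_maps" using sys.Dset_finite by (auto simp: sys.is_chain_def)
  then have fin: "finite ?D" "finite ?C" using finite_maps by (meson finite_Pow_iff finite_subset)+
  have "\<exists>F. bij_betw F ?D ?C \<and> (\<forall>X\<in>?D. card (F X) = card X)"
    by (rule card_eq_bij[OF fin]) (use sys.card_Dset_chain in simp)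
  then obtain F where F: "bij_betw F ?D ?C" "\<And>X. X \<in> ?D \<Longrightarrow> card (F X) = card X" by blast
  let ?g = "inv_into ?D (\<lambda>X. sys.vhull X)" and ?h = "inv_into E ((`) \<rho>)"
  have g: "bij_betw ?g T ?D"
    unfolding T by (rule bij_betw_inv_into) (simp add: bij_betw_def sys.simplex_inj)
  have cb: "bij_betw ((`) \<rho>) E ?C" unfolding E_def by (rule chains_bij)
  then have h: "bij_betw ?h ?C E" by (rule bij_betw_inv_into)
  \<comment> \<open>The composite goes from a geometric simplex to its vertex set, to a chain of
    maps, to a chain of group elements. The last two maps preserve the number of elements, which
    \<open>aff_dim_simplex\<close> relates to the dimension of the simplex.\<close>
  have "bij_betw (?h \<circ> F \<circ> ?g) T E"
    by (intro bij_betw_trans[OF g] bij_betw_trans[OF F(1) h])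
  moreover have "aff_dim \<sigma> = int (card ((?h \<circ> F \<circ> ?g) \<sigma>)) - 1" if s: "\<sigma> \<in> T" for \<sigma>
  proof -
    have gs: "?g \<sigma> \<in> ?D" using g s by (rule bij_betw_apply)
    have e: "sys.vhull (?g \<sigma>) = \<sigma>" using s unfolding T by (rule f_inv_into_f)
    have Fc: "F (?g \<sigma>) \<in> ?C" using F(1) gs by (rule bij_betw_apply)
    have hE: "?h (F (?g \<sigma>)) \<in> E" using h Fc by (rule bij_betw_apply)
    have "F (?g \<sigma>) = \<rho> ` ?h (F (?g \<sigma>))"
      using bij_betw_inv_into_right[OF cb Fc] by simp
    moreover have "inj_on \<rho> (?h (F (?g \<sigma>)))"
      using rho_inj hE by (auto simp: E_def order_complex_def intro: inj_on_subset)
    ultimately have "card (F (?g \<sigma>)) = card (?h (F (?g \<sigma>)))" by (metis card_image)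
    then have "card (?h (F (?g \<sigma>))) = card (?g \<sigma>)" using F(2)[OF gs] by simp
    moreover have "aff_dim (sys.vhull (?g \<sigma>)) = int (card (?g \<sigma>)) - 1"
      using gs by (intro sys.aff_dim_simplex) simp
    ultimately show ?thesis unfolding e by simp
  qed
  ultimately show ?thesis by blast
qed

end

text \<open>A chain with \<open>k + 1\<close> elements has dimension \<open>k\<close>, and
  \<open>aff_dim {} = - 1\<close> fits the empty chain, so a single equation expresses preservation
  of dimension in all cases.\<close>

theorem theorem1p5:
  fixes W :: "('g, 'b) monoid_scheme" and S :: "'g set"
    and \<rho> :: "'g \<Rightarrow> 'v::euclidean_space \<Rightarrow> 'v" and B :: "'v set" and x :: 'v
    and \<A> :: "'v set set"
  assumes "coxeter_system W S" and "finite (carrier W)"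
    and "acts_as_reflection_group W S \<rho>"
    and "\<A> = reflection_arrangement W S \<rho>"
    and "B \<in> regions \<A>" and "facet_hyperplanes B = fixed_hyperplane \<rho> ` S"
    and "x \<in> interior B"
  shows "\<exists>f. bij_betw f
           (pulling_triangulation (reverse_weak_vertex_le W \<rho> \<A> B x) (permutohedron W \<rho> x))
           (order_complex (carrier W) (shard_le \<rho> \<A> B)) \<and>
         (\<forall>\<sigma> \<in> pulling_triangulation (reverse_weak_vertex_le W \<rho> \<A> B x) (permutohedron W \<rho> x).
           aff_dim \<sigma> = int (card (f \<sigma>)) - 1)"
proof -
  have "reflection_action W S \<rho> B x"
    using assms unfolding coxeter_system_def by (intro reflection_action.intro) auto
  then show ?thesis unfolding assms(4) by (rule reflection_action.simplex_chain_bijection)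
qed

end
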